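(* Let $d>3$ be an integer and write $n=\lfloor d/2\rfloor$. If $d=2n$, let $S_d\subset\mathbb{K}P^3$ be the surface $\sum_{j=0}^n t^{-j(j+1)}(\det A)^{n-j}f_{2j}(A)=0$, where each $f_{2j}$ is a homogeneous complex polynomial of degree $2j$ in the entries of a $2\times2$ matrix, not divisible by $\det$; if $d=2n+1$, let $S_d\subset\mathbb{K}P^3$ be the surface $\sum_{j=0}^n t^{-j(j+1)}(\det A)^{n-j}f_{2j+1}(A)=0$, where each $f_{2j+1}$ is a homogeneous complex polynomial of degree $2j+1$, not divisible by $\det$. Suppose all the polynomials $f_j$ are generic. Then there is no line $L\subset\mathbb{K}P^3$ such that $\operatorname{VAL}(L)\subset\operatorname{VAL}(S_d)$.
   Context: "Generic" means that the tuple of coefficients of the polynomials $f_j$ lies outside some proper Zariski-closed subset of the corresponding coefficient space. For a $2\times 2$ matrix $B=\begin{pmatrix}a&b\\ c&d\end{pmatrix}$ write $B^{\mathbf c}=\begin{pmatrix}d&-b\\ -c&a\end{pmatrix}$; $B^*$ is the conjugate transpose. $\mathbb{C}P^3$ is the projectivization of the space of complex $2\times2$ matrices and $[B]_{\mathbb{C}^*}$ the class of a nonzero matrix. $\mathbb{K}$ is the field of Puiseux series in $t$ (with $t\to\infty$) with complex coefficients, i.e. series $\sum_q a_q t^q$ with $a_q\in\mathbb{C}$ and exponents in $\frac1N\mathbb{Z}$ for some $N\ge1$, bounded above. $\mathbb{K}P^3$ is the projectivization of the space of $2\times 2$ matrices over $\mathbb{K}$. Every nonzero matrix $A$ over $\mathbb{K}$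 can be written uniquely as $A=t^\alpha B+(\text{terms with exponents}<\alpha)$ with $\alpha\in\mathbb{Q}$ and $B$ a nonzero complex matrix. The map $\operatorname{VAL}\colon\mathbb{K}P^3\to\mathbb{C}P^3$ is: if $\det A=0$, $\operatorname{VAL}([A])=[B]_{\mathbb{C}^*}$; if $\det A\ne0$, rescale $A$ so that $\det A=1$ (then $\alpha\ge0$), and set $\operatorname{VAL}([A])=[e^\alpha B+e^{-\alpha}(B^{\mathbf c})^*]_{\mathbb{C}^*}$. For a subset $X\subset\mathbb{K}P^3$, $\operatorname{VAL}(X)$ is its image (no closure is taken). *)

theory Defs
  imports Complex_Main
begin

datatype 'a mat2 = M2 'a 'a 'a 'a   (* M2 a b c d  =  [[a,b],[c,d]] *)

fun mentries :: "'a mat2 \<Rightarrow> 'a list" where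
  "mentries (M2 a b c e) = [a, b, c, e]"

fun mdet :: "'a::{times,minus} mat2 \<Rightarrow> 'a" where
  "mdet (M2 a b c e) = a * e - b * c"

fun msmult :: "'a::times \<Rightarrow> 'a mat2 \<Rightarrow> 'a mat2" where
  "msmult l (M2 a b c e) = M2 (l * a) (l * b) (l * c) (l * e)"

fun madd :: "'a::plus mat2 \<Rightarrow> 'a mat2 \<Rightarrow> 'a mat2" where
  "madd (M2 a b c e) (M2 a' b' c' e') = M2 (a + a') (b + b') (c + c') (e + e')"

definition mzero :: "'a::zero mat2" where
  "mzero = M2 0 0 0 0"

section \<open>The field K of Puiseux series in t (t \<rightarrow> \<infinity>)\<close>

text \<open>A series sum a_q t^q is represented by its coefficient function q \<mapsto> a_q;
  exponents lie in (1/N)Z for some N \<ge> 1 and are bounded above.\<close>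

definition is_puiseux :: "(rat \<Rightarrow> complex) \<Rightarrow> bool" where
  "is_puiseux f \<longleftrightarrow>
     (\<exists>N::nat. N > 0 \<and> (\<forall>q. f q \<noteq> 0 \<longrightarrow> (\<exists>k::int. q = of_int k / of_nat N)))
     \<and> (\<exists>M. \<forall>q. f q \<noteq> 0 \<longrightarrow> q \<le> M)"

typedef puiseux = "{f. is_puiseux f}"
proof
  show "(\<lambda>_. 0) \<in> {f. is_puiseux f}"
    unfolding is_puiseux_def by (auto intro!: exI[of _ "1::nat"])
qed

instantiation puiseux :: "{zero, one, plus, minus, uminus, times}"
begin
definition "0 = Abs_puiseux (\<lambda>_. 0)"
definition "1 = Abs_puiseux (\<lambda>q. if q = 0 then 1 else 0)"
definition "x + y = Abs_puiseux (\<lambda>q. Rep_puiseux x q + Rep_puiseux y q)"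
definition "x - y = Abs_puiseux (\<lambda>q. Rep_puiseux x q - Rep_puiseux y q)"
definition "- x = Abs_puiseux (\<lambda>q. - Rep_puiseux x q)"
definition "x * y = Abs_puiseux (\<lambda>q.
    \<Sum>r\<in>{r. Rep_puiseux x r \<noteq> 0 \<and> Rep_puiseux y (q - r) \<noteq> 0}.
       Rep_puiseux x r * Rep_puiseux y (q - r))"
instance ..
end

instance puiseux :: power ..

definition tpow :: "rat \<Rightarrow> puiseux" where
  "tpow a = Abs_puiseux (\<lambda>q. if q = a then 1 else 0)"

definition kconst :: "complex \<Rightarrow> puiseux" where
  "kconst z = Abs_puiseux (\<lambda>q. if q = 0 then z else 0)"

text \<open>A nonzero matrix A over K is written A = t^\<alpha> B + lower order terms.\<close>
definition mlead_exp :: "puiseux mat2 \<Rightarrow> rat" where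
  "mlead_exp A = (GREATEST q. \<exists>x\<in>set (mentries A). Rep_puiseux x q \<noteq> 0)"

definition mlead_coef :: "puiseux mat2 \<Rightarrow> complex mat2" where
  "mlead_coef A = map_mat2 (\<lambda>x. Rep_puiseux x (mlead_exp A)) A"

text \<open>Class of a nonzero complex matrix in CP^3.\<close>
definition cclass :: "complex mat2 \<Rightarrow> complex mat2 set" where
  "cclass B = {msmult \<mu> B | \<mu>. \<mu> \<noteq> 0}"

text \<open>(B^c)^* for B = [[a,b],[c,d]]: B^c = [[d,-b],[-c,a]].\<close>
fun adjc :: "complex mat2 \<Rightarrow> complex mat2" where
  "adjc (M2 a b c e) = M2 (cnj e) (- cnj c) (- cnj b) (cnj a)"

definition VALm :: "puiseux mat2 \<Rightarrow> complex mat2 set" where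
  "VALm A =
    (if mdet A = 0 then cclass (mlead_coef A)
     else (let A' = msmult (SOME l. mdet (msmult l A) = 1) A;
               \<alpha> = mlead_exp A'; B = mlead_coef A'
           in cclass (madd (msmult (complex_of_real (exp (real_of_rat \<alpha>))) B)
                           (msmult (complex_of_real (exp (- real_of_rat \<alpha>))) (adjc B)))))"

text \<open>Points of KP^3 are represented by nonzero matrices; VAL of a set of points
  is its image (a set of points of CP^3, i.e. of classes).\<close>
definition VALs :: "puiseux mat2 set \<Rightarrow> complex mat2 set set" where
  "VALs X = VALm ` X"

definition kindep :: "puiseux mat2 \<Rightarrow> puiseux mat2 \<Rightarrow> bool" where
  "kindep P Q \<longleftrightarrow> (\<forall>l m. madd (msmult l P) (msmult m Q) = mzero \<longrightarrow> l = 0 \<and> m = 0)"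

definition kline :: "puiseux mat2 \<Rightarrow> puiseux mat2 \<Rightarrow> puiseux mat2 set" where
  "kline P Q = {madd (msmult l P) (msmult m Q) | l m. (l, m) \<noteq> (0, 0)}"

definition is_kline :: "puiseux mat2 set \<Rightarrow> bool" where
  "is_kline L \<longleftrightarrow> (\<exists>P Q. kindep P Q \<and> L = kline P Q)"

text \<open>Exponent vectors (i,j,l,m) of monomials a^i b^j c^l d^m of degree k.\<close>
definition mons :: "nat \<Rightarrow> (nat \<times> nat \<times> nat \<times> nat) list" where
  "mons k = [(a, b, c, k - a - b - c). a \<leftarrow> [0..<Suc k], b \<leftarrow> [0..<Suc k - a],
              c \<leftarrow> [0..<Suc k - a - b]]"

definition kpeval :: "nat \<Rightarrow> (nat \<times> nat \<times> nat \<times> nat \<Rightarrow> complex) \<Rightarrow> puiseux mat2 \<Rightarrow> puiseux" where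
  "kpeval k f A = (case A of M2 a b c e \<Rightarrow>
     foldr (\<lambda>(i, j, l, m) s. kconst (f (i, j, l, m)) * a ^ i * b ^ j * c ^ l * e ^ m + s) (mons k) 0)"

definition cpeval :: "nat \<Rightarrow> (nat \<times> nat \<times> nat \<times> nat \<Rightarrow> complex) \<Rightarrow> complex \<Rightarrow> complex \<Rightarrow> complex \<Rightarrow> complex \<Rightarrow> complex" where
  "cpeval k f a b c e = (\<Sum>(i, j, l, m) \<leftarrow> mons k. f (i, j, l, m) * a ^ i * b ^ j * c ^ l * e ^ m)"

inductive_set polyfun :: "(('v \<Rightarrow> complex) \<Rightarrow> complex) set" where
  pf_const: "(\<lambda>x. z) \<in> polyfun"
| pf_var: "(\<lambda>x. x v) \<in> polyfun"
| pf_add: "p \<in> polyfun \<Longrightarrow> q \<in> polyfun \<Longrightarrow> (\<lambda>x. p x + q x) \<in> polyfun"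
| pf_mult: "p \<in> polyfun \<Longrightarrow> q \<in> polyfun \<Longrightarrow> (\<lambda>x. p x * q x) \<in> polyfun"

definition det_dvd :: "nat \<Rightarrow> (nat \<times> nat \<times> nat \<times> nat \<Rightarrow> complex) \<Rightarrow> bool" where
  "det_dvd k f \<longleftrightarrow> (\<exists>g \<in> (polyfun :: ((nat \<Rightarrow> complex) \<Rightarrow> complex) set).
      \<forall>x. cpeval k f (x 0) (x 1) (x 2) (x 3) = (x 0 * x 3 - x 1 * x 2) * g x)"

text \<open>Coefficient tuple c: c (k, m) is the coefficient of monomial m in f_k.
  Uniformly, f_{2j + (d mod 2)} for j = 0..n, n = d div 2.\<close>
definition Sd_poly :: "nat \<Rightarrow> (nat \<times> (nat \<times> nat \<times> nat \<times> nat) \<Rightarrow> complex) \<Rightarrow> puiseux mat2 \<Rightarrow> puiseux" where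
  "Sd_poly d c A = (let n = d div 2 in
     foldr (\<lambda>j s. tpow (- of_nat (j * (j + 1))) * (mdet A) ^ (n - j)
                   * kpeval (2 * j + d mod 2) (\<lambda>m. c (2 * j + d mod 2, m)) A + s)
           [0..<Suc n] 0)"

definition surface :: "nat \<Rightarrow> (nat \<times> (nat \<times> nat \<times> nat \<times> nat) \<Rightarrow> complex) \<Rightarrow> puiseux mat2 set" where
  "surface d c = {A. A \<noteq> mzero \<and> Sd_poly d c A = 0}"

definition coef_space :: "nat \<Rightarrow> (nat \<times> (nat \<times> nat \<times> nat \<times> nat) \<Rightarrow> complex) set" where
  "coef_space d = {c. \<forall>k m. c (k, m) \<noteq> 0 \<longrightarrow> k \<le> d \<and> k mod 2 = d mod 2 \<and> m \<in> set (mons k)}"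

definition zariski_closed_in :: "(('v \<Rightarrow> complex) set) \<Rightarrow> ('v \<Rightarrow> complex) set \<Rightarrow> bool" where
  "zariski_closed_in V Z \<longleftrightarrow> (\<exists>P \<subseteq> polyfun. Z = {x \<in> V. \<forall>p \<in> P. p x = 0})"

end

theory Submission
  imports Defs "HOL-Computational_Algebra.Computational_Algebra"
begin

text \<open>A line in the projective space over \<open>K\<close> has a basis \<open>P, Q\<close> over the valuation ring whose
  reductions \<open>P\<^sub>0, Q\<^sub>0\<close> are linearly independent, and \<open>det (l P + m Q) = t\<^bsup>-2\<gamma>\<^esup> E(l, m)\<close> with a binary
  quadratic form \<open>E\<close> of nonzero reduction (unless the determinant vanishes on the line). Hence \<open>VAL\<close>
  of the line contains, at level \<open>\<gamma>\<close>, the leading terms \<open>E(l, m)\<^bsup>-1/2\<^esup> (l P\<^sub>0 + m Q\<^sub>0)\<close>, and at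
  every level \<open>\<alpha> > \<gamma>\<close> the roots of \<open>E\<close> with arbitrary phase. On \<open>VAL(S_d)\<close> the leading term \<open>B\<close> at a
  level \<open>j < \<alpha> < j + 1\<close> satisfies \<open>f\<^bsub>2j+r\<^esub>(B) = 0\<close>, where \<open>r = d mod 2\<close>, and at \<open>\<alpha> = j + 1\<close> it satisfies
  \<open>f\<^bsub>2j+2+r\<^esub>(B) + f\<^bsub>2j+r\<^esub>(B) = 0\<close>. If \<open>\<gamma> = 0\<close> a root of \<open>E\<close> is a common zero of \<open>f\<^bsub>r\<^esub>, f\<^bsub>r+2\<^esub>, f\<^bsub>r+4\<^esub>\<close> on
  the quadric \<open>det = 0\<close>. If \<open>\<gamma> > 0\<close> the span of \<open>P\<^sub>0, Q\<^sub>0\<close> is a line of a ruling of the quadric, and either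
  some \<open>f\<^bsub>k\<^esub>\<close> vanishes on it, or two consecutive forms \<open>f\<^bsub>k\<^esub>, f\<^bsub>k+2\<^esub>\<close> with \<open>k \<ge> 2\<close> have two common
  zeros on it (possibly coinciding). Each of these is excluded for generic coefficients by counting
  parameters: a polynomial map from a space of smaller dimension has its image in a hypersurface.\<close>

section \<open>The field of Puiseux series\<close>

text \<open>At a level \<alpha> > 0 the value of \<open>VAL\<close> determines the leading matrix
  only up to a real factor, because the correction by \<open>adjc\<close> is conjugate-linear. The
  equation at an integer level is therefore available only with an unknown positive weight, and all
  that is taken from it is that two consecutive forms vanish together. The first integer level
  resists the count of two common zeros: with \<open>r = d mod 2\<close>, the lower form f_r is
  constant or linear on a ruling line, so two common zeros with f_(r+2) need not exist. There a root
  of \<open>E\<close> helps, being a common zero of f_(r+2) and f_(r+4); these forms exist because d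
  > 3. In the counts, a point of the quadric costs two parameters and a ruling line with two points
  on it three, against three and four conditions respectively. The elimination is made explicit in
  an affine chart; the points outside the chart are excluded by separate conditions, and the second
  ruling is reached by transposing the matrices.\<close>

definition puiseux_of_fls :: "nat \<Rightarrow> complex fls \<Rightarrow> puiseux" where
  "puiseux_of_fls N g =
     Abs_puiseux (\<lambda>q. if q * of_nat N \<in> \<int> then fls_nth g (- \<lfloor>q * of_nat N\<rfloor>) else 0)"

text \<open>The Laurent variable stands for t^(-1/N), hence the minus sign: the lower bound on the
  indices of a Laurent series becomes the required upper bound on exponents.\<close>

lemma Rep_puiseux_of_fls:
  assumes "N > 0"
  shows "Rep_puiseux (puiseux_of_fls N g) q =
    (if q * of_nat N \<in> \<int> then fls_nth g (- \<lfloor>q * of_nat N\<rfloor>) else 0)"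
proof -
  let ?f = "\<lambda>q. if q * of_nat N \<in> \<int> then fls_nth g (- \<lfloor>q * of_nat N\<rfloor>) else 0"
  have "is_puiseux ?f"
    unfolding is_puiseux_def
  proof (intro conjI exI allI impI)
    show "N > 0" by fact
  next
    fix q :: rat assume "?f q \<noteq> 0"
    then have "q * of_nat N \<in> \<int>" by (auto split: if_splits)
    then obtain k where "q * of_nat N = of_int k" by (elim Ints_cases)
    then show "q = of_int \<lfloor>q * of_nat N\<rfloor> / of_nat N" using assms by (simp add: field_simps)
  next
    fix q :: rat assume *: "?f q \<noteq> 0"
    then have "q * of_nat N \<in> \<int>" by (auto split: if_splits)
    then obtain k where k: "q * of_nat N = of_int k" by (elim Ints_cases)
    have "fls_subdegree g \<le> - k" using * k by (auto split: if_splits intro!: fls_subdegree_leI)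
    then have "q * of_nat N \<le> of_int (- fls_subdegree g)" unfolding k of_int_le_iff by simp
    then show "q \<le> of_int (- fls_subdegree g) / of_nat N" using assms by (simp add: field_simps)
  qed
  then show ?thesis unfolding puiseux_of_fls_def by (subst Abs_puiseux_inverse) auto
qed

lemma Rep_puiseux_eq_iff: "x = y \<longleftrightarrow> (\<forall>q. Rep_puiseux x q = Rep_puiseux y q)"
  by (metis Rep_puiseux_inject ext)

lemma puiseux_of_fls_cases:
  obtains N where "N > 0" "\<And>M. M > 0 \<Longrightarrow> \<exists>g. x = puiseux_of_fls (N * M) g"
proof -
  have "is_puiseux (Rep_puiseux x)" using Rep_puiseux by blast
  then obtain N b where N: "N > 0" "\<And>q. Rep_puiseux x q \<noteq> 0 \<Longrightarrow> \<exists>k::int. q = of_int k / of_nat N"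
    and b: "\<And>q. Rep_puiseux x q \<noteq> 0 \<Longrightarrow> q \<le> b"
    unfolding is_puiseux_def by blast
  have "\<exists>g. x = puiseux_of_fls (N * M) g" if M: "M > 0" for M
  proof -
    let ?K = "N * M"
    have K: "?K > 0" using M N by simp
    define g where "g = Abs_fls (\<lambda>i. Rep_puiseux x (- of_int i / of_nat ?K))"
    have g: "fls_nth g i = Rep_puiseux x (- of_int i / of_nat ?K)" for i
      unfolding g_def
    proof (rule nth_Abs_fls_lower_bound, intro allI impI)
      fix i :: int assume i: "i < - \<lceil>b * of_nat ?K\<rceil>"
      show "Rep_puiseux x (- of_int i / of_nat ?K) = 0"
      proof (rule ccontr)
        assume "Rep_puiseux x (- of_int i / of_nat ?K) \<noteq> 0"
        then have "- of_int i / of_nat ?K \<le> b" by (rule b)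
        then have "of_int (- i) \<le> b * of_nat ?K" using K
          by (simp only: of_int_minus pos_divide_le_eq of_nat_0_less_iff)
        then have "- i \<le> \<lceil>b * of_nat ?K\<rceil>" by linarith
        then show False using i by simp
      qed
    qed
    have "x = puiseux_of_fls ?K g"
      unfolding Rep_puiseux_eq_iff Rep_puiseux_of_fls[OF K]
    proof
      fix q
      show "Rep_puiseux x q = (if q * of_nat ?K \<in> \<int> then fls_nth g (- \<lfloor>q * of_nat ?K\<rfloor>) else 0)"
      proof (cases "q * of_nat ?K \<in> \<int>")
        case True
        then obtain k where k: "q * of_nat ?K = of_int k" by (elim Ints_cases)
        then have "q = of_int k / of_nat ?K" using K by (metis nonzero_mult_div_cancel_right of_nat_0_less_iff order_less_irrefl)
        then show ?thesis using k True by (simp add: g)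
      next
        case False
        have "Rep_puiseux x q = 0"
        proof (rule ccontr)
          assume "Rep_puiseux x q \<noteq> 0"
          then obtain k :: int where "q = of_int k / of_nat N" using N by blast
          then have "q * of_nat ?K = of_int (k * int M)" using N by simp
          then show False using False by (metis Ints_of_int)
        qed
        then show ?thesis using False by simp
      qed
    qed
    then show ?thesis by blast
  qed
  then show ?thesis using that N(1) by blast
qed

lemma puiseux_of_fls_common:
  obtains N f g h where "N > 0" "x = puiseux_of_fls N f" "y = puiseux_of_fls N g" "z = puiseux_of_fls N h"
proof -
  obtain N1 where 1: "N1 > 0" "\<And>M. M > 0 \<Longrightarrow> \<exists>g. x = puiseux_of_fls (N1 * M) g"
    using puiseux_of_fls_cases[of x] by blast
  obtain N2 where 2: "N2 > 0" "\<And>M. M > 0 \<Longrightarrow> \<exists>g. y = puiseux_of_fls (N2 * M) g"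
    using puiseux_of_fls_cases[of y] by blast
  obtain N3 where 3: "N3 > 0" "\<And>M. M > 0 \<Longrightarrow> \<exists>g. z = puiseux_of_fls (N3 * M) g"
    using puiseux_of_fls_cases[of z] by blast
  have "N1 * (N2 * N3) = N2 * (N1 * N3)" "N1 * (N2 * N3) = N3 * (N1 * N2)" by simp_all
  then show ?thesis using that[of "N1 * (N2 * N3)"] 1(2)[of "N2 * N3"] 2(2)[of "N1 * N3"] 3(2)[of "N1 * N2"] 1(1) 2(1) 3(1)
    by (metis nat_0_less_mult_iff)
qed

lemma Rep_puiseux_inverse_fun: "f = Rep_puiseux x \<Longrightarrow> Abs_puiseux f = x"
  by (simp add: Rep_puiseux_inverse)

lemma puiseux_of_fls_0: "N > 0 \<Longrightarrow> puiseux_of_fls N 0 = 0"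
  unfolding zero_puiseux_def by (rule Rep_puiseux_inverse_fun[symmetric]) (auto simp: Rep_puiseux_of_fls fun_eq_iff)

lemma puiseux_of_fls_1: "N > 0 \<Longrightarrow> puiseux_of_fls N 1 = 1"
  unfolding one_puiseux_def
proof (rule Rep_puiseux_inverse_fun[symmetric], rule ext)
  fix q :: rat assume N: "N > 0"
  have "q = 0" if "q * of_nat N \<in> \<int>" "\<lfloor>q * of_nat N\<rfloor> = 0"
    using that N by (elim Ints_cases) auto
  then show "(if q = 0 then 1 else 0) = Rep_puiseux (puiseux_of_fls N 1) q"
    by (auto simp: Rep_puiseux_of_fls[OF N])
qed

lemma puiseux_of_fls_add:
  "N > 0 \<Longrightarrow> puiseux_of_fls N g + puiseux_of_fls N h = puiseux_of_fls N (g + h)"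
  unfolding plus_puiseux_def by (rule Rep_puiseux_inverse_fun) (auto simp: Rep_puiseux_of_fls fun_eq_iff)

lemma puiseux_of_fls_diff:
  "N > 0 \<Longrightarrow> puiseux_of_fls N g - puiseux_of_fls N h = puiseux_of_fls N (g - h)"
  unfolding minus_puiseux_def by (rule Rep_puiseux_inverse_fun) (auto simp: Rep_puiseux_of_fls fun_eq_iff)

lemma puiseux_of_fls_uminus:
  "N > 0 \<Longrightarrow> - puiseux_of_fls N g = puiseux_of_fls N (- g)"
  unfolding uminus_puiseux_def by (rule Rep_puiseux_inverse_fun) (auto simp: Rep_puiseux_of_fls fun_eq_iff)

lemma Rep_puiseux_of_fls_mult:
  assumes N: "N > 0"
  shows "(\<Sum>r\<in>{r. Rep_puiseux (puiseux_of_fls N g) r \<noteq> 0 \<and> Rep_puiseux (puiseux_of_fls N h) (q - r) \<noteq> 0}.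
      Rep_puiseux (puiseux_of_fls N g) r * Rep_puiseux (puiseux_of_fls N h) (q - r))
    = Rep_puiseux (puiseux_of_fls N (g * h)) q"
proof -
  let ?x = "Rep_puiseux (puiseux_of_fls N g)" and ?y = "Rep_puiseux (puiseux_of_fls N h)"
  let ?S = "{r. ?x r \<noteq> 0 \<and> ?y (q - r) \<noteq> 0}"
  have int: "r * of_nat N \<in> \<int>" if "?x r \<noteq> 0 \<or> ?y r \<noteq> 0" for r
    using that by (auto simp: Rep_puiseux_of_fls[OF N] split: if_splits)
  show "(\<Sum>r\<in>?S. ?x r * ?y (q - r)) = Rep_puiseux (puiseux_of_fls N (g * h)) q"
  proof (cases "q * of_nat N \<in> \<int>")
    case False
    have empty: "?S = {}"
    proof (rule ccontr)
      assume "?S \<noteq> {}"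
      then obtain r where "r * of_nat N \<in> \<int>" "(q - r) * of_nat N \<in> \<int>" using int by blast
      then have "r * of_nat N + (q - r) * of_nat N \<in> \<int>" by (rule Ints_add)
      then show False using False by (simp add: algebra_simps)
    qed
    show ?thesis unfolding empty using False by (simp add: Rep_puiseux_of_fls[OF N])
  next
    case True
    then obtain k where k: "q * of_nat N = of_int k" by (elim Ints_cases)
    let ?e = "\<lambda>i::int. - of_int i / of_nat N :: rat"
    have qk: "q = of_int k / of_nat N" using k N by (simp add: field_simps)
    have ex: "?x (?e i) = fls_nth g i" for i
      using N by (simp add: Rep_puiseux_of_fls[OF N] flip: of_int_minus)
    have ey: "?y (q - ?e i) = fls_nth h (- k - i)" for i
    proof -
      have "(q - ?e i) * of_nat N = of_int (k + i)" using N qk by (simp add: field_simps)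
      then show ?thesis by (simp add: Rep_puiseux_of_fls[OF N] del: of_int_add)
    qed
    \<comment> \<open>Both supports lie on the lattice of exponents -i/N, which turns the sum over
      rational exponents into a Laurent convolution.\<close>
    let ?T = "{i. fls_nth g i \<noteq> 0 \<and> fls_nth h (- k - i) \<noteq> 0}"
    have S: "?S = ?e ` ?T"
    proof (intro set_eqI iffI)
      fix r assume r: "r \<in> ?S"
      then have "r * of_nat N \<in> \<int>" using int by blast
      then obtain i where "r * of_nat N = of_int i" by (elim Ints_cases)
      then have "r = ?e (- i)" using N by (simp add: field_simps)
      then show "r \<in> ?e ` ?T" using r ex[of "-i"] ey[of "-i"] by (intro image_eqI[of _ _ "-i"]) auto
    next
      fix r assume "r \<in> ?e ` ?T"
      then show "r \<in> ?S" using ex ey by auto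
    qed
    have inj: "inj_on ?e ?T" using N by (auto simp: inj_on_def)
    have "(\<Sum>r\<in>?S. ?x r * ?y (q - r)) = (\<Sum>i\<in>?T. fls_nth g i * fls_nth h (- k - i))"
      unfolding S by (subst sum.reindex[OF inj]) (simp only: o_def ex ey)
    also have "\<dots> = (\<Sum>i=fls_subdegree g..- k - fls_subdegree h. fls_nth g i * fls_nth h (- k - i))"
    proof (rule sum.mono_neutral_left)
      show "?T \<subseteq> {fls_subdegree g..- k - fls_subdegree h}"
        using fls_subdegree_leI[of g] fls_subdegree_leI[of h] by force
    qed auto
    also have "\<dots> = fls_nth (g * h) (- k)" by (simp add: fls_times_nth(2))
    finally show ?thesis using k by (simp add: Rep_puiseux_of_fls[OF N])
  qed
qed

lemma puiseux_of_fls_mult: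
  "N > 0 \<Longrightarrow> puiseux_of_fls N g * puiseux_of_fls N h = puiseux_of_fls N (g * h)"
  unfolding times_puiseux_def by (rule Rep_puiseux_inverse_fun) (simp only: Rep_puiseux_of_fls_mult)

lemma puiseux_of_fls_inject:
  assumes N: "N > 0" and eq: "puiseux_of_fls N g = puiseux_of_fls N h"
  shows "g = h"
proof (rule fls_eqI)
  fix i :: int
  have "Rep_puiseux (puiseux_of_fls N f) (- of_int i / of_nat N) = fls_nth f i" for f
    using N by (simp add: Rep_puiseux_of_fls[OF N] flip: of_int_minus)
  then show "fls_nth g i = fls_nth h i" using eq by metis
qed

instance puiseux :: comm_ring_1
proof
  fix x y z :: puiseux
  obtain N f g h where *: "N > 0" "x = puiseux_of_fls N f" "y = puiseux_of_fls N g" "z = puiseux_of_fls N h"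
    by (rule puiseux_of_fls_common)
  note [simp] = puiseux_of_fls_mult[OF *(1)] puiseux_of_fls_add[OF *(1)] puiseux_of_fls_diff[OF *(1)]
    puiseux_of_fls_uminus[OF *(1)] puiseux_of_fls_0[OF *(1), symmetric] puiseux_of_fls_1[OF *(1), symmetric]
  show "x * y * z = x * (y * z)" "x * y = y * x" "1 * x = x" "x + y + z = x + (y + z)" "x + y = y + x"
    "0 + x = x" "- x + x = 0" "x - y = x + - y" "(x + y) * z = x * z + y * z"
    by (simp_all add: * algebra_simps)
  show "(0::puiseux) \<noteq> 1" using puiseux_of_fls_inject[OF *(1), of 0 1] by auto
qed

instantiation puiseux :: field
begin
definition "inverse x = (if x = 0 then 0 else (SOME y. x * y = 1))" for x :: puiseux
definition "x div y = x * inverse y" for x y :: puiseux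
instance
proof
  fix x y :: puiseux
  show "inverse (0::puiseux) = 0" by (simp add: inverse_puiseux_def)
  show "x div y = x * inverse y" by (simp add: divide_puiseux_def)
  assume x: "x \<noteq> 0"
  obtain N f where *: "N > 0" "x = puiseux_of_fls N f" by (metis puiseux_of_fls_common)
  then have "f \<noteq> 0" using x puiseux_of_fls_0 by auto
  then have "x * puiseux_of_fls N (inverse f) = 1" using * by (simp add: puiseux_of_fls_mult puiseux_of_fls_1)
  then have "x * (SOME y. x * y = 1) = 1" by (rule someI)
  then show "inverse x * x = 1" using x by (simp add: inverse_puiseux_def mult.commute)
qed
end

section \<open>Coefficients, orders and leading coefficients of Puiseux series\<close>

lemma Rep_puiseux_0 [simp]: "Rep_puiseux 0 q = 0"
  using Rep_puiseux_of_fls[of 1 0 q] by (simp add: puiseux_of_fls_0)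

lemma Rep_puiseux_add [simp]: "Rep_puiseux (x + y) q = Rep_puiseux x q + Rep_puiseux y q"
  by (rule puiseux_of_fls_common[of x y 0]) (simp add: puiseux_of_fls_add Rep_puiseux_of_fls)

lemma Rep_puiseux_diff [simp]: "Rep_puiseux (x - y) q = Rep_puiseux x q - Rep_puiseux y q"
  by (rule puiseux_of_fls_common[of x y 0]) (simp add: puiseux_of_fls_diff Rep_puiseux_of_fls)

lemma Rep_puiseux_uminus [simp]: "Rep_puiseux (- x) q = - Rep_puiseux x q"
  by (rule puiseux_of_fls_common[of x 0 0]) (simp add: puiseux_of_fls_uminus Rep_puiseux_of_fls)

lemma Rep_puiseux_mult:
  "Rep_puiseux (x * y) q = (\<Sum>r\<in>{r. Rep_puiseux x r \<noteq> 0 \<and> Rep_puiseux y (q - r) \<noteq> 0}.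
       Rep_puiseux x r * Rep_puiseux y (q - r))"
  by (rule puiseux_of_fls_common[of x y 0]) (simp only: puiseux_of_fls_mult Rep_puiseux_of_fls_mult)

lemma Rep_tpow: "Rep_puiseux (tpow a) q = (if q = a then 1 else 0)"
proof -
  have "is_puiseux (\<lambda>q. if q = a then 1 else 0)"
    unfolding is_puiseux_def
  proof (intro conjI exI allI impI)
    show "nat (snd (quotient_of a)) > 0" by (simp add: quotient_of_denom_pos')
    fix q :: rat assume "(if q = a then 1 else 0 :: complex) \<noteq> 0"
    then show "q = of_int (fst (quotient_of a)) / of_nat (nat (snd (quotient_of a)))"
      using quotient_of_div[of a] quotient_of_denom_pos'[of a] by (cases "quotient_of a") (auto split: if_splits)
  qed (auto split: if_splits)
  then show ?thesis unfolding tpow_def by (subst Abs_puiseux_inverse) auto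
qed

lemma Rep_kconst: "Rep_puiseux (kconst z) q = (if q = 0 then z else 0)"
proof -
  have "is_puiseux (\<lambda>q. if q = 0 then z else 0)"
    unfolding is_puiseux_def
    by (auto intro!: exI[of _ "1::nat"] exI[of _ "0::int"] split: if_splits)
  then show ?thesis unfolding kconst_def by (subst Abs_puiseux_inverse) auto
qed

lemma Rep_tpow_mult [simp]: "Rep_puiseux (tpow a * x) q = Rep_puiseux x (q - a)"
proof -
  have "{r. Rep_puiseux (tpow a) r \<noteq> 0 \<and> Rep_puiseux x (q - r) \<noteq> 0} = (if Rep_puiseux x (q - a) \<noteq> 0 then {a} else {})"
    by (auto simp: Rep_tpow split: if_splits)
  then show ?thesis by (simp add: Rep_puiseux_mult Rep_tpow)
qed

lemma tpow_add: "tpow (a + b) = tpow a * tpow b"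
  by (auto simp: Rep_puiseux_eq_iff Rep_tpow)

lemma tpow_0: "tpow 0 = 1"
  by (simp add: tpow_def one_puiseux_def)

lemma tpow_minus_mult [simp]: "tpow (- a) * tpow a = 1" "tpow a * tpow (- a) = 1"
  by (simp_all add: tpow_0 flip: tpow_add)

lemma tpow_nonzero [simp]: "tpow a \<noteq> 0"
  by (metis Rep_puiseux_0 Rep_tpow zero_neq_one)

lemma Rep_puiseux_1: "Rep_puiseux 1 q = (if q = 0 then 1 else 0)"
  using Rep_tpow[of 0] by (simp add: tpow_0)

text \<open>An upper bound for the order instead of the order itself: zero needs no exceptional
  value, and \<open>Rep_puiseux x q\<close> serves as leading coefficient relative to
  \<open>q\<close> even when it vanishes. Leading terms then add and multiply without a case
  distinction on cancellation.\<close>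

definition val_le :: "puiseux \<Rightarrow> rat \<Rightarrow> bool" where
  "val_le x q \<longleftrightarrow> (\<forall>r>q. Rep_puiseux x r = 0)"

lemma val_leD: "val_le x q \<Longrightarrow> q < r \<Longrightarrow> Rep_puiseux x r = 0"
  by (simp add: val_le_def)

lemma val_le_mono: "val_le x q \<Longrightarrow> q \<le> r \<Longrightarrow> val_le x r"
  by (auto simp: val_le_def)

lemma val_le_0 [simp]: "val_le 0 q"
  by (simp add: val_le_def)

lemma val_le_add: "val_le x q \<Longrightarrow> val_le y q \<Longrightarrow> val_le (x + y) q"
  and val_le_diff: "val_le x q \<Longrightarrow> val_le y q \<Longrightarrow> val_le (x - y) q"
  and val_le_uminus: "val_le x q \<Longrightarrow> val_le (- x) q"
  by (auto simp: val_le_def)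

lemma val_le_tpow: "val_le (tpow a) q \<longleftrightarrow> a \<le> q"
  by (auto simp: val_le_def Rep_tpow)

lemma val_le_tpow_mult: "val_le (tpow a * x) q \<longleftrightarrow> val_le x (q - a)"
proof
  assume *: "val_le (tpow a * x) q"
  show "val_le x (q - a)" unfolding val_le_def
  proof (intro allI impI)
    fix r assume "q - a < r"
    then show "Rep_puiseux x r = 0" using val_leD[OF *, of "r + a"] by simp
  qed
next
  assume "val_le x (q - a)"
  then show "val_le (tpow a * x) q" by (simp add: val_le_def)
qed

lemma val_le_kconst: "0 \<le> q \<Longrightarrow> val_le (kconst z) q"
  by (auto simp: val_le_def Rep_kconst)

lemma
  assumes x: "val_le x a" and y: "val_le y b"
  shows val_le_mult: "val_le (x * y) (a + b)"
    and Rep_mult_lead: "Rep_puiseux (x * y) (a + b) = Rep_puiseux x a * Rep_puiseux y b"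
proof -
  have le: "r \<le> a" "q - r \<le> b" if "Rep_puiseux x r \<noteq> 0" "Rep_puiseux y (q - r) \<noteq> 0" for q r
    using that x y by (meson not_le val_leD)+
  show "val_le (x * y) (a + b)"
    unfolding val_le_def
  proof (intro allI impI)
    fix q assume "a + b < q"
    then have "{r. Rep_puiseux x r \<noteq> 0 \<and> Rep_puiseux y (q - r) \<noteq> 0} = {}"
      using le[of _ q] by force
    then show "Rep_puiseux (x * y) q = 0" unfolding Rep_puiseux_mult by (simp only: sum.empty)
  qed
  have "r = a" if "Rep_puiseux x r \<noteq> 0" "Rep_puiseux y (a + b - r) \<noteq> 0" for r
    using le[OF that] by simp
  then have "Rep_puiseux (x * y) (a + b) = (\<Sum>r\<in>{a}. Rep_puiseux x r * Rep_puiseux y (a + b - r))"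
    unfolding Rep_puiseux_mult by (intro sum.mono_neutral_left) auto
  then show "Rep_puiseux (x * y) (a + b) = Rep_puiseux x a * Rep_puiseux y b" by simp
qed

lemma val_exists:
  assumes "x \<noteq> 0"
  obtains v where "val_le x v" "Rep_puiseux x v \<noteq> 0"
proof -
  obtain N f where *: "N > 0" "x = puiseux_of_fls N f" by (metis puiseux_of_fls_common)
  have f: "f \<noteq> 0" using assms * puiseux_of_fls_0 by auto
  let ?v = "- of_int (fls_subdegree f) / of_nat N :: rat"
  have "Rep_puiseux x ?v = fls_nth f (fls_subdegree f)"
    using * by (simp add: Rep_puiseux_of_fls flip: of_int_minus)
  then have "Rep_puiseux x ?v \<noteq> 0" using f by simp
  moreover have "val_le x ?v"
    unfolding val_le_def
  proof (intro allI impI)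
    fix r assume r: "?v < r"
    show "Rep_puiseux x r = 0"
    proof (rule ccontr)
      assume nz: "Rep_puiseux x r \<noteq> 0"
      then have "r * of_nat N \<in> \<int>" using * by (auto simp: Rep_puiseux_of_fls split: if_splits)
      then obtain k where k: "r * of_nat N = of_int k" by (elim Ints_cases)
      then have "fls_subdegree f \<le> - k" using nz * by (auto simp: Rep_puiseux_of_fls intro!: fls_subdegree_leI)
      moreover have "of_int (- fls_subdegree f) < r * of_nat N"
        using r *(1) by (simp only: of_int_minus pos_divide_less_eq of_nat_0_less_iff)
      then have "- fls_subdegree f < k" unfolding k of_int_less_iff by simp
      ultimately show False by simp
    qed
  qed
  ultimately show ?thesis using that by blast
qed

text \<open>Dividing by the leading monomial leaves a power series in t^(-1/N) with nonzero constant
  term, which has a formal square root; the monomial has one because half of a rational exponent is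
  admissible.\<close>

lemma puiseux_sqrt_exists: "\<exists>y. y * y = (x::puiseux)"
proof (cases "x = 0")
  case False
  obtain v where v: "val_le x v" "Rep_puiseux x v \<noteq> 0" using val_exists[OF False] .
  define u where "u = tpow (- v) * x"
  obtain N g where N: "N > 0" and u: "u = puiseux_of_fls N g" by (metis puiseux_of_fls_common)
  have nth: "fls_nth g i = Rep_puiseux x (v - of_int i / of_nat N)" for i
  proof -
    have "fls_nth g i = Rep_puiseux u (- of_int i / of_nat N)"
      using N by (simp add: u Rep_puiseux_of_fls flip: of_int_minus)
    then show ?thesis by (simp add: u_def)
  qed
  have neg: "fls_nth g i = 0" if "i < 0" for i
    unfolding nth using that N by (intro val_leD[OF v(1)]) (simp add: divide_neg_pos)
  define h where "h = fls_regpart g"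
  have g: "g = fps_to_fls h"
    unfolding h_def by (rule fls_eqI) (use neg in auto)
  have h0: "h $ 0 \<noteq> 0" using v(2) nth[of 0] by (simp add: h_def)
  define s where "s = fps_radical (\<lambda>_. csqrt) (Suc 1) h"
  have "s ^ Suc 1 = h"
    unfolding s_def by (subst power_radical[OF h0, symmetric]) (simp add: power2_eq_square[symmetric])
  then have "puiseux_of_fls N (fps_to_fls s) * puiseux_of_fls N (fps_to_fls s) = u"
    unfolding u g by (simp add: puiseux_of_fls_mult[OF N] flip: fls_times_fps_to_fls)
  moreover have "x = tpow (v / 2) * tpow (v / 2) * u"
    by (simp add: u_def mult.assoc[symmetric] flip: tpow_add)
       (simp add: tpow_0)
  ultimately show ?thesis
    by (intro exI[of _ "tpow (v / 2) * puiseux_of_fls N (fps_to_fls s)"]) (simp add: mult_ac)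
qed auto

lemma foldr_plus_eq_sum_list: "foldr (\<lambda>x s. g x + s) xs 0 = (\<Sum>x\<leftarrow>xs. g x :: 'a::monoid_add)"
  by (induction xs) auto

lemma val_le_sum_list: "(\<And>x. x \<in> set xs \<Longrightarrow> val_le (g x) q) \<Longrightarrow> val_le (\<Sum>x\<leftarrow>xs. g x) q"
  by (induction xs) (auto intro: val_le_add)

lemma Rep_sum_list: "Rep_puiseux (\<Sum>x\<leftarrow>xs. g x) q = (\<Sum>x\<leftarrow>xs. Rep_puiseux (g x) q)"
  by (induction xs) auto

lemma Rep_sum: "Rep_puiseux (\<Sum>x\<in>X. g x) q = (\<Sum>x\<in>X. Rep_puiseux (g x) q)"
  by (induction X rule: infinite_finite_induct) auto

lemma val_power:
  assumes "val_le x a"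
  shows "val_le (x ^ n) (of_nat n * a) \<and> Rep_puiseux (x ^ n) (of_nat n * a) = Rep_puiseux x a ^ n"
proof (induction n)
  case 0
  then show ?case using val_le_tpow[of 0 0] by (simp add: Rep_puiseux_1 tpow_0)
next
  case (Suc n)
  have *: "of_nat (Suc n) * a = a + of_nat n * a" by (simp add: algebra_simps)
  show ?case unfolding * power_Suc using Suc assms val_le_mult Rep_mult_lead by metis
qed

lemma val_inverse:
  assumes m: "val_le m q" "Rep_puiseux m q \<noteq> 0"
  shows "val_le (inverse m) (- q) \<and> Rep_puiseux (inverse m) (- q) = 1 / Rep_puiseux m q"
proof -
  have "m \<noteq> 0" using m by auto
  then obtain v where v: "val_le (inverse m) v" "Rep_puiseux (inverse m) v \<noteq> 0"
    using val_exists by (metis nonzero_imp_inverse_nonzero)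
  have "Rep_puiseux 1 (q + v) = Rep_puiseux m q * Rep_puiseux (inverse m) v"
    using Rep_mult_lead[OF m(1) v(1)] \<open>m \<noteq> 0\<close> by simp
  then have "q + v = 0" "Rep_puiseux m q * Rep_puiseux (inverse m) v = 1"
    using m v by (auto simp: Rep_puiseux_1 split: if_splits)
  moreover from this have "v = - q" by simp
  ultimately show ?thesis using v m by (simp add: field_simps)
qed

lemma finite_lead_exists:
  assumes "finite X" "\<exists>x\<in>X. x \<noteq> 0"
  obtains q m where "m \<in> X" "Rep_puiseux m q \<noteq> 0" "\<And>x. x \<in> X \<Longrightarrow> val_le x q"
proof -
  have "\<exists>q m. m \<in> X \<and> Rep_puiseux m q \<noteq> 0 \<and> (\<forall>x\<in>X. val_le x q)"
    using assms
  proof (induction X rule: finite_induct)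
    case (insert y X)
    show ?case
    proof (cases "\<exists>x\<in>X. x \<noteq> 0")
      case False
      then have "y \<noteq> 0" using insert by auto
      then show ?thesis using False val_exists[of y] by (metis insert_iff val_le_0)
    next
      case True
      then obtain q m where q: "m \<in> X" "Rep_puiseux m q \<noteq> 0" "\<forall>x\<in>X. val_le x q" using insert by blast
      show ?thesis
      proof (cases "val_le y q")
        case True then show ?thesis using q by blast
      next
        case False
        then have "y \<noteq> 0" by auto
        then obtain v where v: "val_le y v" "Rep_puiseux y v \<noteq> 0" using val_exists by blast
        then have "q \<le> v" using False val_le_mono by (metis linorder_linear)
        then show ?thesis using v q by (metis insert_iff val_le_mono)
      qed
    qed
  qed simp
  then show ?thesis using that by blast
qed

section \<open>Matrices over the field of Puiseux series\<close>

definition mval_le :: "puiseux mat2 \<Rightarrow> rat \<Rightarrow> bool" where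
  "mval_le A q \<longleftrightarrow> (\<forall>x\<in>set (mentries A). val_le x q)"

definition mcoef :: "puiseux mat2 \<Rightarrow> rat \<Rightarrow> complex mat2" where
  "mcoef A q = map_mat2 (\<lambda>x. Rep_puiseux x q) A"

lemma mval_le_M2 [simp]: "mval_le (M2 a b c e) q \<longleftrightarrow> val_le a q \<and> val_le b q \<and> val_le c q \<and> val_le e q"
  by (simp add: mval_le_def)

lemma mcoef_M2 [simp]:
  "mcoef (M2 a b c e) q = M2 (Rep_puiseux a q) (Rep_puiseux b q) (Rep_puiseux c q) (Rep_puiseux e q)"
  by (simp add: mcoef_def)

lemma mlead:
  assumes "mval_le A q" "mcoef A q \<noteq> mzero"
  shows "mlead_exp A = q" "mlead_coef A = mcoef A q"
proof -
  show *: "mlead_exp A = q"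
    unfolding mlead_exp_def
  proof (rule Greatest_equality)
    show "\<exists>x\<in>set (mentries A). Rep_puiseux x q \<noteq> 0"
      using assms by (cases A) (auto simp: mzero_def)
    show "r \<le> q" if "\<exists>x\<in>set (mentries A). Rep_puiseux x r \<noteq> 0" for r
      using that assms(1) unfolding mval_le_def by (meson not_le val_leD)
  qed
  show "mlead_coef A = mcoef A q" by (simp add: mlead_coef_def mcoef_def *)
qed

lemma mlead_exists:
  assumes "A \<noteq> mzero"
  obtains q where "mval_le A q" "mcoef A q \<noteq> mzero"
proof -
  have "\<exists>x\<in>set (mentries A). x \<noteq> 0" using assms by (cases A) (auto simp: mzero_def)
  then obtain q m where "m \<in> set (mentries A)" "Rep_puiseux m q \<noteq> 0" "\<And>x. x \<in> set (mentries A) \<Longrightarrow> val_le x q"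
    by (rule finite_lead_exists[rotated]) auto
  then show ?thesis using that[of q] by (cases A) (auto simp: mzero_def)
qed

lemma val_mdet:
  assumes "mval_le A q"
  shows "val_le (mdet A) (2 * q)" "Rep_puiseux (mdet A) (2 * q) = mdet (mcoef A q)"
proof -
  obtain a b c e where M: "A = M2 a b c e" by (cases A)
  have v: "val_le a q" "val_le b q" "val_le c q" "val_le e q" using assms M by auto
  show "val_le (mdet A) (2 * q)"
    unfolding M mdet.simps mult_2 by (intro val_le_diff val_le_mult v)
  show "Rep_puiseux (mdet A) (2 * q) = mdet (mcoef A q)"
    unfolding M mdet.simps mult_2 mcoef_M2 Rep_puiseux_diff
    by (simp only: Rep_mult_lead[OF v(1) v(4)] Rep_mult_lead[OF v(2) v(3)])
qed

lemma val_msmult: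
  assumes "mval_le A q" "val_le s v"
  shows "mval_le (msmult s A) (v + q)" "mcoef (msmult s A) (v + q) = msmult (Rep_puiseux s v) (mcoef A q)"
proof -
  obtain a b c e where M: "A = M2 a b c e" by (cases A)
  have v: "val_le a q" "val_le b q" "val_le c q" "val_le e q" using assms M by auto
  show "mval_le (msmult s A) (v + q)"
    unfolding M msmult.simps mval_le_M2 by (intro conjI val_le_mult assms v)
  show "mcoef (msmult s A) (v + q) = msmult (Rep_puiseux s v) (mcoef A q)"
    unfolding M msmult.simps mcoef_M2 by (simp only: Rep_mult_lead[OF assms(2)] v)
qed

lemma mdet_msmult: "mdet (msmult s A) = s * s * mdet (A :: 'a::comm_ring_1 mat2)"
  by (cases A) (simp add: algebra_simps)

lemma msmult_eq_mzero_iff: "msmult (s :: 'a::field) A = mzero \<longleftrightarrow> s = 0 \<or> A = mzero"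
  by (cases A) (auto simp: mzero_def)

lemma msmult_msmult: "msmult s (msmult t A) = msmult (s * t) (A :: 'a::comm_ring_1 mat2)"
  by (cases A) (simp add: algebra_simps)

lemma msmult_1: "msmult 1 A = (A :: 'a::comm_ring_1 mat2)"
  by (cases A) simp

section \<open>The leading terms of the equation of the surface\<close>

lemma set_mons: "(i, j, l, m) \<in> set (mons k) \<longleftrightarrow> i + j + l + m = k"
proof
  assume *: "i + j + l + m = k"
  show "(i, j, l, m) \<in> set (mons k)"
    unfolding mons_def set_concat set_map set_upt
    using * by (intro UN_I[of "[(i, b, c, k - i - b - c). b \<leftarrow> [0..<Suc k - i], c \<leftarrow> [0..<Suc k - i - b]]"]
      image_eqI[of _ _ i]) (auto simp: image_iff)
qed (auto simp: mons_def)

definition cform :: "nat \<Rightarrow> (nat \<times> nat \<times> nat \<times> nat \<Rightarrow> complex) \<Rightarrow> complex mat2 \<Rightarrow> complex" where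
  "cform k f B = (case B of M2 a b c e \<Rightarrow> cpeval k f a b c e)"

lemma cform_msmult: "cform k f (msmult s B) = s ^ k * cform k f B"
proof (cases B)
  case (M2 a b c e)
  have "(\<Sum>(i, j, l, m)\<leftarrow>mons k. f (i, j, l, m) * (s * a) ^ i * (s * b) ^ j * (s * c) ^ l * (s * e) ^ m) =
    (\<Sum>x\<leftarrow>mons k. s ^ k * (case x of (i, j, l, m) \<Rightarrow> f (i, j, l, m) * a ^ i * b ^ j * c ^ l * e ^ m))"
    by (intro arg_cong[where f = sum_list] map_cong refl)
       (auto simp: set_mons power_mult_distrib power_add)
  then show ?thesis by (simp add: M2 cform_def cpeval_def sum_list_const_mult)
qed

lemma kpeval_eq:
  "kpeval k f (M2 a b c e) =
    (\<Sum>(i, j, l, m)\<leftarrow>mons k. kconst (f (i, j, l, m)) * a ^ i * b ^ j * c ^ l * e ^ m)"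
proof -
  have "(\<lambda>(i, j, l, m) s. kconst (f (i, j, l, m)) * a ^ i * b ^ j * c ^ l * e ^ m + s) =
    (\<lambda>x s. (case x of (i, j, l, m) \<Rightarrow> kconst (f (i, j, l, m)) * a ^ i * b ^ j * c ^ l * e ^ m) + s)"
    by (auto simp: fun_eq_iff)
  then show ?thesis unfolding kpeval_def mat2.case by (simp only: foldr_plus_eq_sum_list)
qed

lemma kpeval_msmult: "kpeval k f (msmult s A) = s ^ k * kpeval k f A"
proof (cases A)
  case (M2 a b c e)
  have "(\<Sum>(i, j, l, m)\<leftarrow>mons k. kconst (f (i, j, l, m)) * (s * a) ^ i * (s * b) ^ j * (s * c) ^ l * (s * e) ^ m) =
    (\<Sum>x\<leftarrow>mons k. s ^ k * (case x of (i, j, l, m) \<Rightarrow> kconst (f (i, j, l, m)) * a ^ i * b ^ j * c ^ l * e ^ m))"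
    by (intro arg_cong[where f = sum_list] map_cong refl)
       (auto simp: set_mons power_mult_distrib power_add)
  then show ?thesis by (simp add: M2 kpeval_eq sum_list_const_mult)
qed

lemma val_kpeval:
  assumes A: "mval_le A q"
  shows "val_le (kpeval k f A) (of_nat k * q)"
    and "Rep_puiseux (kpeval k f A) (of_nat k * q) = cform k f (mcoef A q)"
proof -
  obtain a b c e where M: "A = M2 a b c e" by (cases A)
  have v: "val_le a q" "val_le b q" "val_le c q" "val_le e q" using A M by auto
  have *: "val_le (kconst z * a ^ i * b ^ j * c ^ l * e ^ m) (of_nat k * q) \<and>
     Rep_puiseux (kconst z * a ^ i * b ^ j * c ^ l * e ^ m) (of_nat k * q)
       = z * Rep_puiseux a q ^ i * Rep_puiseux b q ^ j * Rep_puiseux c q ^ l * Rep_puiseux e q ^ m"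
    if "i + j + l + m = k" for i j l m z
  proof -
    have k: "of_nat k * q = 0 + of_nat i * q + of_nat j * q + of_nat l * q + of_nat m * q"
      by (simp add: that[symmetric] algebra_simps)
    have z: "val_le (kconst z) 0" "Rep_puiseux (kconst z) 0 = z" by (simp_all add: val_le_kconst Rep_kconst)
    note p = val_power[OF v(1), of i] val_power[OF v(2), of j] val_power[OF v(3), of l] val_power[OF v(4), of m]
    note l1 = val_le_mult[OF z(1) conjunct1[OF p(1)]] and r1 = Rep_mult_lead[OF z(1) conjunct1[OF p(1)]]
    note l2 = val_le_mult[OF l1 conjunct1[OF p(2)]] and r2 = Rep_mult_lead[OF l1 conjunct1[OF p(2)]]
    note l3 = val_le_mult[OF l2 conjunct1[OF p(3)]] and r3 = Rep_mult_lead[OF l2 conjunct1[OF p(3)]]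
    note l4 = val_le_mult[OF l3 conjunct1[OF p(4)]] and r4 = Rep_mult_lead[OF l3 conjunct1[OF p(4)]]
    show ?thesis unfolding k
      by (rule conjI, rule l4) (simp only: r4 r3 r2 r1 conjunct2[OF p(1)] conjunct2[OF p(2)] conjunct2[OF p(3)] conjunct2[OF p(4)] z(2))
  qed
  show "val_le (kpeval k f A) (of_nat k * q)"
    unfolding M kpeval_eq by (rule val_le_sum_list) (use * in \<open>auto simp: set_mons\<close>)
  show "Rep_puiseux (kpeval k f A) (of_nat k * q) = cform k f (mcoef A q)"
    unfolding M kpeval_eq Rep_sum_list cform_def mcoef_M2 mat2.case cpeval_def
    by (intro arg_cong[where f = sum_list] map_cong refl) (use * in \<open>auto simp: set_mons\<close>)
qed

abbreviation fval :: "(nat \<times> (nat \<times> nat \<times> nat \<times> nat) \<Rightarrow> complex) \<Rightarrow> nat \<Rightarrow> complex mat2 \<Rightarrow> complex" where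
  "fval c k \<equiv> cform k (\<lambda>m. c (k, m))"

lemma Sd_poly_eq:
  "Sd_poly d c A = (\<Sum>j\<le>d div 2. tpow (- of_nat (j * (j + 1))) * mdet A ^ (d div 2 - j)
                   * kpeval (2 * j + d mod 2) (\<lambda>m. c (2 * j + d mod 2, m)) A)"
  unfolding Sd_poly_def Let_def foldr_plus_eq_sum_list
  by (simp only: interv_sum_list_conv_sum_set_nat set_upt atLeast0LessThan lessThan_Suc_atMost)

lemma Sd_poly_msmult: "Sd_poly d c (msmult s A) = s ^ d * Sd_poly d c A"
proof -
  have 1: "s * s * mdet A = s ^ 2 * mdet A" by (simp add: power2_eq_square)
  have 2: "(s ^ 2) ^ (d div 2 - j) * s ^ (2 * j + d mod 2) = s ^ d" if "j \<le> d div 2" for j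
  proof -
    have "2 * (d div 2 - j) + (2 * j + d mod 2) = d" using that by presburger
    then show ?thesis by (metis power_add power_mult)
  qed
  show ?thesis
    unfolding Sd_poly_eq sum_distrib_left mdet_msmult kpeval_msmult 1 power_mult_distrib
  proof (intro sum.cong refl)
    fix j assume "j \<in> {..d div 2}"
    then have "s ^ d = (s ^ 2) ^ (d div 2 - j) * s ^ (2 * j + d mod 2)" using 2[of j] by simp
    then show "tpow (- of_nat (j * (j + 1))) * ((s ^ 2) ^ (d div 2 - j) * mdet A ^ (d div 2 - j)) *
        (s ^ (2 * j + d mod 2) * kpeval (2 * j + d mod 2) (\<lambda>m. c (2 * j + d mod 2, m)) A)
      = s ^ d * (tpow (- of_nat (j * (j + 1))) * mdet A ^ (d div 2 - j) *
        kpeval (2 * j + d mod 2) (\<lambda>m. c (2 * j + d mod 2, m)) A)"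
      by (simp only: mult_ac)
  qed
qed

text \<open>The order of the \<open>j\<close>-th term at a point \<open>A = t\<^sup>\<alpha> B + \<dots>\<close> of determinant 1 is
  \<open>(2 j + r) \<alpha> - j (j + 1)\<close>; this is maximal at \<open>j\<close> for \<open>j < \<alpha> < j + 1\<close>, and at both
  \<open>j - 1\<close> and \<open>j\<close> for \<open>\<alpha> = j\<close>.\<close>

definition tropical_cond ::
  "nat \<Rightarrow> (nat \<times> (nat \<times> nat \<times> nat \<times> nat) \<Rightarrow> complex) \<Rightarrow> rat \<Rightarrow> complex \<Rightarrow> complex mat2 \<Rightarrow> bool" where
  "tropical_cond d c \<alpha> \<delta> B \<longleftrightarrow>
    (\<forall>j \<le> d div 2. of_nat j < \<alpha> \<longrightarrow> (\<alpha> < of_nat j + 1 \<or> j = d div 2) \<longrightarrow> fval c (2 * j + d mod 2) B = 0) \<and>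
    (\<forall>j < d div 2. \<alpha> = of_nat j + 1 \<longrightarrow>
      (\<exists>\<rho>>0. complex_of_real \<rho> * fval c (2 * j + 2 + d mod 2) B + \<delta> * fval c (2 * j + d mod 2) B = 0))"

lemma surface_leading:
  assumes S: "Sd_poly d c A = 0" and det: "mdet A = 1" and A: "mval_le A \<alpha>" and B: "B = mcoef A \<alpha>"
  shows "\<forall>j \<le> d div 2. of_nat j < \<alpha> \<longrightarrow> (\<alpha> < of_nat j + 1 \<or> j = d div 2) \<longrightarrow> fval c (2 * j + d mod 2) B = 0"
    and "\<forall>j < d div 2. \<alpha> = of_nat j + 1 \<longrightarrow>
      fval c (2 * j + 2 + d mod 2) B + fval c (2 * j + d mod 2) B = 0"
proof -
  let ?n = "d div 2" and ?r = "d mod 2"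
  define e where "e j = of_nat (2 * j + ?r) * \<alpha> - of_nat (j * (j + 1))" for j
  define T where "T j = tpow (- of_nat (j * (j + 1))) * kpeval (2 * j + ?r) (\<lambda>m. c (2 * j + ?r, m)) A" for j
  have T: "val_le (T j) (e j)" "Rep_puiseux (T j) (e j) = fval c (2 * j + ?r) B" for j
    using val_kpeval[OF A, of "2 * j + ?r"] B
    by (simp_all add: T_def e_def val_le_tpow_mult)
  have "(\<Sum>j\<le>?n. T j) = 0" using S by (simp add: Sd_poly_eq det T_def)
  then have sum: "(\<Sum>j\<le>?n. Rep_puiseux (T j) q) = 0" for q by (metis Rep_sum Rep_puiseux_0)
  \<comment> \<open>The exponents j (j + 1) make the second factor change sign at 2 \<alpha> = i + j
    + 1. Hence the j-th term strictly dominates for j < \<alpha> < j + 1, with no upper bound if it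
    is the last one, and the terms j and j + 1 tie at \<alpha> = j + 1.\<close>
  have ediff: "e j - e i = (of_nat j - of_nat i) * (2 * \<alpha> - of_nat (i + j + 1))" for i j
    by (simp add: e_def algebra_simps)
  show "\<forall>j \<le> ?n. of_nat j < \<alpha> \<longrightarrow> (\<alpha> < of_nat j + 1 \<or> j = ?n) \<longrightarrow> fval c (2 * j + ?r) B = 0"
  proof (intro allI impI)
    fix j assume j: "j \<le> ?n" "of_nat j < \<alpha>" "\<alpha> < of_nat j + 1 \<or> j = ?n"
    have less: "e i < e j" if i: "i \<le> ?n" "i \<noteq> j" for i
    proof (cases "i < j")
      case True
      then have "of_nat (i + j + 1) \<le> (of_nat (2 * j) :: rat)" by (intro of_nat_mono) simp
      then have "2 * \<alpha> - of_nat (i + j + 1) > 0" using j by simp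
      then have "e j - e i > 0" unfolding ediff using True by (intro mult_pos_pos) auto
      then show ?thesis by simp
    next
      case False
      then have "of_nat (2 * j + 2) \<le> (of_nat (i + j + 1) :: rat)" using i by (intro of_nat_mono) simp
      then have "2 * \<alpha> - of_nat (i + j + 1) < 0" using j i False by auto
      then have "e j - e i > 0" unfolding ediff using False i by (intro mult_neg_neg) auto
      then show ?thesis by simp
    qed
    have "(\<Sum>i\<le>?n. Rep_puiseux (T i) (e j)) = (\<Sum>i\<in>{j}. Rep_puiseux (T i) (e j))"
      by (rule sum.mono_neutral_right) (use j less val_leD[OF T(1)] in auto)
    then show "fval c (2 * j + ?r) B = 0" using sum T(2) by simp
  qed
  show "\<forall>j < ?n. \<alpha> = of_nat j + 1 \<longrightarrow> fval c (2 * j + 2 + ?r) B + fval c (2 * j + ?r) B = 0"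
  proof (intro allI impI)
    fix j assume j: "j < ?n" "\<alpha> = of_nat j + 1"
    have eq: "e (Suc j) = e j" using ediff[of "Suc j" j] by (simp add: j algebra_simps)
    have less: "e i < e j" if i: "i \<noteq> j" "i \<noteq> Suc j" for i
    proof (cases "i < j")
      case True
      then have "of_nat (i + j + 1) \<le> (of_nat (2 * j) :: rat)" by (intro of_nat_mono) simp
      then have "2 * \<alpha> - of_nat (i + j + 1) > 0" using j by simp
      then have "e j - e i > 0" unfolding ediff using True by (intro mult_pos_pos) auto
      then show ?thesis by simp
    next
      case False
      then have "of_nat (2 * j + 3) \<le> (of_nat (i + j + 1) :: rat)" using i by (intro of_nat_mono) simp
      then have "2 * \<alpha> - of_nat (i + j + 1) < 0" using j i False by auto
      then have "e j - e i > 0" unfolding ediff using False i by (intro mult_neg_neg) auto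
      then show ?thesis by simp
    qed
    have "(\<Sum>i\<le>?n. Rep_puiseux (T i) (e j)) = (\<Sum>i\<in>{j, Suc j}. Rep_puiseux (T i) (e j))"
      by (rule sum.mono_neutral_right) (use j less val_leD[OF T(1)] in auto)
    then show "fval c (2 * j + 2 + ?r) B + fval c (2 * j + ?r) B = 0"
      using sum T(2)[of j] T(2)[of "Suc j"] eq by (simp add: add.commute)
  qed
qed

section \<open>Recovering the leading term from the value of VAL\<close>

fun mnorm2 :: "complex mat2 \<Rightarrow> real" where
  "mnorm2 (M2 a b c e) = (cmod a)\<^sup>2 + (cmod b)\<^sup>2 + (cmod c)\<^sup>2 + (cmod e)\<^sup>2"

text \<open>The matrix whose class is \<open>VAL\<close> at level \<alpha>, with \<open>x\<close>
  standing for exp \<alpha>.\<close>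

definition val_mat :: "real \<Rightarrow> complex mat2 \<Rightarrow> complex mat2" where
  "val_mat x B = madd (msmult (complex_of_real x) B) (msmult (complex_of_real (1 / x)) (adjc B))"

lemma mnorm2_pos: "B \<noteq> mzero \<Longrightarrow> mnorm2 B > 0"
  by (cases B) (auto simp: mzero_def add_nonneg_pos add_pos_nonneg)

lemma mnorm2_msmult: "mnorm2 (msmult s B) = (cmod s)\<^sup>2 * mnorm2 B"
  by (cases B) (simp add: norm_mult power_mult_distrib algebra_simps)

lemma mdet_val_mat:
  assumes "x > 0"
  shows "mdet (val_mat x B) = of_real (x\<^sup>2) * mdet B + of_real (1 / x\<^sup>2) * cnj (mdet B) + of_real (mnorm2 B)"
proof (cases B)
  case (M2 a b c e)
  have *: "(X * a + Y * e') * (X * e + Y * a') - (X * b + Y * (- c')) * (X * c + Y * (- b')) =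
     X\<^sup>2 * (a * e - b * c) + Y\<^sup>2 * (a' * e' - b' * c') + (a * a' + b * b' + c * c' + e * e')"
    if "X * Y = 1" for X Y a b c e a' b' c' e' :: complex
    using that by algebra
  have "complex_of_real x * complex_of_real (1 / x) = 1" using assms by simp
  from *[OF this, of a "cnj e" e "cnj a" b "cnj c" c "cnj b"] show ?thesis
    by (simp add: M2 val_mat_def power_divide complex_norm_square del: of_real_power of_real_divide flip: of_real_power)
qed

lemma cmod_power2_lincomb:
  "(cmod (of_real x * a + of_real y * cnj b))\<^sup>2 = x\<^sup>2 * (cmod a)\<^sup>2 + y\<^sup>2 * (cmod b)\<^sup>2 + 2 * (x * y) * Re (a * b)"
  unfolding cmod_power2 by (simp add: power2_eq_square algebra_simps)

lemma mnorm2_val_mat: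
  assumes "x > 0"
  shows "mnorm2 (val_mat x B) = (x\<^sup>2 + 1 / x\<^sup>2) * mnorm2 B + 4 * Re (mdet B)"
proof (cases B)
  case (M2 a b c e)
  have x: "x * (1 / x) = 1" using assms by simp
  have v: "val_mat x B = M2 (of_real x * a + of_real (1 / x) * cnj e) (of_real x * b + of_real (1 / x) * cnj (- c))
    (of_real x * c + of_real (1 / x) * cnj (- b)) (of_real x * e + of_real (1 / x) * cnj a)"
    by (simp add: M2 val_mat_def)
  show ?thesis unfolding v mnorm2.simps cmod_power2_lincomb x
    by (simp add: M2 algebra_simps power_divide)
qed

text \<open>The ratio of the squared norm to the absolute value of the determinant depends only on the
  class of a matrix; it is \<open>x\<^sup>2 + x\<^bsup>-2\<^esup>\<close> here, which recovers \<open>x\<close>.\<close>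

lemma val_mat_invariant:
  assumes x: "x \<ge> 1" and B: "B \<noteq> mzero" and "mdet B = 0 \<or> x = 1 \<and> mdet B = 1"
  obtains N where "N > 0" "mdet (val_mat x B) = complex_of_real N" "mnorm2 (val_mat x B) = (x\<^sup>2 + 1 / x\<^sup>2) * N"
proof (cases "mdet B = 0")
  case True
  then show ?thesis using that[of "mnorm2 B"] mdet_val_mat[of x B] mnorm2_val_mat[of x B] x mnorm2_pos[OF B] by simp
next
  case False
  then show ?thesis using that[of "mnorm2 B + 2"] mdet_val_mat[of x B] mnorm2_val_mat[of x B] x mnorm2_pos[OF B] assms(3)
    by simp
qed

text \<open>\<open>adjc\<close> is conjugate-linear, so a factor passes through the combination when
  it is real.\<close>

lemma real_lincomb_msmult:
  assumes "cnj m = m"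
  shows "msmult p (madd (msmult q (msmult m V)) (msmult r (adjc (msmult m V)))) =
    msmult m (msmult p (madd (msmult q V) (msmult r (adjc V))))"
  using assms by (cases V) (simp add: algebra_simps)

text \<open>Both determinants are positive reals, so the square of \<mu> is positive and \<mu> is
  real. The invariant ratio gives equality of the levels, and a real scalar passes to the leading
  matrices. The phase of the leading matrix thus remains visible up to sign.\<close>

lemma val_mat_eqD:
  assumes x: "x > 1" and B: "B \<noteq> mzero" "mdet B = 0"
    and y: "y \<ge> 1" and B': "B' \<noteq> mzero" "mdet B' = 0 \<or> y = 1 \<and> mdet B' = 1"
    and eq: "val_mat y B' = msmult \<mu> (val_mat x B)" and \<mu>: "\<mu> \<noteq> 0"
  shows "y = x" "\<exists>m. m \<noteq> 0 \<and> B' = msmult (complex_of_real m) B"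
proof -
  obtain N where N: "N > 0" "mdet (val_mat x B) = complex_of_real N" "mnorm2 (val_mat x B) = (x\<^sup>2 + 1 / x\<^sup>2) * N"
    by (rule val_mat_invariant[of x B]) (use x B in auto)
  obtain N' where N': "N' > 0" "mdet (val_mat y B') = complex_of_real N'" "mnorm2 (val_mat y B') = (y\<^sup>2 + 1 / y\<^sup>2) * N'"
    by (rule val_mat_invariant[of y B']) (use y B' in auto)
  have d: "complex_of_real N' = \<mu> * \<mu> * complex_of_real N" using N N' eq by (simp add: mdet_msmult)
  then have "cmod (complex_of_real N') = cmod (\<mu> * \<mu> * complex_of_real N)" by simp
  then have N'eq: "N' = (cmod \<mu>)\<^sup>2 * N" using N N' by (simp add: norm_mult power2_eq_square)
  have "(y\<^sup>2 + 1 / y\<^sup>2) * N' = (cmod \<mu>)\<^sup>2 * ((x\<^sup>2 + 1 / x\<^sup>2) * N)"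
    using N N' eq by (simp add: mnorm2_msmult)
  then have "(y\<^sup>2 + 1 / y\<^sup>2) * N' = (x\<^sup>2 + 1 / x\<^sup>2) * N'" using N'eq by simp
  then have "y\<^sup>2 + 1 / y\<^sup>2 = x\<^sup>2 + 1 / x\<^sup>2" using N' by simp
  \<comment> \<open>An equality u + 1/u = v + 1/v leaves u = v or u v = 1; the strict bound on
    \<open>x\<close> excludes the second.\<close>
  then have "(x\<^sup>2 - y\<^sup>2) * (x\<^sup>2 * y\<^sup>2 - 1) = 0" using x y by (simp add: field_simps)
  moreover have "x\<^sup>2 * y\<^sup>2 > 1"
  proof -
    have "1 < x\<^sup>2" "1 \<le> y\<^sup>2" using x y by (simp_all add: one_less_power one_le_power)
    then show ?thesis using mult_left_mono[of 1 "y\<^sup>2" "x\<^sup>2"] by simp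
  qed
  ultimately have "x\<^sup>2 = y\<^sup>2" by auto
  then show yx: "y = x" using x y by (simp add: power2_eq_iff)
  have "\<mu> * \<mu> = complex_of_real (N' / N)" using d N by (simp add: field_simps)
  then have im: "2 * (Re \<mu> * Im \<mu>) = 0" and re: "Re \<mu> * Re \<mu> - Im \<mu> * Im \<mu> = N' / N"
    by (auto simp: complex_eq_iff)
  have "Im \<mu> = 0"
  proof (rule ccontr)
    assume "Im \<mu> \<noteq> 0"
    then have "Re \<mu> = 0" using im by simp
    then have "- (Im \<mu> * Im \<mu>) = N' / N" using re by simp
    moreover have "N' / N > 0" using N N' by simp
    moreover have "Im \<mu> * Im \<mu> \<ge> 0" by simp
    ultimately show False by linarith
  qed
  then have m: "\<mu> = complex_of_real (Re \<mu>)" and cm: "cnj \<mu> = \<mu>" by (simp_all add: complex_eq_iff)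
  let ?m = "Re \<mu>" and ?X = "complex_of_real x"
  have X: "?X \<noteq> 0" "?X * ?X - 1 / (?X * ?X) \<noteq> 0"
  proof -
    show "?X \<noteq> 0" using x by simp
    have "x * x > 1" using x by (simp add: less_1_mult)
    then have "1 / (x * x) < 1" by simp
    with \<open>x * x > 1\<close> have "x * x - 1 / (x * x) \<noteq> 0" by linarith
    moreover have "?X * ?X - 1 / (?X * ?X) = complex_of_real (x * x - 1 / (x * x))" by simp
    ultimately show "?X * ?X - 1 / (?X * ?X) \<noteq> 0" by (simp only: of_real_eq_0_iff not_False_eq_True)
  qed
  let ?D = "?X * ?X - 1 / (?X * ?X)"
  \<comment> \<open>As \<open>adjc\<close> is an involution, x V - (1/x) \<open>adjc V\<close> for V
    = \<open>val_mat x U\<close> equals (x^2 - x^(-2)) U, and this factor is nonzero because x > 1.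
    So \<open>R\<close> is a left inverse that commutes with real scalars.\<close>
  define R where "R V = msmult (1 / ?D) (madd (msmult ?X V) (msmult (- (1 / ?X)) (adjc V)))" for V
  have cancel: "1 / D * (D * a) = a" if "D \<noteq> 0" for a D :: complex using that by simp
  have entry: "1 / ?D * (?X * (?X * a + 1 / ?X * b) + - (1 / ?X) * (?X * b + 1 / ?X * a)) = a" for a b
  proof -
    have "?X * (?X * a + 1 / ?X * b) + - (1 / ?X) * (?X * b + 1 / ?X * a) = ?D * a"
      using X(1) by (simp add: field_simps)
    then show ?thesis using cancel[OF X(2)] by metis
  qed
  have R: "R (val_mat x U) = U" for U
  proof (cases U)
    case (M2 a b c e)
    have v: "val_mat x U = M2 (?X * a + 1 / ?X * cnj e) (?X * b + 1 / ?X * (- cnj c))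
        (?X * c + 1 / ?X * (- cnj b)) (?X * e + 1 / ?X * cnj a)"
      "adjc (val_mat x U) = M2 (?X * cnj e + 1 / ?X * a) (?X * (- cnj c) + 1 / ?X * b)
        (?X * (- cnj b) + 1 / ?X * c) (?X * cnj a + 1 / ?X * e)"
      by (simp_all add: M2 val_mat_def)
    show ?thesis unfolding R_def v(2) unfolding v(1) msmult.simps madd.simps entry by (simp only: M2)
  qed
  have "B' = msmult \<mu> B"
  proof -
    have "R (val_mat x B') = msmult \<mu> (R (val_mat x B))"
      unfolding R_def eq[unfolded yx] by (rule real_lincomb_msmult[OF cm])
    then show ?thesis by (simp only: R)
  qed
  then show "\<exists>m. m \<noteq> 0 \<and> B' = msmult (complex_of_real m) B" using m \<mu> by (metis of_real_0)
qed

lemma cclass_eqD: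
  assumes "cclass A = cclass B"
  shows "\<exists>\<mu>. \<mu> \<noteq> 0 \<and> B = msmult \<mu> A"
proof -
  have "msmult 1 B \<in> cclass B" unfolding cclass_def by (intro CollectI exI[of _ 1]) simp
  then have "B \<in> cclass A" using assms by (simp add: msmult_1)
  then show ?thesis by (auto simp: cclass_def)
qed

lemma VALm_det_0:
  assumes "mdet A = 0" "mval_le A q" "mcoef A q \<noteq> mzero"
  shows "VALm A = cclass (mcoef A q)"
  using assms mlead by (simp add: VALm_def)

text \<open>The properties of the scalar chosen by \<open>SOME\<close> all come from its equation
  det = 1, which fixes it up to sign. The coefficient of t^(2 \<alpha>) in this equation is the
  determinant of the leading matrix; hence \<alpha> \<ge> 0, and the leading matrix is singular
  unless \<alpha> = 0.\<close>

lemma VALm_det_nonzero: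
  assumes "mdet A \<noteq> 0"
  obtains s \<alpha> where "s * s * mdet A = 1" "mdet (msmult s A) = 1" "mval_le (msmult s A) \<alpha>" "mcoef (msmult s A) \<alpha> \<noteq> mzero"
    "0 \<le> \<alpha>" "mdet (mcoef (msmult s A) \<alpha>) = (if \<alpha> = 0 then 1 else 0)"
    "VALm A = cclass (val_mat (exp (real_of_rat \<alpha>)) (mcoef (msmult s A) \<alpha>))"
proof -
  obtain y where "y * y = inverse (mdet A)" using puiseux_sqrt_exists by blast
  then have "mdet (msmult y A) = 1" using assms by (simp add: mdet_msmult)
  then have s: "mdet (msmult (SOME l. mdet (msmult l A) = 1) A) = 1" by (rule someI)
  define s where "s = (SOME l. mdet (msmult l A) = 1)"
  have s1: "mdet (msmult s A) = 1" using s by (simp add: s_def)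
  then have "msmult s A \<noteq> mzero" by (auto simp: mzero_def)
  then obtain \<alpha> where \<alpha>: "mval_le (msmult s A) \<alpha>" "mcoef (msmult s A) \<alpha> \<noteq> mzero" using mlead_exists by blast
  note d = val_mdet[OF \<alpha>(1), unfolded s1]
  have "0 \<le> \<alpha>" using d(1) val_le_tpow[of 0 "2 * \<alpha>"] by (simp add: tpow_0)
  moreover have "mdet (mcoef (msmult s A) \<alpha>) = (if \<alpha> = 0 then 1 else 0)" using d(2) by (simp add: Rep_puiseux_1)
  moreover have "VALm A = cclass (val_mat (exp (real_of_rat \<alpha>)) (mcoef (msmult s A) \<alpha>))"
    using assms mlead[OF \<alpha>] by (simp add: VALm_def Let_def s_def[symmetric] val_mat_def exp_minus inverse_eq_divide)
  moreover have "s * s * mdet A = 1" using s1 by (simp add: mdet_msmult)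
  ultimately show ?thesis using that s1 \<alpha> by blast
qed

text \<open>A zero determinant kills every term that carries a positive power of it; what remains is
  the last one, whose form has degree \<open>d\<close>.\<close>

lemma Sd_poly_det_0:
  assumes "mdet A = 0" "Sd_poly d c A = 0" "mval_le A q"
  shows "fval c d (mcoef A q) = 0"
proof -
  let ?t = "\<lambda>j. tpow (- of_nat (j * (j + 1))) * mdet A ^ (d div 2 - j)
                   * kpeval (2 * j + d mod 2) (\<lambda>m. c (2 * j + d mod 2, m)) A"
  have "(\<Sum>j\<le>d div 2. ?t j) = (\<Sum>j\<in>{d div 2}. ?t j)"
    by (rule sum.mono_neutral_right) (use assms(1) in \<open>auto simp: zero_power\<close>)
  then have "?t (d div 2) = 0" using assms(2) by (simp only: Sd_poly_eq sum.insert[OF finite.emptyI] sum.empty) simp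
  then have "kpeval (2 * (d div 2) + d mod 2) (\<lambda>m. c (2 * (d div 2) + d mod 2, m)) A = 0" by simp
  then have "kpeval d (\<lambda>m. c (d, m)) A = 0" unfolding mult_div_mod_eq .
  then show ?thesis using val_kpeval(2)[OF assms(3), of d "\<lambda>m. c (d, m)"] by simp
qed

text \<open>The point of the surface with the same value must be singular as well, since a matrix of
  nonzero determinant has a value of positive determinant.\<close>

lemma VAL_surface_det_0:
  assumes VAL: "VALm A \<in> VALs (surface d c)" and A: "mdet A = 0" "mval_le A q" "mcoef A q \<noteq> mzero"
  shows "fval c d (mcoef A q) = 0"
proof -
  obtain A' where A': "VALm A = VALm A'" "A' \<noteq> mzero" "Sd_poly d c A' = 0"
    using VAL by (auto simp: VALs_def surface_def)
  have VA: "VALm A = cclass (mcoef A q)" by (rule VALm_det_0[OF A])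
  have dB: "mdet (mcoef A q) = 0" using val_mdet(2)[OF A(2)] A(1) by simp
  show ?thesis
  proof (cases "mdet A' = 0")
    case True
    obtain q' where q': "mval_le A' q'" "mcoef A' q' \<noteq> mzero" using mlead_exists[OF A'(2)] .
    have "fval c d (mcoef A' q') = 0" by (rule Sd_poly_det_0[OF True A'(3) q'(1)])
    moreover obtain \<mu> where "\<mu> \<noteq> 0" "mcoef A' q' = msmult \<mu> (mcoef A q)"
      using cclass_eqD VA A'(1) VALm_det_0[OF True q'] by metis
    ultimately show ?thesis by (simp add: cform_msmult)
  next
    case False
    obtain s \<alpha> where s: "mcoef (msmult s A') \<alpha> \<noteq> mzero" "0 \<le> \<alpha>" "mdet (mcoef (msmult s A') \<alpha>) = (if \<alpha> = 0 then 1 else 0)"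
      "VALm A' = cclass (val_mat (exp (real_of_rat \<alpha>)) (mcoef (msmult s A') \<alpha>))"
      using VALm_det_nonzero[OF False] by metis
    obtain N where N: "N > 0" "mdet (val_mat (exp (real_of_rat \<alpha>)) (mcoef (msmult s A') \<alpha>)) = complex_of_real N"
      by (rule val_mat_invariant[of "exp (real_of_rat \<alpha>)" "mcoef (msmult s A') \<alpha>"]) (use s in \<open>auto split: if_splits\<close>)
    obtain \<mu> where "val_mat (exp (real_of_rat \<alpha>)) (mcoef (msmult s A') \<alpha>) = msmult \<mu> (mcoef A q)"
      using cclass_eqD VA A'(1) s(4) by metis
    then have "complex_of_real N = 0" using N dB by (simp add: mdet_msmult)
    then show ?thesis using N by simp
  qed
qed

text \<open>Rescaling \<open>A\<close> to determinant 1 multiplies its leading matrix by some w with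
  w^2 \<delta> = 1, where \<delta> is the leading coefficient of \<open>u\<close>. The surface point
  with the same value has leading matrix m w times the given one, with m real, so the equations at
  that point become conditions on the given matrix.\<close>

lemma VAL_surface_det_nonzero:
  assumes VAL: "VALm A \<in> VALs (surface d c)" and A: "mval_le A 0" "mcoef A 0 \<noteq> mzero"
    and det: "mdet A = tpow (- 2 * \<alpha>) * u" "val_le u 0" "Rep_puiseux u 0 \<noteq> 0" and \<alpha>: "\<alpha> > 0"
  shows "tropical_cond d c \<alpha> (Rep_puiseux u 0) (mcoef A 0)"
proof -
  let ?\<delta> = "Rep_puiseux u 0"
  have "u \<noteq> 0" using det(3) by auto
  then have nz: "mdet A \<noteq> 0" using det(1) by simp
  obtain s \<beta> where s: "s * s * mdet A = 1" "mdet (msmult s A) = 1" "mval_le (msmult s A) \<beta>" "mcoef (msmult s A) \<beta> \<noteq> mzero"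
    "0 \<le> \<beta>" "mdet (mcoef (msmult s A) \<beta>) = (if \<beta> = 0 then 1 else 0)"
    "VALm A = cclass (val_mat (exp (real_of_rat \<beta>)) (mcoef (msmult s A) \<beta>))"
    using VALm_det_nonzero[OF nz] by metis
  have "s \<noteq> 0" using s(1) by auto
  then obtain v where v: "val_le s v" "Rep_puiseux s v \<noteq> 0" using val_exists by blast
  define w where "w = Rep_puiseux s v"
  have "s * s * u = tpow (2 * \<alpha>)"
  proof -
    have "s * s * u = tpow (2 * \<alpha>) * (s * s * mdet A)"
      unfolding det(1) by (simp add: mult.left_commute mult.assoc[symmetric])
    then show ?thesis using s(1) by simp
  qed
  moreover have "Rep_puiseux (s * s * u) (v + v + 0) = w * w * ?\<delta>"
    using Rep_mult_lead[OF val_le_mult[OF v(1) v(1)] det(2)] Rep_mult_lead[OF v(1) v(1)] by (simp add: w_def)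
  ultimately have "(if v + v = 2 * \<alpha> then 1 else 0) = w * w * ?\<delta>" by (simp add: Rep_tpow)
  then have va: "v = \<alpha>" and w: "w * w * ?\<delta> = 1" using v(2) det(3) by (auto simp: w_def split: if_splits)
  have mc: "mval_le (msmult s A) \<alpha>" "mcoef (msmult s A) \<alpha> = msmult w (mcoef A 0)"
    using val_msmult[OF A(1) v(1)] by (simp_all add: va w_def)
  have w0: "w \<noteq> 0" using w by auto
  then have "mcoef (msmult s A) \<alpha> \<noteq> mzero" using A(2) by (simp add: mc(2) msmult_eq_mzero_iff)
  then have \<beta>: "\<beta> = \<alpha>" using mlead(1)[OF mc(1)] mlead(1)[OF s(3,4)] by simp
  obtain A' where A': "VALm A = VALm A'" "A' \<noteq> mzero" "Sd_poly d c A' = 0"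
    using VAL by (auto simp: VALs_def surface_def)
  let ?B = "mcoef (msmult s A) \<alpha>"
  have B: "?B \<noteq> mzero" "mdet ?B = 0" "VALm A = cclass (val_mat (exp (real_of_rat \<alpha>)) ?B)"
    using s(4,6,7) \<alpha> by (auto simp: \<beta>)
  have x1: "exp (real_of_rat \<alpha>) > 1" using \<alpha> by simp
  have nz': "mdet A' \<noteq> 0"
  proof
    assume 0: "mdet A' = 0"
    obtain q' where q': "mval_le A' q'" "mcoef A' q' \<noteq> mzero" using mlead_exists[OF A'(2)] .
    then have "mdet (mcoef A' q') = 0" using val_mdet(2)[OF q'(1)] 0 by simp
    moreover obtain \<mu> where "\<mu> \<noteq> 0" "val_mat (exp (real_of_rat \<alpha>)) ?B = msmult \<mu> (mcoef A' q')"
      using cclass_eqD B(3) A'(1) VALm_det_0[OF 0 q'] by metis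
    moreover obtain N where "N > 0" "mdet (val_mat (exp (real_of_rat \<alpha>)) ?B) = complex_of_real N"
      by (rule val_mat_invariant[of "exp (real_of_rat \<alpha>)" ?B]) (use B x1 in auto)
    ultimately show False by (simp add: mdet_msmult)
  qed
  obtain s' \<alpha>' where s': "mdet (msmult s' A') = 1" "mval_le (msmult s' A') \<alpha>'" "mcoef (msmult s' A') \<alpha>' \<noteq> mzero"
    "0 \<le> \<alpha>'" "mdet (mcoef (msmult s' A') \<alpha>') = (if \<alpha>' = 0 then 1 else 0)"
    "VALm A' = cclass (val_mat (exp (real_of_rat \<alpha>')) (mcoef (msmult s' A') \<alpha>'))"
    using VALm_det_nonzero[OF nz'] by metis
  let ?B' = "mcoef (msmult s' A') \<alpha>'"
  obtain \<mu> where \<mu>: "\<mu> \<noteq> 0" "val_mat (exp (real_of_rat \<alpha>')) ?B' = msmult \<mu> (val_mat (exp (real_of_rat \<alpha>)) ?B)"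
    using cclass_eqD B(3) A'(1) s'(6) by metis
  have "exp (real_of_rat \<alpha>') = exp (real_of_rat \<alpha>)" "\<exists>m. m \<noteq> 0 \<and> ?B' = msmult (complex_of_real m) ?B"
    using val_mat_eqD[OF x1 B(1,2) _ s'(3) _ \<mu>(2,1)] s'(4,5) by (auto split: if_splits)
  then obtain m where aa: "\<alpha>' = \<alpha>" and m: "m \<noteq> 0" "?B' = msmult (complex_of_real m * w) (mcoef A 0)"
    by (auto simp: mc(2) msmult_msmult)
  have "Sd_poly d c (msmult s' A') = 0" by (simp add: Sd_poly_msmult A'(3))
  note S = surface_leading[OF this s'(1,2) refl, unfolded m(2) cform_msmult, unfolded aa]
  let ?z = "complex_of_real m * w"
  have z: "?z \<noteq> 0" using m w0 by simp
  \<comment> \<open>The phase of the factor is dictated by \<delta>; its free real part m^2 becomes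
    the unknown weight \<rho>.\<close>
  have z2: "?z\<^sup>2 = complex_of_real (m\<^sup>2) / ?\<delta>"
    using w det(3) by (simp add: field_simps power2_eq_square)
  show ?thesis
    unfolding tropical_cond_def
  proof (intro conjI allI impI)
    fix j assume "j \<le> d div 2" "of_nat j < \<alpha>" "\<alpha> < of_nat j + 1 \<or> j = d div 2"
    then show "fval c (2 * j + d mod 2) (mcoef A 0) = 0" using S(1) z by auto
  next
    fix j assume j: "j < d div 2" "\<alpha> = of_nat j + 1"
    let ?f = "fval c (2 * j + 2 + d mod 2) (mcoef A 0)" and ?g = "fval c (2 * j + d mod 2) (mcoef A 0)"
    have "?z ^ (2 * j + 2 + d mod 2) * ?f + ?z ^ (2 * j + d mod 2) * ?g = 0" using S(2) j by blast
    moreover have e: "?z ^ (2 * j + 2 + d mod 2) = ?z ^ (2 * j + d mod 2) * ?z\<^sup>2"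
      by (simp only: power_add mult_ac)
    ultimately have "?z ^ (2 * j + d mod 2) * (?z\<^sup>2 * ?f + ?g) = 0" unfolding e by (simp only: distrib_left mult.assoc)
    then have "?z\<^sup>2 * ?f + ?g = 0" using z by simp
    then have "complex_of_real (m\<^sup>2) * ?f + ?\<delta> * ?g = 0" unfolding z2 using det(3) by (simp add: field_simps)
    then show "\<exists>\<rho>>0. complex_of_real \<rho> * ?f + ?\<delta> * ?g = 0" using m(1) by (intro exI[of _ "m\<^sup>2"]) simp
  qed
qed

section \<open>Lines\<close>

lemma pivot_exists:
  fixes M :: "nat \<Rightarrow> nat \<Rightarrow> puiseux"
  assumes "i < n" "j < n" "M i j \<noteq> 0"
  obtains i j where "i < n" "j < n" "M i j \<noteq> 0" "\<And>k l. k < n \<Longrightarrow> l < n \<Longrightarrow> val_le (M k l / M i j) 0"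
proof -
  let ?X = "(\<lambda>(k, l). M k l) ` ({..<n} \<times> {..<n})"
  have "finite ?X" "\<exists>x\<in>?X. x \<noteq> 0" using assms by auto
  then obtain q m where q: "m \<in> ?X" "Rep_puiseux m q \<noteq> 0" "\<And>x. x \<in> ?X \<Longrightarrow> val_le x q"
    by (rule finite_lead_exists) blast
  then obtain i' j' where ij: "i' < n" "j' < n" "m = M i' j'" by auto
  have "val_le (inverse m) (- q)" using val_inverse q by blast
  then have "val_le (M k l / m) 0" if "k < n" "l < n" for k l
    using val_le_mult[of "M k l" q "inverse m" "- q"] q(3)[of "M k l"] that by (auto simp: divide_inverse)
  moreover have "M i' j' \<noteq> 0" using q(2) ij by auto
  ultimately show ?thesis using that ij by blast
qed

definition lincomb :: "'a::{plus,times} \<Rightarrow> 'a \<Rightarrow> 'a mat2 \<Rightarrow> 'a mat2 \<Rightarrow> 'a mat2" where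
  "lincomb l m P Q = madd (msmult l P) (msmult m Q)"

lemma lincomb_M2:
  "lincomb l m (M2 a b c e) (M2 a' b' c' e') = M2 (l * a + m * a') (l * b + m * b') (l * c + m * c') (l * e + m * e')"
  by (simp add: lincomb_def)

lemma lincomb_lincomb:
  "lincomb l m (lincomb a b P Q) (lincomb a' b' P Q) = lincomb (l * a + m * a') (l * b + m * b') P (Q :: 'a::comm_ring_1 mat2)"
  by (cases P; cases Q) (simp add: lincomb_M2 algebra_simps)

lemma lincomb_0: "lincomb 0 0 P Q = (mzero :: 'a::comm_ring_1 mat2)"
  by (cases P; cases Q) (simp add: lincomb_M2 mzero_def)

lemma val_le_0_mult: "val_le x 0 \<Longrightarrow> val_le y 0 \<Longrightarrow> val_le (x * y) 0"
  using val_le_mult[of x 0 y 0] by simp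

lemma val_lincomb:
  assumes "val_le l 0" "val_le m 0" "mval_le P 0" "mval_le Q 0"
  shows "mval_le (lincomb l m P Q) 0"
    "mcoef (lincomb l m P Q) 0 = lincomb (Rep_puiseux l 0) (Rep_puiseux m 0) (mcoef P 0) (mcoef Q 0)"
proof -
  have le: "val_le (l * a + m * b) 0" if "val_le a 0" "val_le b 0" for a b
    using that assms by (intro val_le_add val_le_0_mult)
  have rep: "Rep_puiseux (l * a + m * b) 0 = Rep_puiseux l 0 * Rep_puiseux a 0 + Rep_puiseux m 0 * Rep_puiseux b 0"
    if "val_le a 0" "val_le b 0" for a b
    using Rep_mult_lead[OF assms(1) that(1)] Rep_mult_lead[OF assms(2) that(2)] by simp
  obtain a b c e a' b' c' e' where "P = M2 a b c e" "Q = M2 a' b' c' e'" by (cases P; cases Q)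
  then show "mval_le (lincomb l m P Q) 0"
    "mcoef (lincomb l m P Q) 0 = lincomb (Rep_puiseux l 0) (Rep_puiseux m 0) (mcoef P 0) (mcoef Q 0)"
    using assms(3,4) by (simp_all add: lincomb_M2 le rep del: Rep_puiseux_add)
qed

text \<open>The basis is obtained by pivoting on a \<open>2 \<times> 2\<close> minor of maximal order.\<close>

lemma kline_reduced_basis:
  assumes "is_kline L"
  obtains P Q where "mval_le P 0" "mval_le Q 0"
    "\<And>l m. lincomb l m (mcoef P 0) (mcoef Q 0) = mzero \<Longrightarrow> l = 0 \<and> m = 0"
    "\<And>l m. lincomb l m P Q \<noteq> mzero \<Longrightarrow> lincomb l m P Q \<in> L"
proof -
  obtain P Q where ind: "kindep P Q" and L: "L = kline P Q" using assms by (auto simp: is_kline_def)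
  define p where "p i = mentries P ! i" for i
  define q where "q i = mentries Q ! i" for i
  have P: "P = M2 (p 0) (p 1) (p 2) (p 3)" by (cases P) (simp add: p_def eval_nat_numeral)
  have Q: "Q = M2 (q 0) (q 1) (q 2) (q 3)" by (cases Q) (simp add: q_def eval_nat_numeral)
  define M where "M i j = p i * q j - p j * q i" for i j
  have ind': "l = 0 \<and> m = 0" if "lincomb l m P Q = mzero" for l m
    using ind that by (auto simp: kindep_def lincomb_def)
  have less4: "i < 4 \<longleftrightarrow> i = 0 \<or> i = 1 \<or> i = 2 \<or> i = 3" for i :: nat by auto
  have "\<exists>i<4. \<exists>j<4. M i j \<noteq> 0"
  proof (rule ccontr)
    assume "\<not> ?thesis"
    then have M0: "p i * q j = p j * q i" if "i < 4" "j < 4" for i j using that by (auto simp: M_def)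
    have "p i = 0" if i: "i < 4" for i
    proof -
      have "lincomb (q i) (- p i) P Q = mzero"
        using M0[OF i, of 0] M0[OF i, of 1] M0[OF i, of 2] M0[OF i, of 3]
        by (simp add: P Q lincomb_M2 mzero_def mult.commute)
      then show ?thesis using ind' by fastforce
    qed
    then have "lincomb 1 0 P Q = mzero" by (simp add: P Q lincomb_M2 mzero_def)
    then show False using ind' by fastforce
  qed
  then obtain i j where ij: "i < 4" "j < 4" "M i j \<noteq> 0" "\<And>k l. k < 4 \<Longrightarrow> l < 4 \<Longrightarrow> val_le (M k l / M i j) 0"
    using pivot_exists[of _ 4 _ M] by metis
  \<comment> \<open>These are the rows of the reduced echelon form at the coordinates i and j: the
    entries there are 1, 0 and 0, 1, which keeps the reductions independent, and the other entries
    are ratios of minors, of order at most 0 by the choice of the pivot.\<close>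
  define P' where "P' = lincomb (q j / M i j) (- p j / M i j) P Q"
  define Q' where "Q' = lincomb (- q i / M i j) (p i / M i j) P Q"
  have P': "P' = M2 (M 0 j / M i j) (M 1 j / M i j) (M 2 j / M i j) (M 3 j / M i j)"
    by (simp add: P'_def P Q lincomb_M2 M_def diff_divide_distrib mult.commute)
  have Q': "Q' = M2 (M i 0 / M i j) (M i 1 / M i j) (M i 2 / M i j) (M i 3 / M i j)"
    by (simp add: Q'_def P Q lincomb_M2 M_def diff_divide_distrib mult.commute)
  show ?thesis
  proof
    show "mval_le P' 0" "mval_le Q' 0" using ij by (simp_all add: P' Q')
    fix l m :: complex assume *: "lincomb l m (mcoef P' 0) (mcoef Q' 0) = mzero"
    have k: "l * Rep_puiseux (M k j / M i j) 0 + m * Rep_puiseux (M i k / M i j) 0 = 0" if "k < 4" for k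
      using that * by (auto simp: P' Q' lincomb_M2 mzero_def less4)
    have "M i i = 0" "M j j = 0" by (simp_all add: M_def)
    then show "l = 0 \<and> m = 0" using k[OF ij(1)] k[OF ij(2)] ij(3) by (simp add: Rep_puiseux_1)
  next
    fix l m assume nz: "lincomb l m P' Q' \<noteq> mzero"
    then have "\<exists>l' m'. lincomb l m P' Q' = lincomb l' m' P Q \<and> (l', m') \<noteq> (0, 0)"
      unfolding P'_def Q'_def lincomb_lincomb using lincomb_0 by (metis prod.inject)
    then show "lincomb l m P' Q' \<in> L" unfolding L kline_def lincomb_def by blast
  qed
qed

section \<open>The determinant along a line and the roots of its quadratic form\<close>

definition qform :: "'a \<Rightarrow> 'a \<Rightarrow> 'a \<Rightarrow> 'a \<Rightarrow> 'a \<Rightarrow> 'a::comm_ring_1" where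
  "qform a b c l m = a * l * l + b * l * m + c * m * m"

text \<open>The polarization of the determinant, which is the mixed coefficient of det (l P + m
  Q).\<close>

fun mpolar :: "'a::comm_ring_1 mat2 \<Rightarrow> 'a mat2 \<Rightarrow> 'a" where
  "mpolar (M2 a b c e) (M2 a' b' c' e') = a * e' + a' * e - b * c' - b' * c"

lemma mdet_lincomb: "mdet (lincomb l m P Q) = qform (mdet P) (mpolar P Q) (mdet Q) l m"
  by (cases P; cases Q) (simp add: lincomb_M2 qform_def algebra_simps)

lemma Rep_mult_0: "val_le x 0 \<Longrightarrow> val_le y 0 \<Longrightarrow> Rep_puiseux (x * y) 0 = Rep_puiseux x 0 * Rep_puiseux y 0"
  using Rep_mult_lead[of x 0 y 0] by simp

lemmas val_le_0_intros = val_le_add val_le_diff val_le_uminus val_le_0_mult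

lemma val_le_kconst_0: "val_le (kconst z) 0"
  by (simp add: val_le_kconst)

lemma Rep_kconst_0: "Rep_puiseux (kconst z) 0 = z"
  by (simp add: Rep_kconst)

lemma val_qform:
  assumes "val_le a 0" "val_le b 0" "val_le c 0" "val_le l 0" "val_le m 0"
  shows "val_le (qform a b c l m) 0" "Rep_puiseux (qform a b c l m) 0 =
    qform (Rep_puiseux a 0) (Rep_puiseux b 0) (Rep_puiseux c 0) (Rep_puiseux l 0) (Rep_puiseux m 0)"
  unfolding qform_def using assms by (simp_all add: val_le_0_intros Rep_mult_0)

lemma val_le_sqrt:
  assumes "val_le (w * w) 0"
  shows "val_le w 0"
proof (cases "w = 0")
  case False
  then obtain v where v: "val_le w v" "Rep_puiseux w v \<noteq> 0" using val_exists by blast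
  then have "Rep_puiseux (w * w) (v + v) \<noteq> 0" using Rep_mult_lead[OF v(1) v(1)] by simp
  then have "v + v \<le> 0" using assms val_leD by (metis not_le)
  then show ?thesis using v val_le_mono by (metis add_le_same_cancel1 add_nonneg_pos linorder_not_less less_eq_rat_def)
qed simp

lemma puiseux_two: "val_le 2 0" "Rep_puiseux 2 0 = 2"
proof -
  have "(2::puiseux) = kconst 2"
    unfolding one_add_one[symmetric] by (simp only: Rep_puiseux_eq_iff Rep_puiseux_add Rep_puiseux_1 Rep_kconst) simp
  then show "val_le 2 0" "Rep_puiseux 2 0 = 2" by (metis val_le_kconst_0, metis Rep_kconst_0)
qed

text \<open>A case of Hensel's lemma that also admits a double root of the reduction. The sign of
  the square root of the discriminant is chosen so that its reduction is that of \<open>b\<close>.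
  If that reduction is zero, the one of \<open>a\<close> is not, and the usual quadratic formula
  applies.\<close>

lemma quadratic_infinitesimal_root:
  assumes a: "val_le a 0" and b: "val_le b 0" and c: "val_le c 0"
    and nz: "Rep_puiseux a 0 \<noteq> 0 \<or> Rep_puiseux b 0 \<noteq> 0" and c0: "Rep_puiseux c 0 = 0"
  obtains z where "val_le z 0" "Rep_puiseux z 0 = 0" "a * z * z + b * z + c = 0"
proof -
  let ?D = "b * b - (2 * 2) * (a * c)"
  note two = puiseux_two
  obtain w where w: "w * w = ?D" using puiseux_sqrt_exists by blast
  have "val_le ?D 0" using a b c two by (intro val_le_0_intros)
  then have w0: "val_le w 0" by (rule val_le_sqrt[of w, unfolded w])
  have "Rep_puiseux (w * w) 0 = Rep_puiseux b 0 * Rep_puiseux b 0"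
    unfolding w by (simp only: Rep_puiseux_diff Rep_mult_0 val_le_0_mult a b c two c0) simp
  then have "Rep_puiseux w 0 * Rep_puiseux w 0 = Rep_puiseux b 0 * Rep_puiseux b 0" by (simp add: Rep_mult_0 w0)
  then have wb: "Rep_puiseux w 0 = Rep_puiseux b 0 \<or> Rep_puiseux (- w) 0 = Rep_puiseux b 0"
    by (simp add: square_eq_iff) (metis minus_minus)
  have "\<exists>w. w * w = ?D \<and> val_le w 0 \<and> Rep_puiseux w 0 = Rep_puiseux b 0"
  proof (cases "Rep_puiseux w 0 = Rep_puiseux b 0")
    case True
    then show ?thesis using w w0 by blast
  next
    case False
    then show ?thesis using wb w w0 by (intro exI[of _ "- w"]) (simp add: val_le_uminus)
  qed
  then obtain w where w: "w * w = ?D" "val_le w 0" "Rep_puiseux w 0 = Rep_puiseux b 0" by blast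
  show ?thesis
  proof (cases "Rep_puiseux b 0 = 0")
    case False
    let ?u = "b + w"
    have u: "val_le ?u 0" "Rep_puiseux ?u 0 \<noteq> 0" using w b False by (auto intro: val_le_add)
    then have u0: "?u \<noteq> 0" by (metis Rep_puiseux_0)
    have iu: "val_le (inverse ?u) 0" using val_inverse[OF u] by simp
    \<comment> \<open>The rationalized quadratic formula: it divides by b + w, whose reduction is
      twice that of \<open>b\<close>, instead of 2 a, which may be infinitesimal or zero.\<close>
    let ?z = "- (2 * (c * inverse ?u))"
    have "a * ?z * ?z + b * ?z + c = c * inverse ?u * inverse ?u * (2 * 2 * (a * c) - 2 * b * ?u + ?u * ?u)"
    proof -
      have "u * i = 1 \<Longrightarrow> a * - (2 * (c * i)) * - (2 * (c * i)) + b * - (2 * (c * i)) + c =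
        c * i * i * (2 * 2 * (a * c) - 2 * b * u + u * u)" for u i
        by algebra
      then show ?thesis using u0 by simp
    qed
    also have "2 * 2 * (a * c) - 2 * b * ?u + ?u * ?u = w * w - ?D" by (simp add: algebra_simps)
    finally have "a * ?z * ?z + b * ?z + c = 0" using w by simp
    moreover have "val_le ?z 0" using two c iu by (intro val_le_0_intros)
    moreover have "Rep_puiseux ?z 0 = 0" using two c iu c0 by (simp add: Rep_mult_0 val_le_0_mult)
    ultimately show ?thesis using that by blast
  next
    case True
    then have a0: "Rep_puiseux a 0 \<noteq> 0" using nz by simp
    let ?u = "2 * a"
    have u: "val_le ?u 0" "Rep_puiseux ?u 0 \<noteq> 0" using two a a0 by (simp_all add: Rep_mult_0 val_le_0_mult)
    have u0: "?u \<noteq> 0" using u by (metis Rep_puiseux_0)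
    have iu: "val_le (inverse ?u) 0" using val_inverse[OF u] by simp
    let ?z = "(w - b) * inverse ?u"
    have "?u * ?z = w - b" using u0 by simp
    moreover have "2 * ?u * (a * ?z * ?z + b * ?z + c) = (?u * ?z) * (?u * ?z) + 2 * b * (?u * ?z) + 4 * a * c"
      by (simp only: algebra_simps) (simp add: algebra_simps)
    ultimately have "2 * ?u * (a * ?z * ?z + b * ?z + c) = (w - b) * (w - b) + 2 * b * (w - b) + 4 * a * c" by simp
    also have "\<dots> = w * w - ?D" by (simp add: algebra_simps)
    finally have "2 * ?u * (a * ?z * ?z + b * ?z + c) = 0" using w by simp
    moreover have "2 * ?u \<noteq> 0" using u0 two(2) by (metis Rep_puiseux_0 mult_eq_0_iff zero_neq_numeral)
    ultimately have "a * ?z * ?z + b * ?z + c = 0" by (metis mult_eq_0_iff)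
    moreover have "val_le ?z 0" using w b iu by (intro val_le_0_intros)
    moreover have "Rep_puiseux ?z 0 = 0"
      unfolding Rep_mult_0[OF val_le_diff[OF w(2) b] iu] Rep_puiseux_diff w(3) by simp
    ultimately show ?thesis using that by blast
  qed
qed

lemma val_le_infinitesimal_tpow: "\<beta> > 0 \<Longrightarrow> val_le (tpow (- \<beta>)) 0 \<and> Rep_puiseux (tpow (- \<beta>)) 0 = 0"
  by (auto simp: val_le_tpow Rep_tpow)

text \<open>Keep \<open>m\<close>, shift \<open>l\<close> by z, and solve the resulting quadratic
  equation for an infinitesimal z. The small value is attained exactly and the representative (l, m)
  of the root is arbitrary; this is the source of all levels above \<gamma> and of the arbitrary
  phase there.\<close>

lemma qform_small_value_aux:
  assumes abc: "val_le a 0" "val_le b 0" "val_le c 0" and \<beta>: "\<beta> > 0"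
    and nz: "Rep_puiseux a 0 \<noteq> 0 \<or> Rep_puiseux b 0 \<noteq> 0 \<or> Rep_puiseux c 0 \<noteq> 0"
    and root: "qform (Rep_puiseux a 0) (Rep_puiseux b 0) (Rep_puiseux c 0) l m = 0" and m: "m \<noteq> 0"
  shows "\<exists>l' m'. val_le l' 0 \<and> val_le m' 0 \<and> Rep_puiseux l' 0 = l \<and> Rep_puiseux m' 0 = m \<and> qform a b c l' m' = tpow (- \<beta>)"
proof -
  let ?l = "kconst l" and ?m = "kconst m"
  note k = val_le_kconst_0 Rep_kconst_0
  let ?b = "a * ?l + a * ?l + b * ?m" and ?c = "qform a b c ?l ?m - tpow (- \<beta>)"
  note t = val_le_infinitesimal_tpow[OF \<beta>]
  have vb: "val_le ?b 0" by (intro val_le_0_intros abc k(1))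
  have vc: "val_le ?c 0" by (intro val_le_diff val_qform(1) abc k(1) conjunct1[OF t])
  have rb: "Rep_puiseux ?b 0 = 2 * (Rep_puiseux a 0 * l) + Rep_puiseux b 0 * m"
    by (simp only: Rep_puiseux_add Rep_mult_0 abc k) simp
  have rc: "Rep_puiseux ?c 0 = 0"
    using root t by (simp add: val_qform(2)[OF abc k(1) k(1)] k(2))
  \<comment> \<open>If both vanished, the middle coefficient of the reduced form would vanish too
    since \<open>m\<close> is nonzero, and then the root would force the last coefficient to
    vanish.\<close>
  have "Rep_puiseux a 0 \<noteq> 0 \<or> Rep_puiseux ?b 0 \<noteq> 0"
  proof (rule ccontr)
    assume "\<not> ?thesis"
    then have a0: "Rep_puiseux a 0 = 0" and "2 * (Rep_puiseux a 0 * l) + Rep_puiseux b 0 * m = 0"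
      by (blast, metis rb)
    then have "Rep_puiseux b 0 = 0" using m by simp
    with a0 show False using nz root m by (simp add: qform_def)
  qed
  then obtain z where z: "val_le z 0" "Rep_puiseux z 0 = 0" "a * z * z + ?b * z + ?c = 0"
    using quadratic_infinitesimal_root[OF abc(1) vb vc _ rc] by blast
  have "qform a b c (?l + z) ?m - tpow (- \<beta>) = a * z * z + ?b * z + ?c"
    by (simp add: qform_def algebra_simps)
  then have "qform a b c (?l + z) ?m = tpow (- \<beta>)" using z(3) by (metis eq_iff_diff_eq_0)
  then show ?thesis using z k by (intro exI[of _ "?l + z"] exI[of _ ?m]) (simp add: val_le_add)
qed

lemma qform_swap: "qform a b c l m = qform c b a m l"
  by (simp add: qform_def algebra_simps)

lemma qform_small_value:
  assumes abc: "val_le a 0" "val_le b 0" "val_le c 0" and \<beta>: "\<beta> > 0"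
    and nz: "Rep_puiseux a 0 \<noteq> 0 \<or> Rep_puiseux b 0 \<noteq> 0 \<or> Rep_puiseux c 0 \<noteq> 0"
    and root: "qform (Rep_puiseux a 0) (Rep_puiseux b 0) (Rep_puiseux c 0) l m = 0" and lm: "(l, m) \<noteq> (0, 0)"
  obtains l' m' where "val_le l' 0" "val_le m' 0" "Rep_puiseux l' 0 = l" "Rep_puiseux m' 0 = m" "qform a b c l' m' = tpow (- \<beta>)"
proof (cases "m = 0")
  case False
  then show ?thesis using qform_small_value_aux[OF abc \<beta> nz root] that by blast
next
  case True
  then have l: "l \<noteq> 0" using lm by simp
  obtain m' l' where "val_le m' 0 \<and> val_le l' 0 \<and> Rep_puiseux m' 0 = m \<and> Rep_puiseux l' 0 = l \<and> qform c b a m' l' = tpow (- \<beta>)"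
    using qform_small_value_aux[OF abc(3,2,1) \<beta> _ root[unfolded qform_swap[of _ _ _ l m]] l] nz by blast
  then show ?thesis using that[of l' m'] qform_swap[of a b c l' m'] by simp
qed

text \<open>The first alternative is a line inside det = 0. In the second one, the weight at a root
  of the form is 1 because the determinant can be made exactly t^(-2 \<alpha>) there; at level
  \<gamma> it is the value of the form itself.\<close>

lemma VAL_line_conditions:
  assumes L: "is_kline L" and sub: "VALs L \<subseteq> VALs (surface d c)"
  obtains P Q where "\<And>l m. lincomb l m P Q = mzero \<Longrightarrow> l = 0 \<and> m = 0"
    "\<And>l m. (l, m) \<noteq> (0, 0) \<Longrightarrow> mdet (lincomb l m P Q) = 0 \<and> fval c d (lincomb l m P Q) = 0"
  | P Q \<gamma> e f g where "\<And>l m. lincomb l m P Q = mzero \<Longrightarrow> l = 0 \<and> m = 0" "(e, f, g) \<noteq> (0, 0, 0)" "\<gamma> \<ge> 0"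
    "\<And>l m. \<gamma> = 0 \<Longrightarrow> mdet (lincomb l m P Q) = qform e f g l m"
    "\<And>l m. \<gamma> > 0 \<Longrightarrow> mdet (lincomb l m P Q) = 0"
    "\<And>l m. \<gamma> > 0 \<Longrightarrow> qform e f g l m \<noteq> 0 \<Longrightarrow> tropical_cond d c \<gamma> (qform e f g l m) (lincomb l m P Q)"
    "\<And>l m \<alpha>. qform e f g l m = 0 \<Longrightarrow> (l, m) \<noteq> (0, 0) \<Longrightarrow> \<alpha> > \<gamma> \<Longrightarrow> tropical_cond d c \<alpha> 1 (lincomb l m P Q)"
proof -
  obtain P Q where P: "mval_le P 0" and Q: "mval_le Q 0"
    and ind: "\<And>l m. lincomb l m (mcoef P 0) (mcoef Q 0) = mzero \<Longrightarrow> l = 0 \<and> m = 0"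
    and mem: "\<And>l m. lincomb l m P Q \<noteq> mzero \<Longrightarrow> lincomb l m P Q \<in> L"
    using kline_reduced_basis[OF L] by blast
  let ?P = "mcoef P 0" and ?Q = "mcoef Q 0"
  note k = val_le_kconst_0 Rep_kconst_0
  have VAL: "VALm (lincomb l m P Q) \<in> VALs (surface d c)" and nz: "mcoef (lincomb l m P Q) 0 \<noteq> mzero"
    if "val_le l 0" "val_le m 0" "(Rep_puiseux l 0, Rep_puiseux m 0) \<noteq> (0, 0)" for l m
  proof -
    show nz: "mcoef (lincomb l m P Q) 0 \<noteq> mzero"
      using val_lincomb(2)[OF that(1,2) P Q] ind that(3) by auto
    have "lincomb l m P Q \<noteq> mzero" using nz by (auto simp: mzero_def)
    then show "VALm (lincomb l m P Q) \<in> VALs (surface d c)" using mem sub unfolding VALs_def by blast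
  qed
  define a b c' where "a = mdet P" and "b = mpolar P Q" and "c' = mdet Q"
  have det: "mdet (lincomb l m P Q) = qform a b c' l m" for l m
    by (simp add: mdet_lincomb a_def b_def c'_def)
  have abc: "val_le a 0" "val_le b 0" "val_le c' 0"
  proof -
    show "val_le a 0" "val_le c' 0" using val_mdet(1)[OF P] val_mdet(1)[OF Q] by (simp_all add: a_def c'_def)
    show "val_le b 0" unfolding b_def using P Q by (cases P; cases Q) (auto intro!: val_le_0_intros)
  qed
  show ?thesis
  proof (cases "a = 0 \<and> b = 0 \<and> c' = 0")
    case True
    then have det0: "mdet (lincomb l m P Q) = 0" for l m by (simp add: det qform_def)
    show ?thesis
    proof (rule that(1)[OF ind])
      fix l m :: complex assume lm: "(l, m) \<noteq> (0, 0)"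
      let ?A = "lincomb (kconst l) (kconst m) P Q"
      have v: "mval_le ?A 0" "mcoef ?A 0 = lincomb l m ?P ?Q" using val_lincomb[OF k(1) k(1) P Q] by (simp_all add: k)
      have "fval c d (mcoef ?A 0) = 0"
        by (rule VAL_surface_det_0[OF VAL det0 v(1) nz]) (use k lm in auto)
      moreover have "mdet (mcoef ?A 0) = 0" using val_mdet(2)[OF v(1)] det0 by simp
      ultimately show "mdet (lincomb l m ?P ?Q) = 0 \<and> fval c d (lincomb l m ?P ?Q) = 0" using v by simp
    qed
  next
    case False
    then obtain q x where q: "x \<in> {a, b, c'}" "Rep_puiseux x q \<noteq> 0" "\<And>x. x \<in> {a, b, c'} \<Longrightarrow> val_le x q"
      using finite_lead_exists[of "{a, b, c'}"] by blast
    then have q0: "q \<le> 0" using abc val_leD by (metis emptyE insert_iff linorder_not_le)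
    define \<gamma> where "\<gamma> = - q / 2"
    have \<gamma>: "\<gamma> \<ge> 0" "q = - 2 * \<gamma>" using q0 by (simp_all add: \<gamma>_def)
    define a' b' c'' where "a' = tpow (2 * \<gamma>) * a" and "b' = tpow (2 * \<gamma>) * b" and "c'' = tpow (2 * \<gamma>) * c'"
    have abc': "val_le a' 0" "val_le b' 0" "val_le c'' 0"
      using q(3) by (auto simp: a'_def b'_def c''_def val_le_tpow_mult \<gamma>(2))
    let ?e = "Rep_puiseux a' 0" and ?f = "Rep_puiseux b' 0" and ?g = "Rep_puiseux c'' 0"
    have nz0: "?e \<noteq> 0 \<or> ?f \<noteq> 0 \<or> ?g \<noteq> 0" using q(1,2) by (auto simp: a'_def b'_def c''_def \<gamma>(2))
    have det': "mdet (lincomb l m P Q) = tpow (- 2 * \<gamma>) * qform a' b' c'' l m" for l m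
    proof -
      have "qform a' b' c'' l m = tpow (2 * \<gamma>) * qform a b c' l m"
        by (simp add: qform_def a'_def b'_def c''_def algebra_simps)
      then show ?thesis by (simp add: det mult.assoc[symmetric] flip: tpow_add) (simp add: tpow_0)
    qed
    have red: "mval_le (lincomb l m P Q) 0 \<and> mcoef (lincomb l m P Q) 0 = lincomb (Rep_puiseux l 0) (Rep_puiseux m 0) ?P ?Q"
      if "val_le l 0" "val_le m 0" for l m
      using val_lincomb[OF that P Q] by simp
    \<comment> \<open>The coefficient of t^0 in the determinant is that of t^(2 \<gamma>) in the
      normalized form, which vanishes for \<gamma> > 0: this puts the reduced line on the
      quadric.\<close>
    have detred: "mdet (lincomb l m ?P ?Q) = (if \<gamma> = 0 then qform ?e ?f ?g l m else 0)" for l m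
    proof -
      let ?A = "lincomb (kconst l) (kconst m) P Q"
      have v: "mval_le ?A 0" "mcoef ?A 0 = lincomb l m ?P ?Q" using red[OF k(1) k(1)] by (simp_all add: k)
      have "mdet (lincomb l m ?P ?Q) = Rep_puiseux (mdet ?A) 0" using val_mdet(2)[OF v(1)] v(2) by simp
      also have "\<dots> = Rep_puiseux (qform a' b' c'' (kconst l) (kconst m)) (2 * \<gamma>)" by (simp add: det')
      also have "\<dots> = (if \<gamma> = 0 then qform ?e ?f ?g l m else 0)"
        using val_leD[OF val_qform(1)[OF abc' k(1) k(1)], of "2 * \<gamma>"] val_qform(2)[OF abc' k(1) k(1)] \<gamma>(1) by (auto simp: k)
      finally show ?thesis .
    qed
    show ?thesis
    proof (rule that(2)[where P = ?P and Q = ?Q and e = ?e and f = ?f and g = ?g and \<gamma> = \<gamma>, OF ind])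
      show "(?e, ?f, ?g) \<noteq> (0, 0, 0)" using nz0 by simp
      show "0 \<le> \<gamma>" by fact
      show "\<gamma> = 0 \<Longrightarrow> mdet (lincomb l m ?P ?Q) = qform ?e ?f ?g l m" for l m by (simp add: detred)
      show "\<gamma> > 0 \<Longrightarrow> mdet (lincomb l m ?P ?Q) = 0" for l m by (simp add: detred)
    next
      fix l m assume g: "\<gamma> > 0" and E: "qform ?e ?f ?g l m \<noteq> 0"
      then have lm: "(l, m) \<noteq> (0, 0)" by (auto simp: qform_def)
      let ?A = "lincomb (kconst l) (kconst m) P Q"
      have v: "mval_le ?A 0" "mcoef ?A 0 = lincomb l m ?P ?Q" using red[OF k(1) k(1)] by (simp_all add: k)
      note u = val_qform[OF abc' k(1) k(1), of l m]
      have "tropical_cond d c \<gamma> (Rep_puiseux (qform a' b' c'' (kconst l) (kconst m)) 0) (mcoef ?A 0)"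
        by (rule VAL_surface_det_nonzero[OF VAL v(1) nz det' u(1) _ g]) (use k lm E u(2) in auto)
      then show "tropical_cond d c \<gamma> (qform ?e ?f ?g l m) (lincomb l m ?P ?Q)" by (simp add: v u(2) k)
    next
      fix l m \<alpha> assume E: "qform ?e ?f ?g l m = 0" and lm: "(l, m) \<noteq> (0, 0)" and \<alpha>: "\<alpha> > \<gamma>"
      \<comment> \<open>The value t^(-2 (\<alpha> - \<gamma>)) of the normalized form is the one
        that makes the determinant t^(-2 \<alpha>).\<close>
      have "2 * (\<alpha> - \<gamma>) > 0" using \<alpha> by simp
      then obtain l' m' where lm': "val_le l' 0" "val_le m' 0" "Rep_puiseux l' 0 = l" "Rep_puiseux m' 0 = m"
        and val: "qform a' b' c'' l' m' = tpow (- (2 * (\<alpha> - \<gamma>)))"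
        using qform_small_value[OF abc' _ nz0 E lm] by metis
      let ?A = "lincomb l' m' P Q"
      have v: "mval_le ?A 0" "mcoef ?A 0 = lincomb l m ?P ?Q" using red[OF lm'(1,2)] by (simp_all add: lm')
      have dA: "mdet ?A = tpow (- 2 * \<alpha>) * 1"
        unfolding det' val by (simp add: algebra_simps flip: tpow_add)
      have one: "val_le 1 0" "Rep_puiseux 1 0 = 1" using val_le_tpow[of 0 0] by (simp_all add: tpow_0 Rep_puiseux_1)
      have "tropical_cond d c \<alpha> (Rep_puiseux 1 0) (mcoef ?A 0)"
        by (rule VAL_surface_det_nonzero[OF VAL v(1) nz dA one(1)]) (use lm' lm \<alpha> \<gamma> one in auto)
      then show "tropical_cond d c \<alpha> 1 (lincomb l m ?P ?Q)" by (simp add: v one)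
    qed
  qed
qed

section \<open>Generic properties\<close>

lemma polyfun_sum: "(\<And>i. i \<in> I \<Longrightarrow> f i \<in> polyfun) \<Longrightarrow> (\<lambda>x. \<Sum>i\<in>I. f i x) \<in> polyfun"
proof (induction I rule: infinite_finite_induct)
  case (insert i I)
  then show ?case using pf_add[of "f i" "\<lambda>x. \<Sum>i\<in>I. f i x"] by simp
qed (simp_all add: pf_const)

lemma polyfun_power: "p \<in> polyfun \<Longrightarrow> (\<lambda>x. p x ^ n) \<in> polyfun"
proof (induction n)
  case (Suc n)
  then show ?case using pf_mult[of p "\<lambda>x. p x ^ n"] by simp
qed (simp add: pf_const)

lemma polyfun_prod: "(\<And>i. i \<in> I \<Longrightarrow> f i \<in> polyfun) \<Longrightarrow> (\<lambda>x. \<Prod>i\<in>I. f i x) \<in> polyfun"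
proof (induction I rule: infinite_finite_induct)
  case (insert i I)
  then show ?case using pf_mult[of "f i" "\<lambda>x. \<Prod>i\<in>I. f i x"] by simp
qed (simp_all add: pf_const)

lemma polyfun_uminus: "p \<in> polyfun \<Longrightarrow> (\<lambda>x. - p x) \<in> polyfun"
  using pf_mult[OF pf_const[of "-1"]] by simp

lemma polyfun_diff: "p \<in> polyfun \<Longrightarrow> q \<in> polyfun \<Longrightarrow> (\<lambda>x. p x - q x) \<in> polyfun"
  using pf_add[OF _ polyfun_uminus, of p q] by simp

lemmas polyfun_intros = pf_const pf_var pf_add pf_mult polyfun_sum polyfun_power polyfun_prod
  polyfun_uminus polyfun_diff

lemma polyfun_compose:
  assumes "p \<in> polyfun" "\<And>v. \<phi> v \<in> polyfun"
  shows "(\<lambda>x. p (\<lambda>v. \<phi> v x)) \<in> polyfun"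
  using assms(1)
proof induction
  case (pf_add p q)
  show ?case by (rule polyfun.pf_add[OF pf_add.IH])
next
  case (pf_mult p q)
  show ?case by (rule polyfun.pf_mult[OF pf_mult.IH])
qed (simp_all add: polyfun.pf_const assms(2))

lemma polyfun_on_line:
  assumes "p \<in> polyfun"
  shows "\<exists>P. \<forall>s. p (\<lambda>v. a v + s * b v) = poly P s"
  using assms
proof induction
  case (pf_const z)
  show ?case by (intro exI[of _ "[:z:]"]) simp
next
  case (pf_var v)
  show ?case by (intro exI[of _ "[:a v, b v:]"]) simp
next
  case (pf_add p q)
  then obtain P Q where "\<forall>s. p (\<lambda>v. a v + s * b v) = poly P s" "\<forall>s. q (\<lambda>v. a v + s * b v) = poly Q s" by blast
  then show ?case by (intro exI[of _ "P + Q"]) simp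
next
  case (pf_mult p q)
  then obtain P Q where "\<forall>s. p (\<lambda>v. a v + s * b v) = poly P s" "\<forall>s. q (\<lambda>v. a v + s * b v) = poly Q s" by blast
  then show ?case by (intro exI[of _ "P * Q"]) simp
qed

text \<open>Genericity is witnessed by a single polynomial; its zero set in \<open>V\<close> later
  serves as the closed set of the theorem.\<close>

definition generically :: "('v \<Rightarrow> complex) set \<Rightarrow> (('v \<Rightarrow> complex) \<Rightarrow> bool) \<Rightarrow> bool" where
  "generically V G \<longleftrightarrow> (\<exists>p\<in>polyfun. (\<exists>x\<in>V. p x \<noteq> 0) \<and> (\<forall>x\<in>V. p x \<noteq> 0 \<longrightarrow> G x))"

definition supported_on :: "'v set \<Rightarrow> ('v \<Rightarrow> complex) set" where
  "supported_on V = {x. \<forall>v. v \<notin> V \<longrightarrow> x v = 0}"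

lemma generically_mono: "generically V G \<Longrightarrow> (\<And>x. x \<in> V \<Longrightarrow> G x \<Longrightarrow> H x) \<Longrightarrow> generically V H"
  unfolding generically_def by blast

lemma generically_True: "generically (supported_on V) (\<lambda>_. True)"
  unfolding generically_def supported_on_def by (intro bexI[of _ "\<lambda>_. 1"] conjI bexI[of _ "\<lambda>_. 0"]) (auto intro: pf_const)

text \<open>Irreducibility of a coordinate space. On the line joining a point where one polynomial
  is nonzero to a point where the other is, both restrict to nonzero polynomials in one variable,
  and some parameter avoids the roots of both.\<close>

lemma generically_conj:
  assumes "generically (supported_on V) G" "generically (supported_on V) H"
  shows "generically (supported_on V) (\<lambda>x. G x \<and> H x)"
proof -
  obtain p x where p: "p \<in> polyfun" "x \<in> supported_on V" "p x \<noteq> 0" "\<And>x. x \<in> supported_on V \<Longrightarrow> p x \<noteq> 0 \<Longrightarrow> G x"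
    using assms(1) unfolding generically_def by blast
  obtain q y where q: "q \<in> polyfun" "y \<in> supported_on V" "q y \<noteq> 0" "\<And>x. x \<in> supported_on V \<Longrightarrow> q x \<noteq> 0 \<Longrightarrow> H x"
    using assms(2) unfolding generically_def by blast
  define z where "z s v = x v + s * (y v - x v)" for s v
  obtain P where P: "\<And>s. p (z s) = poly P s"
    using polyfun_on_line[OF p(1), of x "\<lambda>v. y v - x v"] unfolding z_def by blast
  obtain Q where Q: "\<And>s. q (z s) = poly Q s"
    using polyfun_on_line[OF q(1), of x "\<lambda>v. y v - x v"] unfolding z_def by blast
  have "z 0 = x" "z 1 = y" by (auto simp: z_def)
  then have "P \<noteq> 0" "Q \<noteq> 0" using P[of 0] Q[of 1] p q by auto
  then have "finite {s. poly (P * Q) s = 0}" by (intro poly_roots_finite) simp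
  then obtain s where "poly (P * Q) s \<noteq> 0" using infinite_UNIV_char_0 by (metis (mono_tags) UNIV_eq_I mem_Collect_eq)
  then have "p (z s) * q (z s) \<noteq> 0" by (simp add: P Q)
  moreover have "z s \<in> supported_on V" using p(2) q(2) by (simp add: z_def supported_on_def)
  moreover have "(\<lambda>x. p x * q x) \<in> polyfun" using p q by (intro pf_mult)
  ultimately show ?thesis unfolding generically_def using p(4) q(4) by (intro bexI[of _ "\<lambda>x. p x * q x"]) auto
qed

lemma generically_ball:
  assumes "finite I" "\<And>i. i \<in> I \<Longrightarrow> generically (supported_on V) (G i)"
  shows "generically (supported_on V) (\<lambda>x. \<forall>i\<in>I. G i x)"
  using assms
proof (induction I rule: finite_induct)
  case (insert i I)
  then show ?case using generically_conj[of V "G i" "\<lambda>x. \<forall>i\<in>I. G i x"] by simp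
qed (simp add: generically_True)

section \<open>Polynomial images of small dimension\<close>

lemma homogeneous_system_nontrivial:
  fixes A :: "'i \<Rightarrow> 'j \<Rightarrow> 'a::field"
  assumes "finite J" "finite I" "card J < card I"
  shows "\<exists>x. (\<exists>i\<in>I. x i \<noteq> 0) \<and> (\<forall>j\<in>J. (\<Sum>i\<in>I. x i * A i j) = 0)"
  using assms
proof (induction J arbitrary: I A rule: finite_induct)
  case empty
  then have "I \<noteq> {}" by auto
  then show ?case by (intro exI[of _ "\<lambda>_. 1"]) auto
next
  case (insert j J)
  show ?case
  proof (cases "\<forall>i\<in>I. A i j = 0")
    case True
    have "card J < card I" using insert by simp
    then obtain x where "\<exists>i\<in>I. x i \<noteq> 0" "\<forall>j\<in>J. (\<Sum>i\<in>I. x i * A i j) = 0" using insert.IH[OF insert.prems(1), of A] by blast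
    then show ?thesis using True by (intro exI[of _ x]) auto
  next
    case False
    then obtain i0 where i0: "i0 \<in> I" "A i0 j \<noteq> 0" by blast
    \<comment> \<open>Gaussian elimination: the equation j is used to remove the unknown i0 from the
      others.\<close>
    define B where "B i k = A i k - A i j / A i0 j * A i0 k" for i k
    have "card J < card (I - {i0})" using insert i0 by simp
    then obtain x where x: "\<exists>i\<in>I - {i0}. x i \<noteq> 0" "\<forall>k\<in>J. (\<Sum>i\<in>I - {i0}. x i * B i k) = 0"
      using insert.IH[of "I - {i0}" B] insert.prems(1) by blast
    define t where "t = - (\<Sum>i\<in>I - {i0}. x i * A i j) / A i0 j"
    have *: "(\<Sum>i\<in>I. (x(i0 := t)) i * A i k) = t * A i0 k + (\<Sum>i\<in>I - {i0}. x i * A i k)" for k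
    proof -
      have "(\<Sum>i\<in>I - {i0}. (x(i0 := t)) i * A i k) = (\<Sum>i\<in>I - {i0}. x i * A i k)" by (rule sum.cong) auto
      then show ?thesis using sum.remove[OF insert.prems(1) i0(1), of "\<lambda>i. (x(i0 := t)) i * A i k"] by simp
    qed
    have "(\<Sum>i\<in>I. (x(i0 := t)) i * A i k) = 0" if "k \<in> insert j J" for k
    proof (cases "k = j")
      case True
      have "t * A i0 j = - (\<Sum>i\<in>I - {i0}. x i * A i j)" using i0 by (simp add: t_def)
      then show ?thesis using *[of j] True by simp
    next
      case False
      then have "k \<in> J" using that by simp
      then have "(\<Sum>i\<in>I - {i0}. x i * B i k) = 0" using x by blast
      then have "(\<Sum>i\<in>I - {i0}. x i * A i k) = (\<Sum>i\<in>I - {i0}. x i * A i j) / A i0 j * A i0 k"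
        by (simp add: B_def right_diff_distrib sum_subtractf sum_distrib_right sum_divide_distrib mult.assoc)
      then show ?thesis using *[of k] by (simp add: t_def)
    qed
    moreover have "\<exists>i\<in>I. (x(i0 := t)) i \<noteq> 0" using x(1) by auto
    ultimately show ?thesis by blast
  qed
qed

section \<open>Spaces of polynomials of bounded degree in each variable\<close>

definition expvecs :: "'v set \<Rightarrow> nat \<Rightarrow> ('v \<Rightarrow> nat) set" where
  "expvecs M D = {e. (\<forall>i\<in>M. e i \<le> D) \<and> (\<forall>i. i \<notin> M \<longrightarrow> e i = 0)}"

definition monofun :: "'v set \<Rightarrow> ('v \<Rightarrow> nat) \<Rightarrow> ('v \<Rightarrow> complex) \<Rightarrow> complex" where
  "monofun M e x = (\<Prod>i\<in>M. x i ^ e i)"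

lemma expvecs_insert:
  assumes "n \<notin> N"
  shows "bij_betw (\<lambda>(k, e). e(n := k)) ({..D} \<times> expvecs N D) (expvecs (insert n N) D)"
  by (rule bij_betw_byWitness[where f' = "\<lambda>e. (e n, e(n := 0))"])
     (use assms in \<open>auto simp: expvecs_def fun_eq_iff\<close>)

lemma expvecs_empty: "expvecs {} D = {\<lambda>_. 0}"
  by (auto simp: expvecs_def)

text \<open>Bounding each degree separately makes the exponent vectors a box; the count is a plain
  power, easily compared for different numbers of variables.\<close>

lemma card_expvecs: "finite N \<Longrightarrow> finite (expvecs N D) \<and> card (expvecs N D) = Suc D ^ card N"
proof (induction N rule: finite_induct)
  case (insert n N)
  note b = expvecs_insert[OF insert(2), of D]
  have "finite (expvecs (insert n N) D)" using bij_betw_finite[OF b] insert by simp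
  moreover have "card (expvecs (insert n N) D) = Suc D ^ card (insert n N)"
    using bij_betw_same_card[OF b] insert by simp
  ultimately show ?case by simp
qed (simp add: expvecs_empty)

lemma monofun_polyfun: "monofun M e \<in> polyfun"
  unfolding monofun_def by (intro polyfun_intros)

lemma monofun_independent:
  assumes "finite N" "\<And>x. (\<Sum>e\<in>expvecs N D. a e * monofun N e x) = 0" "e \<in> expvecs N D"
  shows "a e = 0"
  using assms
proof (induction N arbitrary: a e rule: finite_induct)
  case empty
  then show ?case by (simp add: expvecs_empty monofun_def)
next
  case (insert n N)
  note b = expvecs_insert[OF insert(2), of D]
  have mono: "monofun (insert n N) (e(n := k)) (x(n := t)) = t ^ k * monofun N e x" for e k t x
  proof -
    have "(\<Prod>i\<in>N. (x(n := t)) i ^ (e(n := k)) i) = (\<Prod>i\<in>N. x i ^ e i)"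
      by (rule prod.cong) (use insert(2) in auto)
    then show ?thesis using insert(1,2) by (simp add: monofun_def)
  qed
  \<comment> \<open>The coefficient of the k-th power of the new variable, as a function of the old
    ones. It vanishes because a polynomial in one variable without nonzero values is zero.\<close>
  define c where "c x k = (\<Sum>e\<in>expvecs N D. a (e(n := k)) * monofun N e x)" for x k
  have "c x k = 0" if k: "k \<le> D" for x k
  proof -
    have "poly (\<Sum>k\<le>D. monom (c x k) k) t = 0" for t
    proof -
      have "0 = (\<Sum>e\<in>expvecs (insert n N) D. a e * monofun (insert n N) e (x(n := t)))" using insert.prems by simp
      also have "\<dots> = (\<Sum>(k, e)\<in>{..D} \<times> expvecs N D. a (e(n := k)) * (t ^ k * monofun N e x))"
        by (subst sum.reindex_bij_betw[OF b, symmetric]) (simp add: case_prod_beta mono)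
      also have "\<dots> = (\<Sum>k\<le>D. c x k * t ^ k)"
        unfolding sum.cartesian_product[symmetric] c_def sum_distrib_right by (intro sum.cong refl) (simp only: mult_ac)
      finally show ?thesis by (simp add: poly_sum poly_monom)
    qed
    then have "(\<Sum>k\<le>D. monom (c x k) k) = 0" by (metis poly_all_0_iff_0)
    then have "coeff (\<Sum>k\<le>D. monom (c x k) k) k = 0" by simp
    then show ?thesis using k by (simp add: coeff_sum if_distrib sum.delta cong: if_cong)
  qed
  then have IH: "a (e(n := k)) = 0" if "k \<le> D" "e \<in> expvecs N D" for k e
    using insert.IH[of "\<lambda>e. a (e(n := k))"] that unfolding c_def by blast
  obtain k e' where ke: "k \<le> D" "e' \<in> expvecs N D" "e = e'(n := k)"
    using b insert.prems(2) unfolding bij_betw_def by force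
  show ?case unfolding ke(3) by (rule IH[OF ke(1,2)])
qed

definition deg_span :: "'v set \<Rightarrow> nat \<Rightarrow> (('v \<Rightarrow> complex) \<Rightarrow> complex) set" where
  "deg_span M D = {f. \<exists>a. \<forall>x. f x = (\<Sum>e\<in>expvecs M D. a e * monofun M e x)}"

lemma deg_span_scale: "f \<in> deg_span M D \<Longrightarrow> (\<lambda>x. z * f x) \<in> deg_span M D"
proof -
  assume "f \<in> deg_span M D"
  then obtain a where "\<forall>x. f x = (\<Sum>e\<in>expvecs M D. a e * monofun M e x)" unfolding deg_span_def by blast
  then show ?thesis unfolding deg_span_def by (intro CollectI exI[of _ "\<lambda>e. z * a e"]) (simp add: sum_distrib_left mult.assoc)
qed

lemma deg_span_add: "f \<in> deg_span M D \<Longrightarrow> g \<in> deg_span M D \<Longrightarrow> (\<lambda>x. f x + g x) \<in> deg_span M D"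
proof -
  assume "f \<in> deg_span M D" "g \<in> deg_span M D"
  then obtain a b where "\<forall>x. f x = (\<Sum>e\<in>expvecs M D. a e * monofun M e x)" "\<forall>x. g x = (\<Sum>e\<in>expvecs M D. b e * monofun M e x)"
    unfolding deg_span_def by blast
  then show ?thesis unfolding deg_span_def
    by (intro CollectI exI[of _ "\<lambda>e. a e + b e"]) (simp add: sum.distrib distrib_right)
qed

lemma deg_span_0: "(\<lambda>x. 0) \<in> deg_span M D"
  unfolding deg_span_def by (intro CollectI exI[of _ "\<lambda>e. 0"]) simp

lemma deg_span_sum: "(\<And>i. i \<in> I \<Longrightarrow> f i \<in> deg_span M D) \<Longrightarrow> (\<lambda>x. \<Sum>i\<in>I. f i x) \<in> deg_span M D"
  by (induction I rule: infinite_finite_induct) (auto intro: deg_span_add deg_span_0)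

lemma monofun_in_deg_span:
  assumes "finite M" "e \<in> expvecs M D"
  shows "monofun M e \<in> deg_span M D"
  unfolding deg_span_def
proof (intro CollectI exI[of _ "\<lambda>e'. if e' = e then 1 else 0"] allI)
  fix x
  have "(\<Sum>e'\<in>expvecs M D. (if e' = e then 1 else 0) * monofun M e' x) = (\<Sum>e'\<in>expvecs M D. if e' = e then monofun M e' x else 0)"
    by (rule sum.cong) auto
  then show "monofun M e x = (\<Sum>e'\<in>expvecs M D. (if e' = e then 1 else 0) * monofun M e' x)"
    using assms card_expvecs[OF assms(1), of D] by simp
qed

lemma deg_span_mono:
  assumes "finite M" "f \<in> deg_span M D" "D \<le> D'"
  shows "f \<in> deg_span M D'"
proof -
  obtain a where f: "\<forall>x. f x = (\<Sum>e\<in>expvecs M D. a e * monofun M e x)" using assms unfolding deg_span_def by blast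
  have "(\<lambda>x. \<Sum>e\<in>expvecs M D. a e * monofun M e x) \<in> deg_span M D'"
    by (intro deg_span_sum deg_span_scale monofun_in_deg_span assms) (use assms(3) in \<open>force simp: expvecs_def\<close>)
  then show ?thesis using f by (simp add: deg_span_def)
qed

lemma deg_span_mult:
  assumes "finite M" "f \<in> deg_span M D" "g \<in> deg_span M D'"
  shows "(\<lambda>x. f x * g x) \<in> deg_span M (D + D')"
proof -
  obtain a where f: "\<And>x. f x = (\<Sum>e\<in>expvecs M D. a e * monofun M e x)" using assms unfolding deg_span_def by blast
  obtain b where g: "\<And>x. g x = (\<Sum>e\<in>expvecs M D'. b e * monofun M e x)" using assms unfolding deg_span_def by blast
  have m: "monofun M e x * monofun M e' x = monofun M (\<lambda>i. e i + e' i) x" for e e' x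
    by (simp add: monofun_def power_add prod.distrib)
  have "f x * g x = (\<Sum>e\<in>expvecs M D. \<Sum>e'\<in>expvecs M D'. a e * b e' * monofun M (\<lambda>i. e i + e' i) x)" for x
    unfolding f g sum_product m[symmetric] by (intro sum.cong refl) (simp add: mult_ac)
  moreover have "(\<lambda>x. \<Sum>e\<in>expvecs M D. \<Sum>e'\<in>expvecs M D'. a e * b e' * monofun M (\<lambda>i. e i + e' i) x) \<in> deg_span M (D + D')"
    by (intro deg_span_sum deg_span_scale monofun_in_deg_span assms) (auto simp: expvecs_def intro: add_mono)
  ultimately show ?thesis by simp
qed

lemma deg_span_1: "finite M \<Longrightarrow> (\<lambda>x. 1) \<in> deg_span M D"
  using monofun_in_deg_span[of M "\<lambda>_. 0" D] by (simp add: expvecs_def monofun_def[abs_def])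

lemma deg_span_power: "finite M \<Longrightarrow> f \<in> deg_span M D \<Longrightarrow> (\<lambda>x. f x ^ n) \<in> deg_span M (n * D)"
proof (induction n)
  case (Suc n)
  then show ?case using deg_span_mult[of M f D "\<lambda>x. f x ^ n" "n * D"] by simp
qed (simp add: deg_span_1)

lemma deg_span_prod:
  assumes "finite M" "finite N" "\<And>n. n \<in> N \<Longrightarrow> f n \<in> deg_span M D"
  shows "(\<lambda>x. \<Prod>n\<in>N. f n x) \<in> deg_span M (card N * D)"
  using assms(2,3)
proof (induction N rule: finite_induct)
  case (insert n N)
  then show ?case using deg_span_mult[OF assms(1), of "f n" D "\<lambda>x. \<Prod>n\<in>N. f n x" "card N * D"] by simp
qed (simp add: deg_span_1 assms(1))

text \<open>A \<open>polyfun\<close> may involve coordinates outside \<open>M\<close>; setting these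
  to 0 leaves a polynomial in the coordinates of \<open>M\<close>.\<close>

definition cut_to :: "'v set \<Rightarrow> ('v \<Rightarrow> complex) \<Rightarrow> 'v \<Rightarrow> complex" where
  "cut_to M x = (\<lambda>i. if i \<in> M then x i else 0)"

lemma polyfun_in_deg_span:
  assumes "finite M" "p \<in> polyfun"
  shows "\<exists>D. (\<lambda>x. p (cut_to M x)) \<in> deg_span M D"
  using assms(2)
proof induction
  case (pf_const z)
  show ?case using deg_span_scale[OF deg_span_1[OF assms(1)], of z] by auto
next
  case (pf_var v)
  show ?case
  proof (cases "v \<in> M")
    case True
    let ?e = "\<lambda>i. if i = v then 1 else 0 :: nat"
    have "monofun M ?e x = x v" for x
    proof -
      have "monofun M ?e x = (\<Prod>i\<in>M. if i = v then x i else 1)" unfolding monofun_def by (rule prod.cong) auto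
      then show ?thesis using True assms(1) by simp
    qed
    then have "(\<lambda>x. cut_to M x v) = monofun M ?e" using True by (auto simp: cut_to_def)
    moreover have "?e \<in> expvecs M 1" using True by (auto simp: expvecs_def)
    ultimately show ?thesis using monofun_in_deg_span[OF assms(1), of ?e 1] by (intro exI[of _ 1]) (simp only:)
  next
    case False
    then show ?thesis by (simp add: cut_to_def deg_span_0)
  qed
next
  case (pf_add p q)
  then obtain D D' where "(\<lambda>x. p (cut_to M x)) \<in> deg_span M D" "(\<lambda>x. q (cut_to M x)) \<in> deg_span M D'" by blast
  then show ?case using deg_span_mono[OF assms(1)] by (intro exI[of _ "max D D'"] deg_span_add) (meson max.cobounded1 max.cobounded2)+
next
  case (pf_mult p q)
  then show ?case using deg_span_mult[OF assms(1)] by blast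
qed

text \<open>Counting monomials: there are \<open>(E + 1) ^ |N|\<close> monomials of degree at most \<open>E\<close> in each
  of the \<open>N\<close> coordinates, and their pullbacks lie in a space of dimension \<open>O(E ^ |M|)\<close>.\<close>

lemma polynomial_image_in_hypersurface:
  assumes M: "finite M" and N: "finite N" and card: "card M < card N" and \<phi>: "\<And>n. n \<in> N \<Longrightarrow> \<phi> n \<in> polyfun"
  obtains p y where "p \<in> polyfun" "y \<in> supported_on N" "p y \<noteq> 0"
    "\<forall>x t. (\<forall>n\<in>N. x n = \<phi> n (cut_to M t)) \<longrightarrow> p x = 0"
proof -
  have "\<exists>D. \<forall>n\<in>N. (\<lambda>x. \<phi> n (cut_to M x)) \<in> deg_span M D"
    using N \<phi>
  proof (induction N rule: finite_induct)
    case (insert n N)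
    then obtain D where D: "\<forall>n\<in>N. (\<lambda>x. \<phi> n (cut_to M x)) \<in> deg_span M D" by auto
    obtain D' where D': "(\<lambda>x. \<phi> n (cut_to M x)) \<in> deg_span M D'" using polyfun_in_deg_span[OF M] insert by blast
    have "\<forall>k\<in>insert n N. (\<lambda>x. \<phi> k (cut_to M x)) \<in> deg_span M (max D D')"
      using D D' deg_span_mono[OF M] by (metis insert_iff max.cobounded1 max.cobounded2)
    then show ?case by blast
  qed simp
  then obtain \<delta> where \<delta>: "\<And>n. n \<in> N \<Longrightarrow> (\<lambda>x. \<phi> n (cut_to M x)) \<in> deg_span M \<delta>" by blast
  define K where "K = card N * \<delta>"
  \<comment> \<open>The constant is absorbed: with m = |M|, the pullbacks lie in the span of (K E +
    1)^m \<le> (K + 1)^m (E + 1)^m = E (E + 1)^m monomials, fewer than (E + 1)^(m + 1) \<le> (E +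
    1)^|N|.\<close>
  define E where "E = Suc K ^ card M"
  have pull: "(\<lambda>x. \<Prod>n\<in>N. \<phi> n (cut_to M x) ^ e n) \<in> deg_span M (card N * (E * \<delta>))" if "e \<in> expvecs N E" for e
  proof (rule deg_span_prod[OF M N])
    fix n assume n: "n \<in> N"
    have "(\<lambda>x. \<phi> n (cut_to M x) ^ e n) \<in> deg_span M (e n * \<delta>)" using \<delta>[OF n] by (rule deg_span_power[OF M])
    moreover have "e n * \<delta> \<le> E * \<delta>" using that n by (simp add: expvecs_def)
    ultimately show "(\<lambda>x. \<phi> n (cut_to M x) ^ e n) \<in> deg_span M (E * \<delta>)" by (rule deg_span_mono[OF M])
  qed
  define J where "J = expvecs M (card N * (E * \<delta>))"
  define I where "I = expvecs N E"
  have "\<forall>e\<in>I. \<exists>a. \<forall>x. (\<Prod>n\<in>N. \<phi> n (cut_to M x) ^ e n) = (\<Sum>j\<in>J. a j * monofun M j x)"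
    using pull unfolding deg_span_def I_def J_def by auto
  then obtain A where A: "\<And>e x. e \<in> I \<Longrightarrow> (\<Prod>n\<in>N. \<phi> n (cut_to M x) ^ e n) = (\<Sum>j\<in>J. A e j * monofun M j x)"
    by metis
  have fin: "finite I" "finite J" using card_expvecs M N by (auto simp: I_def J_def)
  have "card J = Suc (K * E) ^ card M" using card_expvecs[OF M] by (simp add: J_def K_def mult_ac)
  also have "\<dots> \<le> (Suc K * Suc E) ^ card M" by (intro power_mono) auto
  also have "\<dots> = E * Suc E ^ card M" by (simp only: power_mult_distrib E_def)
  also have "\<dots> < Suc E * Suc E ^ card M" by (intro mult_strict_right_mono) auto
  also have "\<dots> = Suc E ^ Suc (card M)" by simp
  also have "\<dots> \<le> Suc E ^ card N" using card by (intro power_increasing) auto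
  also have "\<dots> = card I" using card_expvecs[OF N] by (simp add: I_def)
  \<comment> \<open>A linear dependency among the pulled back monomials is a polynomial relation
    between the coordinates of the image.\<close>
  finally obtain u where u: "\<exists>e\<in>I. u e \<noteq> 0" "\<forall>j\<in>J. (\<Sum>e\<in>I. u e * A e j) = 0"
    using homogeneous_system_nontrivial[OF fin(2,1)] by blast
  define p where "p x = (\<Sum>e\<in>I. u e * monofun N e x)" for x
  have "p \<in> polyfun" unfolding p_def[abs_def] by (intro polyfun_sum pf_mult pf_const monofun_polyfun)
  moreover have "\<exists>y. p y \<noteq> 0" using monofun_independent[OF N, where D = E and a = u] u(1) unfolding p_def I_def by blast
  then obtain y where "p y \<noteq> 0" by blast
  then have "p (cut_to N y) \<noteq> 0" by (simp add: p_def monofun_def cut_to_def cong: prod.cong)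
  moreover have "cut_to N y \<in> supported_on N" by (simp add: supported_on_def cut_to_def)
  moreover have "p x = 0" if "\<forall>n\<in>N. x n = \<phi> n (cut_to M t)" for x t
  proof -
    have "p x = (\<Sum>e\<in>I. u e * (\<Sum>j\<in>J. A e j * monofun M j t))"
      unfolding p_def monofun_def[of N] by (intro sum.cong refl) (simp add: that A cong: prod.cong)
    also have "\<dots> = (\<Sum>j\<in>J. (\<Sum>e\<in>I. u e * A e j) * monofun M j t)"
      by (simp add: sum_distrib_left sum_distrib_right sum.swap[of _ I J] mult_ac)
    finally show ?thesis using u(2) by simp
  qed
  ultimately show ?thesis using that by blast
qed

text \<open>A bad \<open>x\<close> is determined by the \<open>r\<close> parameters and its
  coordinates outside \<open>W\<close>, so bad points lie in the image of a space of dimension r +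
  |V| - |W| < |V|. The sum type keeps the two kinds of source coordinates apart.\<close>

lemma generically_no_solution:
  fixes g :: "'v \<Rightarrow> 'v \<Rightarrow> (nat \<Rightarrow> complex) \<Rightarrow> complex"
  assumes V: "finite V" and W: "W \<subseteq> V" and r: "r < card W" and g: "\<And>w v. g w v \<in> polyfun"
  shows "generically (supported_on V) (\<lambda>x. \<not> (\<exists>t. (\<forall>i\<ge>r. t i = 0) \<and> (\<forall>w\<in>W. x w = (\<Sum>v\<in>V - W. g w v t * x v))))"
proof -
  define M :: "(nat + 'v) set" where "M = Inl ` {..<r} \<union> Inr ` (V - W)"
  define \<phi> where "\<phi> v \<sigma> = (if v \<in> W then (\<Sum>u\<in>V - W. g v u (\<lambda>i. \<sigma> (Inl i)) * \<sigma> (Inr u)) else \<sigma> (Inr v))" for v \<sigma>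
  have M: "finite M" using V by (simp add: M_def)
  have "card M = r + card (V - W)"
    unfolding M_def by (subst card_Un_disjoint) (use V in \<open>auto simp: card_image\<close>)
  moreover have "card (V - W) = card V - card W" "card W \<le> card V"
    using V W by (simp_all add: card_Diff_subset card_mono finite_subset)
  ultimately have card: "card M < card V" using r by simp
  have "(\<lambda>\<sigma>. g v u (\<lambda>i. \<sigma> (Inl i))) \<in> polyfun" for v u
    using polyfun_compose[OF g[of v u], of "\<lambda>i \<sigma>. \<sigma> (Inl i)"] by (simp add: pf_var)
  then have \<phi>: "\<phi> v \<in> polyfun" for v
    unfolding \<phi>_def[abs_def] by (cases "v \<in> W") (auto intro!: polyfun_intros)
  obtain p y where p: "p \<in> polyfun" "y \<in> supported_on V" "p y \<noteq> 0"
    "\<forall>x t. (\<forall>n\<in>V. x n = \<phi> n (cut_to M t)) \<longrightarrow> p x = 0"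
    by (rule polynomial_image_in_hypersurface[OF M V card, of \<phi>]) (use \<phi> in blast)+
  have "p x = 0" if t: "\<forall>i\<ge>r. t i = 0" and x: "\<forall>w\<in>W. x w = (\<Sum>v\<in>V - W. g w v t * x v)" for x t
  proof (rule p(4)[rule_format])
    fix n assume n: "n \<in> V"
    let ?t = "\<lambda>i. case i of Inl i \<Rightarrow> t i | Inr v \<Rightarrow> x v"
    have "cut_to M ?t (Inl i) = t i" for i using t by (cases "i < r") (auto simp: cut_to_def M_def)
    moreover have "cut_to M ?t (Inr v) = x v" if "v \<in> V - W" for v using that by (auto simp: cut_to_def M_def)
    ultimately show "x n = \<phi> n (cut_to M ?t)" using n x by (simp add: \<phi>_def)
  qed
  then show ?thesis unfolding generically_def using p by (intro bexI[of _ p]) blast+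
qed

section \<open>The generic conditions on the coefficients\<close>

lemma distinct_concat_map:
  assumes "distinct xs" "\<And>x. x \<in> set xs \<Longrightarrow> distinct (f x)"
    "\<And>x y. x \<in> set xs \<Longrightarrow> y \<in> set xs \<Longrightarrow> x \<noteq> y \<Longrightarrow> set (f x) \<inter> set (f y) = {}"
  shows "distinct (concat (map f xs))"
  using assms
proof (induction xs)
  case (Cons x xs)
  have "set (f x) \<inter> set (f y) = {}" if "y \<in> set xs" for y using Cons.prems(1) Cons.prems(3)[of x y] that by auto
  moreover have "distinct (concat (map f xs))" using Cons by simp
  ultimately show ?case using Cons.prems(2) by auto
qed simp

lemma distinct_mons: "distinct (mons k)"
  unfolding mons_def
  by (intro distinct_concat_map) (auto simp: distinct_map inj_on_def intro!: distinct_concat_map)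

lemma cpeval_eq_sum:
  "cpeval k f a b c e = (\<Sum>(i, j, l, m)\<in>set (mons k). f (i, j, l, m) * a ^ i * b ^ j * c ^ l * e ^ m)"
  unfolding cpeval_def by (rule sum_list_distinct_conv_sum_set[OF distinct_mons])

type_synonym expo = "nat \<times> nat \<times> nat \<times> nat"

definition coef_index :: "nat \<Rightarrow> (nat \<times> expo) set" where
  "coef_index d = {(k, m). k \<le> d \<and> k mod 2 = d mod 2 \<and> m \<in> set (mons k)}"

lemma coef_space_eq: "coef_space d = supported_on (coef_index d)"
  unfolding coef_space_def supported_on_def coef_index_def by blast

lemma finite_coef_index: "finite (coef_index d)"
proof (rule finite_subset)
  show "coef_index d \<subseteq> (SIGMA k:{..d}. set (mons k))" by (auto simp: coef_index_def)
qed auto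

text \<open>Each condition is linear in the coefficients of one form. By the two normalizations it
  has coefficient 1 at its own monomial and 0 at the other selected monomials of that degree, so the
  system is already solved for the coefficients indexed by \<open>W\<close>.\<close>

lemma generically_functionals:
  fixes ell :: "nat \<times> expo \<Rightarrow> expo \<Rightarrow> (nat \<Rightarrow> complex) \<Rightarrow> complex"
  assumes W: "W \<subseteq> coef_index d" and r: "r < card W" and p: "\<And>w m. ell w m \<in> polyfun"
    and 1: "\<And>k m t. (k, m) \<in> W \<Longrightarrow> ell (k, m) m t = 1"
    and 0: "\<And>k m m' t. (k, m) \<in> W \<Longrightarrow> (k, m') \<in> W \<Longrightarrow> m' \<noteq> m \<Longrightarrow> ell (k, m) m' t = 0"
  shows "generically (coef_space d)
    (\<lambda>c. \<not> (\<exists>t. (\<forall>i\<ge>r. t i = 0) \<and> (\<forall>(k, m)\<in>W. (\<Sum>m'\<in>set (mons k). c (k, m') * ell (k, m) m' t) = 0)))"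
proof -
  define g where "g w v t = (if fst v = fst w then - ell w (snd v) t else 0)" for w v :: "nat \<times> expo" and t
  have g: "g w v \<in> polyfun" for w v
    using polyfun_uminus[OF p[of w "snd v"]] by (cases "fst v = fst w") (simp_all add: g_def[abs_def] pf_const)
  have "c (k, m) = (\<Sum>v\<in>coef_index d - W. g (k, m) v t * c v)"
    if w: "(k, m) \<in> W" and eq: "(\<Sum>m'\<in>set (mons k). c (k, m') * ell (k, m) m' t) = 0" for c k m t
  proof -
    have km: "k \<le> d" "k mod 2 = d mod 2" "m \<in> set (mons k)" using w W by (auto simp: coef_index_def)
    let ?I = "(\<lambda>m'. (k, m')) ` {m' \<in> set (mons k). (k, m') \<notin> W}"
    have "(\<Sum>v\<in>coef_index d - W. g (k, m) v t * c v) = (\<Sum>v\<in>?I. g (k, m) v t * c v)"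
      by (rule sum.mono_neutral_right) (use km finite_coef_index in \<open>auto simp: coef_index_def g_def\<close>)
    also have "\<dots> = (\<Sum>m'\<in>{m' \<in> set (mons k). (k, m') \<notin> W}. - (c (k, m') * ell (k, m) m' t))"
      by (subst sum.reindex) (auto simp: inj_on_def g_def mult.commute)
    also have "\<dots> = - (\<Sum>m'\<in>set (mons k) - {m}. c (k, m') * ell (k, m) m' t)"
      unfolding sum_negf
      by (intro arg_cong[where f = uminus] sum.mono_neutral_left) (use w 0 in auto)
    also have "\<dots> = c (k, m)"
      using eq sum.remove[of "set (mons k)" m "\<lambda>m'. c (k, m') * ell (k, m) m' t"] km 1[OF w] by (simp add: add_eq_0_iff2)
    finally show ?thesis by simp
  qed
  note solve = this
  show ?thesis
    unfolding coef_space_eq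
  proof (rule generically_mono[OF generically_no_solution[OF finite_coef_index W r g]], intro notI)
    fix c assume no: "\<not> (\<exists>t. (\<forall>i\<ge>r. t i = 0) \<and> (\<forall>w\<in>W. c w = (\<Sum>v\<in>coef_index d - W. g w v t * c v)))"
    assume "\<exists>t. (\<forall>i\<ge>r. t i = 0) \<and> (\<forall>(k, m)\<in>W. (\<Sum>m'\<in>set (mons k). c (k, m') * ell (k, m) m' t) = 0)"
    then obtain t where t: "\<forall>i\<ge>r. t i = 0" "\<forall>(k, m)\<in>W. (\<Sum>m'\<in>set (mons k). c (k, m') * ell (k, m) m' t) = 0" by auto
    have "c w = (\<Sum>v\<in>coef_index d - W. g w v t * c v)" if "w \<in> W" for w
      using solve[of "fst w" "snd w" c t] t(2) that by (auto simp: case_prod_beta)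
    then show False using no t(1) by blast
  qed
qed

lemma fval_eq_sum:
  "fval c k (M2 a b u e) = (\<Sum>m\<in>set (mons k). c (k, m) * (case m of (i, j, l, m') \<Rightarrow> a ^ i * b ^ j * u ^ l * e ^ m'))"
  unfolding cform_def mat2.case cpeval_eq_sum by (intro sum.cong refl) (auto simp: mult.assoc)

text \<open>\<open>chart_poly c k s\<close> is the restriction of \<open>f_k\<close> to the line of matrices
  \<open>(s, 1) \<otimes> (z, 1)\<close> on the quadric.\<close>

definition chart_poly :: "(nat \<times> expo \<Rightarrow> complex) \<Rightarrow> nat \<Rightarrow> complex \<Rightarrow> complex poly" where
  "chart_poly c k s = (\<Sum>(i, j, l, m)\<in>set (mons k). monom (c (k, i, j, l, m) * s ^ (i + j)) (i + l))"

lemma poly_chart_poly: "poly (chart_poly c k s) z = fval c k (M2 (s * z) s z 1)"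
  unfolding chart_poly_def fval_eq_sum poly_sum
  by (intro sum.cong refl) (auto simp: poly_monom power_add power_mult_distrib)

lemma poly_chart_poly_sum:
  "poly (chart_poly c k s) z = (\<Sum>m\<in>set (mons k). c (k, m) * (case m of (i, j, l, m') \<Rightarrow> s ^ (i + j) * z ^ (i + l)))"
  unfolding chart_poly_def poly_sum by (intro sum.cong refl) (auto simp: poly_monom)

lemma degree_chart_poly: "degree (chart_poly c k s) \<le> k"
  unfolding chart_poly_def by (intro degree_sum_le) (auto simp: set_mons intro!: order.trans[OF degree_monom_le])

text \<open>The coefficient of degree \<open>k\<close> is the value at z = \<infinity>, the point of
  the ruling line missed by the chart.\<close>

lemma coeff_chart_poly: "coeff (chart_poly c k s) k = fval c k (M2 s 0 1 0)"
  unfolding chart_poly_def fval_eq_sum coeff_sum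
  by (intro sum.cong refl) (auto simp: set_mons coeff_monom power_0_left)

lemma pderiv_sum: "pderiv (\<Sum>i\<in>I. f i) = (\<Sum>i\<in>I. pderiv (f i))"
  by (induction I rule: infinite_finite_induct) (auto simp: pderiv_add)

lemma poly_pderiv_chart_poly:
  "poly (pderiv (chart_poly c k s)) z = (\<Sum>m\<in>set (mons k). c (k, m) *
    (case m of (i, j, l, m') \<Rightarrow> s ^ (i + j) * (of_nat (i + l) * z ^ (i + l - 1))))"
  unfolding chart_poly_def pderiv_sum poly_sum
  by (intro sum.cong refl) (auto simp: pderiv_monom poly_monom)

text \<open>The divided difference of z^p at the nodes a and b, written without a denominator: it is
  polynomial in both nodes and becomes the derivative for a = b.\<close>

definition divdiff :: "nat \<Rightarrow> complex \<Rightarrow> complex \<Rightarrow> complex" where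
  "divdiff p a b = (\<Sum>i<p. a ^ i * b ^ (p - 1 - i))"

lemma divdiff_0 [simp]: "divdiff 0 a b = 0" and divdiff_1 [simp]: "divdiff (Suc 0) a b = 1"
  by (simp_all add: divdiff_def)

lemma divdiff_mult: "divdiff p a b * (a - b) = a ^ p - b ^ p"
  by (simp add: divdiff_def power_diff_sumr2 mult.commute)

lemma divdiff_same: "divdiff p a a = of_nat p * a ^ (p - 1)"
  by (simp add: divdiff_def flip: power_add)

lemma polyfun_divdiff: "(\<lambda>t. divdiff p (t i) (t j)) \<in> polyfun"
  unfolding divdiff_def by (intro polyfun_intros)

section \<open>Parameter counts for the individual conditions\<close>

lemma generically_coeff_nonzero:
  assumes "(k, m) \<in> coef_index d"
  shows "generically (coef_space d) (\<lambda>c. c (k, m) \<noteq> 0)"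
  unfolding generically_def coef_space_eq
proof (intro bexI[of _ "\<lambda>c. c (k, m)"] conjI bexI[of _ "\<lambda>v. if v = (k, m) then 1 else 0"])
  show "(\<lambda>v. if v = (k, m) then 1 else 0) \<in> supported_on (coef_index d)"
    using assms by (auto simp: supported_on_def)
qed (auto intro: pf_var)

text \<open>Two conditions, at the points z = 0 and z = \<infinity> of a ruling line, against the
  one parameter s. In particular the form vanishes identically on none of these lines.\<close>

lemma generically_no_common_zero_at_0_inf:
  assumes "1 \<le> k" "k \<le> d" "k mod 2 = d mod 2"
  shows "generically (coef_space d) (\<lambda>c. \<not> (\<exists>s. fval c k (M2 0 s 0 1) = 0 \<and> fval c k (M2 s 0 1 0) = 0))"
proof -
  let ?W = "{(k, (0, 0, 0, k)), (k, (0, 0, k, 0))} :: (nat \<times> expo) set"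
  \<comment> \<open>As 0^0 = 1, the powers of 0 keep exactly the monomials that survive at the
    point; the last exponent of the label tells which point is meant.\<close>
  define ell :: "nat \<times> expo \<Rightarrow> expo \<Rightarrow> (nat \<Rightarrow> complex) \<Rightarrow> complex" where
    "ell = (\<lambda>(_, (_, _, _, p)) (i, j, l, m) t. if p = 0 then 0 ^ j * 0 ^ m * t 0 ^ i else 0 ^ i * 0 ^ l * t 0 ^ j)"
  have "generically (coef_space d)
    (\<lambda>c. \<not> (\<exists>t. (\<forall>i\<ge>1. t i = 0) \<and> (\<forall>(k, m)\<in>?W. (\<Sum>m'\<in>set (mons k). c (k, m') * ell (k, m) m' t) = 0)))"
  proof (rule generically_functionals)
    show "?W \<subseteq> coef_index d" using assms by (auto simp: coef_index_def set_mons)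
    show "1 < card ?W" using assms by simp
    show "ell w m \<in> polyfun" for w m
      by (cases w; cases m; cases "snd (snd (snd (snd w))) = 0") (auto simp: ell_def intro!: polyfun_intros)
  qed (use assms in \<open>auto simp: ell_def power_0_left\<close>)
  then show ?thesis
  proof (rule generically_mono, intro notI)
    fix c assume *: "\<not> (\<exists>t. (\<forall>i\<ge>1. t i = 0) \<and> (\<forall>(k, m)\<in>?W. (\<Sum>m'\<in>set (mons k). c (k, m') * ell (k, m) m' t) = 0))"
    assume "\<exists>s. fval c k (M2 0 s 0 1) = 0 \<and> fval c k (M2 s 0 1 0) = 0"
    then obtain s where s: "fval c k (M2 0 s 0 1) = 0" "fval c k (M2 s 0 1 0) = 0" by blast
    let ?t = "\<lambda>i::nat. if i = 0 then s else 0 :: complex"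
    have "(\<Sum>m'\<in>set (mons k). c (k, m') * ell (k, 0, 0, 0, k) m' ?t) = fval c k (M2 0 s 0 1)"
      unfolding fval_eq_sum by (intro sum.cong refl) (use assms in \<open>auto simp: ell_def\<close>)
    moreover have "(\<Sum>m'\<in>set (mons k). c (k, m') * ell (k, 0, 0, k, 0) m' ?t) = fval c k (M2 s 0 1 0)"
      unfolding fval_eq_sum by (intro sum.cong refl) (auto simp: ell_def)
    ultimately show False using * s by (auto dest!: spec[of _ ?t])
  qed
qed

text \<open>Two conditions against the parameter s, for two consecutive forms at the point z =
  \<infinity>.\<close>

lemma generically_no_common_zero_at_inf:
  assumes "k + 2 \<le> d" "k mod 2 = d mod 2"
  shows "generically (coef_space d) (\<lambda>c. \<not> (\<exists>s. fval c k (M2 s 0 1 0) = 0 \<and> fval c (k + 2) (M2 s 0 1 0) = 0))"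
proof -
  let ?W = "{(k, (0, 0, k, 0)), (k + 2, (0, 0, k + 2, 0))} :: (nat \<times> expo) set"
  define ell :: "nat \<times> expo \<Rightarrow> expo \<Rightarrow> (nat \<Rightarrow> complex) \<Rightarrow> complex" where
    "ell = (\<lambda>_ (i, j, l, m) t. 0 ^ j * 0 ^ m * t 0 ^ i)"
  have "generically (coef_space d)
    (\<lambda>c. \<not> (\<exists>t. (\<forall>i\<ge>1. t i = 0) \<and> (\<forall>(k, m)\<in>?W. (\<Sum>m'\<in>set (mons k). c (k, m') * ell (k, m) m' t) = 0)))"
  proof (rule generically_functionals)
    show "?W \<subseteq> coef_index d" using assms by (auto simp: coef_index_def set_mons)
    show "1 < card ?W" using assms by simp
    show "ell w m \<in> polyfun" for w m
      by (cases w; cases m) (auto simp: ell_def intro!: polyfun_intros)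
  qed (use assms in \<open>auto simp: ell_def\<close>)
  then show ?thesis
  proof (rule generically_mono, intro notI)
    fix c assume *: "\<not> (\<exists>t. (\<forall>i\<ge>1. t i = 0) \<and> (\<forall>(k, m)\<in>?W. (\<Sum>m'\<in>set (mons k). c (k, m') * ell (k, m) m' t) = 0))"
    assume "\<exists>s. fval c k (M2 s 0 1 0) = 0 \<and> fval c (k + 2) (M2 s 0 1 0) = 0"
    then obtain s where s: "fval c k (M2 s 0 1 0) = 0" "fval c (k + 2) (M2 s 0 1 0) = 0" by blast
    let ?t = "\<lambda>i::nat. if i = 0 then s else 0 :: complex"
    have "(\<Sum>m'\<in>set (mons k). c (k, m') * ell (k, m) m' ?t) = fval c k (M2 s 0 1 0)" for k m
      unfolding fval_eq_sum by (intro sum.cong refl) (auto simp: ell_def)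
    then show False using * s by (auto dest!: spec[of _ ?t])
  qed
qed

text \<open>The conditions of vanishing at \<open>a\<close> and \<open>b\<close> are solved for the two lowest coefficients,
  using the divided difference; the result makes sense for \<open>a = b\<close>.\<close>

definition hermite_functional :: "nat \<times> expo \<Rightarrow> expo \<Rightarrow> complex \<Rightarrow> complex \<Rightarrow> complex \<Rightarrow> complex" where
  "hermite_functional = (\<lambda>(_, (_, _, q, _)) (i, j, l, m) s a b.
     if q = 0 then s ^ (i + j) * (a ^ (i + l) - a * divdiff (i + l) a b) else s ^ (i + j) * divdiff (i + l) a b)"

text \<open>The linear interpolant at a and b is f(a) + (z - a) D with D the divided difference, and
  the two functionals are its constant term and its slope. Both vanish when a and b are roots,
  counted with multiplicity, and they are dual to 1 and z, which is the normalization of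
  \<open>generically_functionals\<close>.\<close>

lemma hermite_functional_eval:
  assumes k: "1 \<le> k" and a: "poly (chart_poly c k s) a = 0"
    and b: "if a = b then poly (pderiv (chart_poly c k s)) a = 0 else poly (chart_poly c k s) b = 0"
  shows "(\<Sum>m'\<in>set (mons k). c (k, m') * hermite_functional (k, 0, 0, q, p) m' s a b) = 0"
proof -
  let ?d = "\<Sum>m\<in>set (mons k). c (k, m) * (case m of (i, j, l, m') \<Rightarrow> s ^ (i + j) * divdiff (i + l) a b)"
  have d: "?d = 0"
  proof (cases "a = b")
    case True
    then have "?d = poly (pderiv (chart_poly c k s)) a" unfolding poly_pderiv_chart_poly by (simp add: divdiff_same)
    then show ?thesis using b True by simp
  next
    case False
    have "?d * (a - b) = poly (chart_poly c k s) a - poly (chart_poly c k s) b"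
      unfolding poly_chart_poly_sum sum_distrib_right sum_subtractf[symmetric]
    proof (intro sum.cong refl)
      fix m :: expo
      obtain i j l m' where m: "m = (i, j, l, m')" by (cases m)
      show "c (k, m) * (case m of (i, j, l, m') \<Rightarrow> s ^ (i + j) * divdiff (i + l) a b) * (a - b) =
        c (k, m) * (case m of (i, j, l, m') \<Rightarrow> s ^ (i + j) * a ^ (i + l)) -
        c (k, m) * (case m of (i, j, l, m') \<Rightarrow> s ^ (i + j) * b ^ (i + l))"
        unfolding m prod.case mult.assoc divdiff_mult by (simp only: right_diff_distrib)
    qed
    then show ?thesis using a b False by simp
  qed
  show ?thesis
  proof (cases "q = 0")
    case True
    have "(\<Sum>m'\<in>set (mons k). c (k, m') * hermite_functional (k, 0, 0, q, p) m' s a b) = poly (chart_poly c k s) a - a * ?d"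
      unfolding poly_chart_poly_sum sum_distrib_left sum_subtractf[symmetric]
      by (intro sum.cong refl) (auto simp: hermite_functional_def True algebra_simps)
    then show ?thesis using a d by simp
  next
    case False
    have "(\<Sum>m'\<in>set (mons k). c (k, m') * hermite_functional (k, 0, 0, q, p) m' s a b) = ?d"
      by (intro sum.cong refl) (auto simp: hermite_functional_def False)
    then show ?thesis using d by simp
  qed
qed

lemma polyfun_hermite: "(\<lambda>t. hermite_functional w m (t i) (t j) (t l)) \<in> polyfun"
  by (cases w; cases m; cases "fst (snd (snd (snd w))) = 0")
    (auto simp: hermite_functional_def intro!: polyfun_intros polyfun_divdiff)

text \<open>Four conditions, solved for the coefficients of 1 and z in both forms, against the three
  parameters s, a, b.\<close>

lemma generically_no_two_common_roots:
  assumes "2 \<le> k" "k + 2 \<le> d" "k mod 2 = d mod 2"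
  shows "generically (coef_space d) (\<lambda>c. \<not> (\<exists>s a b. a \<noteq> b \<and>
    poly (chart_poly c k s) a = 0 \<and> poly (chart_poly c k s) b = 0 \<and>
    poly (chart_poly c (k + 2) s) a = 0 \<and> poly (chart_poly c (k + 2) s) b = 0))"
proof -
  let ?W = "{(k, (0, 0, 0, k)), (k, (0, 0, 1, k - 1)), (k + 2, (0, 0, 0, k + 2)), (k + 2, (0, 0, 1, k + 1))} :: (nat \<times> expo) set"
  define ell :: "nat \<times> expo \<Rightarrow> expo \<Rightarrow> (nat \<Rightarrow> complex) \<Rightarrow> complex" where
    "ell = (\<lambda>w m t. hermite_functional w m (t 0) (t 1) (t 2))"
  have "generically (coef_space d)
    (\<lambda>c. \<not> (\<exists>t. (\<forall>i\<ge>3. t i = 0) \<and> (\<forall>(k, m)\<in>?W. (\<Sum>m'\<in>set (mons k). c (k, m') * ell (k, m) m' t) = 0)))"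
  proof (rule generically_functionals)
    show "?W \<subseteq> coef_index d" using assms by (auto simp: coef_index_def set_mons)
    show "3 < card ?W" using assms by simp
    show "ell w m \<in> polyfun" for w m unfolding ell_def by (rule polyfun_hermite)
  qed (use assms in \<open>auto simp: ell_def hermite_functional_def\<close>)
  then show ?thesis
  proof (rule generically_mono, intro notI)
    fix c assume *: "\<not> (\<exists>t. (\<forall>i\<ge>3. t i = 0) \<and> (\<forall>(k, m)\<in>?W. (\<Sum>m'\<in>set (mons k). c (k, m') * ell (k, m) m' t) = 0))"
    assume "\<exists>s a b. a \<noteq> b \<and>
      poly (chart_poly c k s) a = 0 \<and> poly (chart_poly c k s) b = 0 \<and>
      poly (chart_poly c (k + 2) s) a = 0 \<and> poly (chart_poly c (k + 2) s) b = 0"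
    then obtain s a b where s: "a \<noteq> b" "poly (chart_poly c k s) a = 0" "poly (chart_poly c k s) b = 0"
      "poly (chart_poly c (k + 2) s) a = 0" "poly (chart_poly c (k + 2) s) b = 0" by blast
    let ?t = "\<lambda>i::nat. if i = 0 then s else if i = 1 then a else if i = 2 then b else 0 :: complex"
    have "(\<Sum>m'\<in>set (mons k). c (k, m') * ell (k, 0, 0, q, p) m' ?t) = 0" for q p
      using hermite_functional_eval[of k c s a b q p] s assms by (simp add: ell_def)
    moreover have "(\<Sum>m'\<in>set (mons (k + 2)). c (k + 2, m') * ell (k + 2, 0, 0, q, p) m' ?t) = 0" for q p
      using hermite_functional_eval[of "k + 2" c s a b q p] s by (simp add: ell_def)
    ultimately have "(\<forall>i\<ge>3. ?t i = 0) \<and> (\<forall>(k, m)\<in>?W. (\<Sum>m'\<in>set (mons k). c (k, m') * ell (k, m) m' ?t) = 0)" by auto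
    then show False by (rule notE[OF *, OF exI[of _ ?t]])
  qed
qed

text \<open>Three conditions against s and a; the double root uses the interpolation functionals
  with coinciding nodes.\<close>

lemma generically_no_common_double_root:
  assumes "2 \<le> k" "k \<le> d" "k mod 2 = d mod 2" "1 \<le> k'" "k' \<le> d" "k' mod 2 = d mod 2" "k \<noteq> k'"
  shows "generically (coef_space d) (\<lambda>c. \<not> (\<exists>s a.
    poly (chart_poly c k s) a = 0 \<and> poly (pderiv (chart_poly c k s)) a = 0 \<and> poly (chart_poly c k' s) a = 0))"
proof -
  let ?W = "{(k, (0, 0, 0, k)), (k, (0, 0, 1, k - 1)), (k', (0, 0, 0, k'))} :: (nat \<times> expo) set"
  define ell :: "nat \<times> expo \<Rightarrow> expo \<Rightarrow> (nat \<Rightarrow> complex) \<Rightarrow> complex" where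
    "ell = (\<lambda>w m t. if fst w = k then hermite_functional w m (t 0) (t 1) (t 1)
       else case m of (i, j, l, m') \<Rightarrow> t 0 ^ (i + j) * t 1 ^ (i + l))"
  have "generically (coef_space d)
    (\<lambda>c. \<not> (\<exists>t. (\<forall>i\<ge>2. t i = 0) \<and> (\<forall>(k, m)\<in>?W. (\<Sum>m'\<in>set (mons k). c (k, m') * ell (k, m) m' t) = 0)))"
  proof (rule generically_functionals)
    show "?W \<subseteq> coef_index d" using assms by (auto simp: coef_index_def set_mons)
    show "2 < card ?W" using assms by simp
    show "ell w m \<in> polyfun" for w m
      by (cases m; cases "fst w = k") (auto simp: ell_def intro!: polyfun_hermite polyfun_intros)
  qed (use assms in \<open>auto simp: ell_def hermite_functional_def\<close>)
  then show ?thesis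
  proof (rule generically_mono, intro notI)
    fix c assume *: "\<not> (\<exists>t. (\<forall>i\<ge>2. t i = 0) \<and> (\<forall>(k, m)\<in>?W. (\<Sum>m'\<in>set (mons k). c (k, m') * ell (k, m) m' t) = 0))"
    assume "\<exists>s a. poly (chart_poly c k s) a = 0 \<and> poly (pderiv (chart_poly c k s)) a = 0 \<and> poly (chart_poly c k' s) a = 0"
    then obtain s a where s: "poly (chart_poly c k s) a = 0" "poly (pderiv (chart_poly c k s)) a = 0" "poly (chart_poly c k' s) a = 0"
      by blast
    let ?t = "\<lambda>i::nat. if i = 0 then s else if i = 1 then a else 0 :: complex"
    have "(\<Sum>m'\<in>set (mons k). c (k, m') * ell (k, 0, 0, q, p) m' ?t) = 0" for q p
      using hermite_functional_eval[of k c s a a q p] s assms by (simp add: ell_def)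
    moreover have "(\<Sum>m'\<in>set (mons k'). c (k', m') * ell (k', 0, 0, 0, k') m' ?t) = 0"
      using s(3) assms(7) unfolding poly_chart_poly_sum by (simp add: ell_def case_prod_beta)
    ultimately have "(\<forall>i\<ge>2. ?t i = 0) \<and> (\<forall>(k, m)\<in>?W. (\<Sum>m'\<in>set (mons k). c (k, m') * ell (k, m) m' ?t) = 0)" by auto
    then show False by (rule notE[OF *, OF exI[of _ ?t]])
  qed
qed

text \<open>Three values against the two chart coordinates of a point of the quadric.\<close>

lemma generically_no_triple_common_root:
  assumes "5 \<le> d" "odd d"
  shows "generically (coef_space d) (\<lambda>c. \<not> (\<exists>s a.
    poly (chart_poly c 1 s) a = 0 \<and> poly (chart_poly c 3 s) a = 0 \<and> poly (chart_poly c 5 s) a = 0))"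
proof -
  let ?W = "{(1, (0, 0, 0, 1)), (3, (0, 0, 0, 3)), (5, (0, 0, 0, 5))} :: (nat \<times> expo) set"
  define ell :: "nat \<times> expo \<Rightarrow> expo \<Rightarrow> (nat \<Rightarrow> complex) \<Rightarrow> complex" where
    "ell = (\<lambda>w (i, j, l, m') t. t 0 ^ (i + j) * t 1 ^ (i + l))"
  have "generically (coef_space d)
    (\<lambda>c. \<not> (\<exists>t. (\<forall>i\<ge>2. t i = 0) \<and> (\<forall>(k, m)\<in>?W. (\<Sum>m'\<in>set (mons k). c (k, m') * ell (k, m) m' t) = 0)))"
  proof (rule generically_functionals)
    show "?W \<subseteq> coef_index d" using assms by (auto simp: coef_index_def set_mons odd_iff_mod_2_eq_one)
    show "2 < card ?W" by simp
    show "ell w m \<in> polyfun" for w m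
      by (cases m) (auto simp: ell_def intro!: polyfun_intros)
  qed (auto simp: ell_def)
  then show ?thesis
  proof (rule generically_mono, intro notI)
    fix c assume *: "\<not> (\<exists>t. (\<forall>i\<ge>2. t i = 0) \<and> (\<forall>(k, m)\<in>?W. (\<Sum>m'\<in>set (mons k). c (k, m') * ell (k, m) m' t) = 0))"
    assume "\<exists>s a. poly (chart_poly c 1 s) a = 0 \<and> poly (chart_poly c 3 s) a = 0 \<and> poly (chart_poly c 5 s) a = 0"
    then obtain s a where s: "poly (chart_poly c 1 s) a = 0" "poly (chart_poly c 3 s) a = 0" "poly (chart_poly c 5 s) a = 0"
      by blast
    let ?t = "\<lambda>i::nat. if i = 0 then s else if i = 1 then a else 0 :: complex"
    have "(\<Sum>m'\<in>set (mons k). c (k, m') * ell (k, m) m' ?t) = poly (chart_poly c k s) a" for k m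
      unfolding poly_chart_poly_sum by (simp add: ell_def case_prod_beta)
    then have "(\<forall>i\<ge>2. ?t i = 0) \<and> (\<forall>(k, m)\<in>?W. (\<Sum>m'\<in>set (mons k). c (k, m') * ell (k, m) m' ?t) = 0)" using s by auto
    then show False by (rule notE[OF *, OF exI[of _ ?t]])
  qed
qed

section \<open>Transposition, which exchanges the two rulings\<close>

definition transpose_coeffs :: "(nat \<times> expo \<Rightarrow> complex) \<Rightarrow> nat \<times> expo \<Rightarrow> complex" where
  "transpose_coeffs c = (\<lambda>(k, i, j, l, m). c (k, i, l, j, m))"

fun mtransp :: "'a mat2 \<Rightarrow> 'a mat2" where
  "mtransp (M2 a b c e) = M2 a c b e"

lemma fval_transpose: "fval (transpose_coeffs c) k (mtransp B) = fval c k B"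
proof (cases B)
  case (M2 a b u e)
  have "bij_betw (\<lambda>(i, j, l, m). (i, l, j, m)) (set (mons k)) (set (mons k))"
    by (rule bij_betw_byWitness[where f' = "\<lambda>(i, j, l, m). (i, l, j, m)"]) (auto simp: set_mons)
  then show ?thesis unfolding M2 mtransp.simps fval_eq_sum
    by (subst sum.reindex_bij_betw[symmetric]) (auto simp: transpose_coeffs_def mult_ac intro!: sum.cong)
qed

lemma transpose_transpose: "transpose_coeffs (transpose_coeffs c) = c"
  by (auto simp: transpose_coeffs_def)

text \<open>Transposition permutes the coordinates of the coefficient space, so polynomials pull
  back to polynomials.\<close>

lemma generically_transpose:
  assumes "generically (coef_space d) G"
  shows "generically (coef_space d) (\<lambda>c. G (transpose_coeffs c))"
proof -
  have V: "transpose_coeffs c \<in> coef_space d" if "c \<in> coef_space d" for c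
    using that by (fastforce simp: coef_space_def transpose_coeffs_def set_mons)
  obtain p c where p: "p \<in> polyfun" "c \<in> coef_space d" "p c \<noteq> 0" "\<And>c. c \<in> coef_space d \<Longrightarrow> p c \<noteq> 0 \<Longrightarrow> G c"
    using assms unfolding generically_def by blast
  have "(\<lambda>x. p (\<lambda>v. transpose_coeffs x v)) \<in> polyfun"
    by (rule polyfun_compose[OF p(1)]) (auto simp: transpose_coeffs_def case_prod_beta intro: pf_var)
  then show ?thesis unfolding generically_def
    using p V transpose_transpose by (intro bexI[of _ "\<lambda>x. p (transpose_coeffs x)"]) (auto intro: bexI[of _ "transpose_coeffs c"])
qed

text \<open>The index \<open>()\<close> turns a premise on \<open>d\<close> into a quantifier over a
  finite set, empty when the premise fails, so that \<open>generically_ball\<close> applies. The two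
  extreme coefficients are the values of a form at two corners of the quadric outside the
  chart.\<close>

definition nondegenerate :: "nat \<Rightarrow> (nat \<times> expo \<Rightarrow> complex) \<Rightarrow> bool" where
  "nondegenerate d c \<longleftrightarrow>
    (\<forall>k\<in>{k. 1 \<le> k \<and> k \<le> d \<and> k mod 2 = d mod 2}.
      (\<not> (\<exists>s. fval c k (M2 0 s 0 1) = 0 \<and> fval c k (M2 s 0 1 0) = 0)) \<and>
      c (k, k, 0, 0, 0) \<noteq> 0 \<and> c (k, 0, k, 0, 0) \<noteq> 0) \<and>
    (\<forall>k\<in>{k. 1 \<le> k \<and> k + 2 \<le> d \<and> k mod 2 = d mod 2}.
      \<not> (\<exists>s. fval c k (M2 s 0 1 0) = 0 \<and> fval c (k + 2) (M2 s 0 1 0) = 0)) \<and>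
    (\<forall>k\<in>{k. 2 \<le> k \<and> k + 2 \<le> d \<and> k mod 2 = d mod 2}. \<not> (\<exists>s a b. a \<noteq> b \<and>
      poly (chart_poly c k s) a = 0 \<and> poly (chart_poly c k s) b = 0 \<and>
      poly (chart_poly c (k + 2) s) a = 0 \<and> poly (chart_poly c (k + 2) s) b = 0)) \<and>
    (\<forall>k\<in>{k. 2 \<le> k \<and> k \<le> d \<and> k mod 2 = d mod 2}. \<forall>k'\<in>{k'. 1 \<le> k' \<and> k' \<le> d \<and> k' mod 2 = d mod 2 \<and> k \<noteq> k'}.
      \<not> (\<exists>s a. poly (chart_poly c k s) a = 0 \<and> poly (pderiv (chart_poly c k s)) a = 0 \<and> poly (chart_poly c k' s) a = 0)) \<and>
    (\<forall>_\<in>{x. x = () \<and> odd d}. \<not> (\<exists>s a.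
      poly (chart_poly c 1 s) a = 0 \<and> poly (chart_poly c 3 s) a = 0 \<and> poly (chart_poly c 5 s) a = 0)) \<and>
    (\<forall>_\<in>{x. x = () \<and> even d}. c (0, 0, 0, 0, 0) \<noteq> 0)"

lemma generically_nondegenerate:
  assumes "d > 3"
  shows "generically (coef_space d) (nondegenerate d)"
proof -
  have fin: "finite {k. P k \<and> k \<le> d \<and> Q k}" "finite {k. P k \<and> k + 2 \<le> d \<and> Q k}" for P Q :: "nat \<Rightarrow> bool"
    by (rule finite_subset[of _ "{..d}"]; auto)+
  have odd5: "odd d \<Longrightarrow> 5 \<le> d" using assms by presburger
  note ball = generically_ball[where V = "coef_index d", folded coef_space_eq]
  note conj = generically_conj[where V = "coef_index d", folded coef_space_eq]
  show ?thesis
    unfolding nondegenerate_def[abs_def]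
  proof (intro conj)
    show "generically (coef_space d) (\<lambda>c. \<forall>k\<in>{k. 1 \<le> k \<and> k \<le> d \<and> k mod 2 = d mod 2}.
      (\<not> (\<exists>s. fval c k (M2 0 s 0 1) = 0 \<and> fval c k (M2 s 0 1 0) = 0)) \<and>
      c (k, k, 0, 0, 0) \<noteq> 0 \<and> c (k, 0, k, 0, 0) \<noteq> 0)"
      by (intro ball fin conj generically_no_common_zero_at_0_inf generically_coeff_nonzero)
         (auto simp: coef_index_def set_mons)
    show "generically (coef_space d) (\<lambda>c. \<forall>k\<in>{k. 1 \<le> k \<and> k + 2 \<le> d \<and> k mod 2 = d mod 2}.
      \<not> (\<exists>s. fval c k (M2 s 0 1 0) = 0 \<and> fval c (k + 2) (M2 s 0 1 0) = 0))"
      by (intro ball fin generically_no_common_zero_at_inf) auto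
    show "generically (coef_space d) (\<lambda>c. \<forall>k\<in>{k. 2 \<le> k \<and> k + 2 \<le> d \<and> k mod 2 = d mod 2}. \<not> (\<exists>s a b. a \<noteq> b \<and>
      poly (chart_poly c k s) a = 0 \<and> poly (chart_poly c k s) b = 0 \<and>
      poly (chart_poly c (k + 2) s) a = 0 \<and> poly (chart_poly c (k + 2) s) b = 0))"
      by (intro ball fin generically_no_two_common_roots) auto
    show "generically (coef_space d) (\<lambda>c. \<forall>k\<in>{k. 2 \<le> k \<and> k \<le> d \<and> k mod 2 = d mod 2}.
      \<forall>k'\<in>{k'. 1 \<le> k' \<and> k' \<le> d \<and> k' mod 2 = d mod 2 \<and> k \<noteq> k'}.
      \<not> (\<exists>s a. poly (chart_poly c k s) a = 0 \<and> poly (pderiv (chart_poly c k s)) a = 0 \<and> poly (chart_poly c k' s) a = 0))"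
      by (intro ball fin generically_no_common_double_root) auto
    show "generically (coef_space d) (\<lambda>c. \<forall>_\<in>{x. x = () \<and> odd d}. \<not> (\<exists>s a.
      poly (chart_poly c 1 s) a = 0 \<and> poly (chart_poly c 3 s) a = 0 \<and> poly (chart_poly c 5 s) a = 0))"
      by (intro ball finite generically_no_triple_common_root) (use odd5 in \<open>auto split: if_splits\<close>)
    show "generically (coef_space d) (\<lambda>c. \<forall>_\<in>{x. x = () \<and> even d}. c (0, 0, 0, 0, 0) \<noteq> 0)"
      by (intro ball finite generically_coeff_nonzero) (auto simp: coef_index_def set_mons split: if_splits)
  qed
qed

section \<open>Corner values, rank-one matrices and lines on the quadric\<close>

lemma fval_corner:
  "fval c k (M2 1 0 0 0) = c (k, k, 0, 0, 0)" "fval c k (M2 0 1 0 0) = c (k, 0, k, 0, 0)"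
proof -
  have *: "(\<Sum>m\<in>set (mons k). c (k, m) * g m) = c (k, m0)"
    if "m0 \<in> set (mons k)" "g m0 = 1" "\<And>m. m \<in> set (mons k) \<Longrightarrow> m \<noteq> m0 \<Longrightarrow> g m = 0" for m0 and g :: "expo \<Rightarrow> complex"
  proof -
    have "(\<Sum>m\<in>set (mons k). c (k, m) * g m) = (\<Sum>m\<in>{m0}. c (k, m) * g m)"
      by (rule sum.mono_neutral_right) (use that in auto)
    then show ?thesis using that by simp
  qed
  show "fval c k (M2 1 0 0 0) = c (k, k, 0, 0, 0)" "fval c k (M2 0 1 0 0) = c (k, 0, k, 0, 0)"
    unfolding fval_eq_sum
    by (rule *[of "(k, 0, 0, 0)"] *[of "(0, k, 0, 0)"]; auto simp: set_mons power_0_left split: if_splits; fail)+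
qed

lemma fval_0: "fval c 0 B = c (0, 0, 0, 0, 0)"
proof (cases B)
  case (M2 a b u e)
  have "set (mons 0) = {(0, 0, 0, 0)}" by (auto simp: set_mons)
  then show ?thesis by (simp add: M2 fval_eq_sum)
qed

text \<open>The Segre parametrization of the quadric det = 0; fixing one factor gives a line of one
  ruling.\<close>

definition tens :: "complex \<Rightarrow> complex \<Rightarrow> complex \<Rightarrow> complex \<Rightarrow> complex mat2" where
  "tens x1 x2 y1 y2 = M2 (x1 * y1) (x1 * y2) (x2 * y1) (x2 * y2)"

lemma mtransp_tens: "mtransp (tens x1 x2 y1 y2) = tens y1 y2 x1 x2"
  by (simp add: tens_def mult.commute)

lemma det_0_tens:
  assumes "mdet B = 0" "B \<noteq> mzero"
  obtains x1 x2 y1 y2 where "(x1, x2) \<noteq> (0, 0)" "(y1, y2) \<noteq> (0, 0)" "B = tens x1 x2 y1 y2"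
proof -
  obtain a b c e where B: "B = M2 a b c e" by (cases B)
  have d: "a * e = b * c" using assms(1) B by simp
  consider "a \<noteq> 0" | "b \<noteq> 0" | "a = 0" "b = 0" by blast
  then show ?thesis
  proof cases
    case 1
    then show ?thesis using that[of 1 "c / a" a b] B d by (simp add: tens_def field_simps)
  next
    case 2
    then show ?thesis using that[of 1 "e / b" a b] B d by (simp add: tens_def field_simps)
  next
    case 3
    then show ?thesis using that[of 0 1 c e] B assms(2) by (auto simp: tens_def mzero_def)
  qed
qed

lemma line_on_quadric:
  assumes ind: "\<And>l m. lincomb l m P Q = mzero \<Longrightarrow> l = 0 \<and> m = 0" and det: "\<And>l m. mdet (lincomb l m P Q) = (0::complex)"
  obtains x1 x2 y1 y2 z1 z2 where "(x1, x2) \<noteq> (0, 0)" "y1 * z2 - y2 * z1 \<noteq> 0" "P = tens x1 x2 y1 y2" "Q = tens x1 x2 z1 z2"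
  | x1 x2 y1 y2 z1 z2 where "(x1, x2) \<noteq> (0, 0)" "y1 * z2 - y2 * z1 \<noteq> 0" "P = tens y1 y2 x1 x2" "Q = tens z1 z2 x1 x2"
proof -
  have l: "lincomb 1 0 P Q = P" "lincomb 0 1 P Q = Q" by (cases P; cases Q; simp add: lincomb_M2)+
  have "mdet P = 0" "mdet Q = 0" using det[of 1 0] det[of 0 1] l by auto
  moreover have "P \<noteq> mzero" "Q \<noteq> mzero" using ind[of 1 0] ind[of 0 1] l by auto
  ultimately have PQ: "mdet P = 0" "P \<noteq> mzero" "mdet Q = 0" "Q \<noteq> mzero" by auto
  obtain x1 x2 y1 y2 where P: "(x1, x2) \<noteq> (0, 0)" "(y1, y2) \<noteq> (0, 0)" "P = tens x1 x2 y1 y2"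
    using PQ(1,2) by (rule det_0_tens)
  obtain u1 u2 v1 v2 where Q: "(u1, u2) \<noteq> (0, 0)" "(v1, v2) \<noteq> (0, 0)" "Q = tens u1 u2 v1 v2"
    using PQ(3,4) by (rule det_0_tens)
  \<comment> \<open>For two matrices of rank one, the determinant of the sum is the product of the
    cross determinants of the factors, so the left or the right factors are proportional.\<close>
  have "(x1 * u2 - x2 * u1) * (y1 * v2 - y2 * v1) = mdet (lincomb 1 1 P Q)"
    by (simp add: P Q tens_def lincomb_M2 algebra_simps)
  then have "x1 * u2 - x2 * u1 = 0 \<or> y1 * v2 - y2 * v1 = 0" using det by simp
  moreover have proportional: "\<exists>s. s \<noteq> 0 \<and> b1 = s * a1 \<and> b2 = s * a2"
    if "a1 * b2 - a2 * b1 = 0" "(a1, a2) \<noteq> (0, 0)" "(b1, b2) \<noteq> (0, 0)" for a1 a2 b1 b2 :: complex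
  proof (cases "a1 = 0")
    case True
    then show ?thesis using that by (intro exI[of _ "b2 / a2"]) auto
  next
    case False
    then show ?thesis using that by (intro exI[of _ "b1 / a1"]) (auto simp: field_simps)
  qed
  ultimately consider s where "s \<noteq> 0" "u1 = s * x1" "u2 = s * x2" | s where "s \<noteq> 0" "v1 = s * y1" "v2 = s * y2"
    using P Q by metis
  then show ?thesis
  proof cases
    case 1
    have Q': "Q = tens x1 x2 (s * v1) (s * v2)" by (simp add: Q 1 tens_def mult_ac)
    have "y1 * (s * v2) - y2 * (s * v1) \<noteq> 0"
    proof
      assume "y1 * (s * v2) - y2 * (s * v1) = 0"
      then obtain t where "s * v1 = t * y1" "s * v2 = t * y2" using proportional[of y1 "s * v2" y2 "s * v1"] P Q 1 by auto
      then have "lincomb t (- 1) P Q = mzero" by (simp add: P(3) Q' tens_def lincomb_M2 mzero_def)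
      then show False using ind by fastforce
    qed
    then show ?thesis using that(1)[OF P(1) _ P(3) Q'] by blast
  next
    case 2
    have Q': "Q = tens (s * u1) (s * u2) y1 y2" by (simp add: Q 2 tens_def mult_ac)
    have "x1 * (s * u2) - x2 * (s * u1) \<noteq> 0"
    proof
      assume "x1 * (s * u2) - x2 * (s * u1) = 0"
      then obtain t where "s * u1 = t * x1" "s * u2 = t * x2" using proportional[of x1 "s * u2" x2 "s * u1"] P Q 2 by auto
      then have "lincomb t (- 1) P Q = mzero" by (simp add: P(3) Q' tens_def lincomb_M2 mzero_def)
      then show False using ind by fastforce
    qed
    then show ?thesis using that(2)[OF P(2) _ P(3) Q'] by blast
  qed
qed

lemma fval_poly_on_line:
  "\<exists>p. \<forall>z. fval c k (tens x1 x2 (v1 + z * w1) (v2 + z * w2)) = poly p z"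
proof (intro exI allI)
  fix z
  show "fval c k (tens x1 x2 (v1 + z * w1) (v2 + z * w2)) =
    poly (\<Sum>m\<in>set (mons k). [:c (k, m):] * (case m of (i, j, l, m') \<Rightarrow>
      [:x1 * v1, x1 * w1:] ^ i * [:x1 * v2, x1 * w2:] ^ j * [:x2 * v1, x2 * w1:] ^ l * [:x2 * v2, x2 * w2:] ^ m')) z"
    unfolding tens_def fval_eq_sum poly_sum
    by (intro sum.cong refl) (auto simp: algebra_simps)
qed

lemma fval_chart:
  assumes "x2 \<noteq> 0" "y2 \<noteq> 0"
  shows "fval c k (tens x1 x2 y1 y2) = 0 \<longleftrightarrow> poly (chart_poly c k (x1 / x2)) (y1 / y2) = 0"
proof -
  have "tens x1 x2 y1 y2 = msmult (x2 * y2) (M2 (x1 / x2 * (y1 / y2)) (x1 / x2) (y1 / y2) 1)"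
    using assms by (simp add: tens_def)
  then show ?thesis using assms by (simp only: cform_msmult poly_chart_poly) simp
qed

lemma fval_chart_inf:
  assumes "x2 \<noteq> 0" "y1 \<noteq> 0"
  shows "fval c k (tens x1 x2 y1 0) = 0 \<longleftrightarrow> fval c k (M2 (x1 / x2) 0 1 0) = 0"
proof -
  have "tens x1 x2 y1 0 = msmult (x2 * y1) (M2 (x1 / x2) 0 1 0)"
    using assms by (simp add: tens_def)
  then show ?thesis using assms by (simp only: cform_msmult) simp
qed

section \<open>Roots in one variable, tropical levels and binary quadratic forms\<close>

lemma poly_root_exists:
  fixes p :: "complex poly"
  assumes "degree p \<ge> 1"
  shows "\<exists>z. poly p z = 0"
  using assms fundamental_theorem_of_algebra[of p] constant_degree[of p] by auto

lemma poly_simple_root_quotient: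
  fixes p :: "complex poly"
  assumes "poly p a = 0" "degree p \<ge> 1" "poly (pderiv p) a \<noteq> 0"
  obtains q where "p = [:- a, 1:] * q" "degree p = Suc (degree q)" "poly q a \<noteq> 0"
proof -
  obtain q where q: "p = [:- a, 1:] * q" using assms(1) by (auto simp: poly_eq_0_iff_dvd)
  then have "q \<noteq> 0" using assms by auto
  then have "degree p = Suc (degree q)" unfolding q by (subst degree_mult_eq) auto
  moreover have "poly (pderiv p) a = poly q a" unfolding q pderiv_mult by (simp add: pderiv_pCons)
  ultimately show ?thesis using that q assms(3) by simp
qed

lemma tropical_cond_interior:
  assumes "tropical_cond d c \<alpha> \<delta> B" "j \<le> d div 2" "of_nat j < \<alpha>" "\<alpha> < of_nat j + 1 \<or> j = d div 2"
  shows "fval c (2 * j + d mod 2) B = 0"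
  using assms unfolding tropical_cond_def by blast

text \<open>Both weights are nonzero, so the relation says that the two forms vanish together
  whatever the value of \<rho>.\<close>

lemma tropical_cond_integer:
  assumes "tropical_cond d c (of_nat j + 1) \<delta> B" "j < d div 2" "\<delta> \<noteq> 0"
  shows "fval c (2 * j + 2 + d mod 2) B = 0 \<longleftrightarrow> fval c (2 * j + d mod 2) B = 0"
proof -
  obtain \<rho> where "\<rho> > 0" "complex_of_real \<rho> * fval c (2 * j + 2 + d mod 2) B + \<delta> * fval c (2 * j + d mod 2) B = 0"
    using assms unfolding tropical_cond_def by blast
  then show ?thesis using assms(3) by (auto simp: add_eq_0_iff)
qed

lemma level_cases:
  fixes \<gamma> :: rat
  assumes "\<gamma> > 0"
  obtains j where "j < n" "\<gamma> = of_nat j + 1" | j where "j \<le> n" "of_nat j < \<gamma>" "\<gamma> < of_nat j + 1 \<or> j = n"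
proof -
  \<comment> \<open>The ceiling gives m < \<gamma> \<le> m + 1, so an integer belongs to the
    interval below it; all levels beyond \<open>n\<close> fall to the last index.\<close>
  define m where "m = nat (\<lceil>\<gamma>\<rceil> - 1)"
  have "\<lceil>\<gamma>\<rceil> \<ge> 1" using assms by linarith
  then have "of_nat m = (of_int (\<lceil>\<gamma>\<rceil> - 1) :: rat)" by (simp add: m_def)
  then have m: "of_nat m < \<gamma>" "\<gamma> \<le> of_nat m + 1" by linarith+
  show ?thesis
  proof (cases "m < n")
    case True
    then show ?thesis using that(1)[of m] that(2)[of m] m by fastforce
  next
    case False
    then have "of_nat n \<le> (of_nat m :: rat)" by simp
    then show ?thesis using that(2)[of n] m by simp
  qed
qed

lemma poly_two_roots_or_double_root:
  fixes p :: "complex poly"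
  assumes "degree p \<ge> 2"
  shows "(\<exists>a b. a \<noteq> b \<and> poly p a = 0 \<and> poly p b = 0) \<or> (\<exists>a. poly p a = 0 \<and> poly (pderiv p) a = 0)"
proof -
  obtain a where a: "poly p a = 0" using poly_root_exists[of p] assms by auto
  then obtain q where q: "p = [:- a, 1:] * q" by (auto simp: poly_eq_0_iff_dvd)
  then have "q \<noteq> 0" using assms by auto
  then have "degree p = 1 + degree q" unfolding q by (subst degree_mult_eq) auto
  then obtain b where b: "poly q b = 0" using poly_root_exists[of q] assms by auto
  show ?thesis
  proof (cases "a = b")
    case True
    have "poly (pderiv p) a = 0" unfolding q pderiv_mult using b True by simp
    then show ?thesis using a by blast
  next
    case False
    then show ?thesis using a b q by auto
  qed
qed

lemma qform_nontrivial_root: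
  fixes e f g :: complex
  obtains l m where "(l, m) \<noteq> (0, 0)" "qform e f g l m = 0"
proof (cases "e = 0")
  case True
  then show ?thesis using that[of 1 0] by (simp add: qform_def)
next
  case False
  define w where "w = csqrt (f * f - 4 * e * g)"
  have w: "w * w = f * f - 4 * e * g" unfolding w_def by (metis power2_csqrt power2_eq_square)
  define l where "l = (- f + w) / (2 * e)"
  have l: "2 * e * l = - f + w" using False by (simp add: l_def)
  have "4 * e * qform e f g l 1 = (2 * e * l) * (2 * e * l) + 2 * f * (2 * e * l) + 4 * e * g"
    by (simp add: qform_def algebra_simps)
  also have "\<dots> = 0" unfolding l using w by (simp add: algebra_simps)
  finally show ?thesis using that[of l 1] False by simp
qed

lemma qform_nonzero_value:
  fixes e f g :: complex
  assumes "(e, f, g) \<noteq> (0, 0, 0)"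
  obtains l m where "qform e f g l m \<noteq> 0"
proof -
  have "qform e f g 1 0 = e" "qform e f g 0 1 = g" "qform e f g 1 1 = e + f + g" by (simp_all add: qform_def)
  then show ?thesis using that assms by (metis add.left_neutral add.right_neutral)
qed

section \<open>Lines on the quadric for nondegenerate coefficients\<close>

context
  fixes d :: nat and c :: "nat \<times> expo \<Rightarrow> complex"
  assumes d: "d > 3" and nd: "nondegenerate d c" and ndt: "nondegenerate d (transpose_coeffs c)"
begin

lemma nondegD:
  shows "1 \<le> k \<Longrightarrow> k \<le> d \<Longrightarrow> k mod 2 = d mod 2 \<Longrightarrow> \<not> (fval c k (M2 0 s 0 1) = 0 \<and> fval c k (M2 s 0 1 0) = 0)"
    and "1 \<le> k \<Longrightarrow> k \<le> d \<Longrightarrow> k mod 2 = d mod 2 \<Longrightarrow> fval c k (M2 1 0 0 0) \<noteq> 0"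
    and "1 \<le> k \<Longrightarrow> k \<le> d \<Longrightarrow> k mod 2 = d mod 2 \<Longrightarrow> fval c k (M2 0 1 0 0) \<noteq> 0"
    and "2 \<le> k \<Longrightarrow> k + 2 \<le> d \<Longrightarrow> k mod 2 = d mod 2 \<Longrightarrow> a \<noteq> b \<Longrightarrow>
      poly (chart_poly c k s) a = 0 \<Longrightarrow> poly (chart_poly c k s) b = 0 \<Longrightarrow>
      poly (chart_poly c (k + 2) s) a = 0 \<Longrightarrow> poly (chart_poly c (k + 2) s) b = 0 \<Longrightarrow> False"
    and "2 \<le> k \<Longrightarrow> k \<le> d \<Longrightarrow> k mod 2 = d mod 2 \<Longrightarrow> 1 \<le> k' \<Longrightarrow> k' \<le> d \<Longrightarrow> k' mod 2 = d mod 2 \<Longrightarrow> k \<noteq> k' \<Longrightarrow>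
      poly (chart_poly c k s) a = 0 \<Longrightarrow> poly (pderiv (chart_poly c k s)) a = 0 \<Longrightarrow> poly (chart_poly c k' s) a = 0 \<Longrightarrow> False"
    and "odd d \<Longrightarrow> poly (chart_poly c 1 s) a = 0 \<Longrightarrow> poly (chart_poly c 3 s) a = 0 \<Longrightarrow> poly (chart_poly c 5 s) a = 0 \<Longrightarrow> False"
    and "even d \<Longrightarrow> fval c 0 B \<noteq> 0"
  using nd unfolding nondegenerate_def fval_corner fval_0 by blast+

text \<open>The witness is a corner on the line x2 = 0 and one of the points z = 0 and z =
  \<infinity> on the other lines; for k = 0 the form is a nonzero constant.\<close>

lemma fval_nonzero_on_ruling:
  assumes "k \<le> d" "k mod 2 = d mod 2" "(x1, x2) \<noteq> (0, 0)"
  obtains v1 v2 where "fval c k (tens x1 x2 v1 v2) \<noteq> 0"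
proof (cases "k = 0")
  case True
  then have "even d" using assms(2) by presburger
  then show ?thesis using that nondegD(7) True by blast
next
  case False
  then have k: "1 \<le> k" "k \<le> d" "k mod 2 = d mod 2" using assms by auto
  show ?thesis
  proof (cases "x2 = 0")
    case True
    have "tens x1 x2 0 1 = msmult x1 (M2 0 1 0 0)" by (simp add: tens_def True)
    then have "fval c k (tens x1 x2 0 1) = x1 ^ k * fval c k (M2 0 1 0 0)" by (simp only: cform_msmult)
    then show ?thesis using that[of 0 1] nondegD(3)[OF k] assms(3) True by simp
  next
    case x2: False
    show ?thesis
    proof (cases "fval c k (M2 (x1 / x2) 0 1 0) = 0")
      case True
      then have "fval c k (M2 0 (x1 / x2) 0 1) \<noteq> 0" using nondegD(1)[OF k] by blast
      moreover have "tens x1 x2 0 1 = msmult x2 (M2 0 (x1 / x2) 0 1)" using x2 by (simp add: tens_def)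
      ultimately have "fval c k (tens x1 x2 0 1) \<noteq> 0" using x2 by (simp only: cform_msmult) simp
      then show ?thesis by (rule that)
    next
      case False
      then show ?thesis using that[of 1 0] fval_chart_inf[OF x2 one_neq_zero] by simp
    qed
  qed
qed

text \<open>Outside the chart the quadric consists of two lines crossing at a corner. On y2 = 0 two
  conditions meet one parameter, x2 = 0 is the same for the transposed coefficients, and the corner
  is excluded by an extreme coefficient.\<close>

lemma common_zero_in_chart:
  assumes k: "1 \<le> k" "k + 2 \<le> d" "k mod 2 = d mod 2" and x: "(x1, x2) \<noteq> (0, 0)" and y: "(y1, y2) \<noteq> (0, 0)"
    and f: "fval c k (tens x1 x2 y1 y2) = 0" and f2: "fval c (k + 2) (tens x1 x2 y1 y2) = 0"
  shows "x2 \<noteq> 0 \<and> y2 \<noteq> 0"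
proof -
  have inf: "\<not> (fval c' k (M2 s 0 1 0) = 0 \<and> fval c' (k + 2) (M2 s 0 1 0) = 0)" if "nondegenerate d c'" for c' s
    using that k unfolding nondegenerate_def by blast
  have y2: "y2 \<noteq> 0" if "x2 \<noteq> 0"
  proof
    assume y2: "y2 = 0"
    then have "y1 \<noteq> 0" using y by simp
    then show False using f f2 fval_chart_inf[OF that] y2 inf[OF nd] by simp
  qed
  have x2: "x2 \<noteq> 0" if "y2 \<noteq> 0"
  proof
    assume "x2 = 0"
    then have "x1 \<noteq> 0" using x by simp
    have "fval (transpose_coeffs c) k' (tens y1 y2 x1 x2) = fval c k' (tens x1 x2 y1 y2)" for k'
      using fval_transpose[of k' c "tens x1 x2 y1 y2"] by (simp add: mtransp_tens)
    then show False using f f2 fval_chart_inf[OF that \<open>x1 \<noteq> 0\<close>, where c = "transpose_coeffs c"] \<open>x2 = 0\<close> inf[OF ndt]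
      by (metis)
  qed
  show ?thesis
  proof (cases "x2 = 0 \<and> y2 = 0")
    case True
    then have "tens x1 x2 y1 y2 = msmult (x1 * y1) (M2 1 0 0 0)" by (simp add: tens_def)
    moreover have "x1 * y1 \<noteq> 0" using x y True by simp
    ultimately have False using nondegD(2)[of k] k f by (simp only: cform_msmult) simp
    then show ?thesis ..
  next
    case False
    then show ?thesis using x2 y2 by blast
  qed
qed

lemma fval_root_on_ruling:
  assumes "1 \<le> k"
  obtains v1 v2 where "(v1, v2) \<noteq> (0, 0)" "fval c k (tens x1 x2 v1 v2) = 0"
proof -
  obtain p where p: "\<And>z. fval c k (tens x1 x2 z 1) = poly p z"
    using fval_poly_on_line[of k c x1 x2 0 1 1 0] by auto
  obtain q where q: "\<And>z. fval c k (tens x1 x2 1 z) = poly q z"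
    using fval_poly_on_line[of k c x1 x2 1 0 0 1] by auto
  show ?thesis
  proof (cases "\<exists>z. poly p z = 0")
    case True
    then show ?thesis using that p by (metis prod.inject zero_neq_one)
  next
    case False
    then have "constant (poly p)" using fundamental_theorem_of_algebra by blast
    then have const: "poly p z = poly p 0" for z unfolding constant_def by blast
    \<comment> \<open>Without an affine root the form is a constant times the k-th power of the
      second coordinate, hence vanishes at (1, 0) since k \<ge> 1.\<close>
    have "poly (q - monom (poly p 0) k) z = 0" if "z \<noteq> 0" for z
    proof -
      have "tens x1 x2 1 z = msmult z (tens x1 x2 (1 / z) 1)" using that by (simp add: tens_def)
      then show ?thesis using p[of "1 / z"] const[of "1 / z"] by (simp add: q[symmetric] cform_msmult poly_monom)
    qed
    then have "- {0} \<subseteq> {z. poly (q - monom (poly p 0) k) z = 0}" by auto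
    moreover have "infinite (- {0 :: complex})" using infinite_UNIV_char_0 by (simp add: finite_compl)
    ultimately have "q - monom (poly p 0) k = 0" using poly_roots_finite finite_subset by blast
    then have "poly q 0 = 0" using assms by (simp add: poly_monom)
    then show ?thesis using that[of 1 0] q[of 0] by simp
  qed
qed

text \<open>A zero at z = \<infinity> would be common to both forms outside the chart, so the
  restriction of f_k has degree k \<ge> 2. Its two roots, distinct or coinciding, are all shared
  with f_(k+2).\<close>

lemma common_roots_contradiction:
  assumes k: "2 \<le> k" "k + 2 \<le> d" "k mod 2 = d mod 2" and x: "(x1, x2) \<noteq> (0, 0)"
    and sub: "\<And>v1 v2. (v1, v2) \<noteq> (0, 0) \<Longrightarrow> fval c k (tens x1 x2 v1 v2) = 0 \<Longrightarrow> fval c (k + 2) (tens x1 x2 v1 v2) = 0"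
  shows False
proof -
  obtain v1 v2 where v: "(v1, v2) \<noteq> (0, 0)" "fval c k (tens x1 x2 v1 v2) = 0"
    using fval_root_on_ruling[of k x1 x2] k by auto
  note chart = common_zero_in_chart[OF _ k(2,3) x]
  have x2: "x2 \<noteq> 0" using chart[OF _ v sub[OF v]] k by auto
  let ?p = "chart_poly c k (x1 / x2)" and ?q = "chart_poly c (k + 2) (x1 / x2)"
  have "coeff ?p k \<noteq> 0"
  proof
    assume "coeff ?p k = 0"
    then have "fval c k (tens x1 x2 1 0) = 0" using fval_chart_inf[OF x2 one_neq_zero] by (simp add: coeff_chart_poly)
    then show False using chart[of 1 0] sub[of 1 0] k by auto
  qed
  then have deg: "degree ?p \<ge> 2" using le_degree k(1) by (meson order_trans)
  have root: "poly ?q z = 0" if "poly ?p z = 0" for z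
    using that fval_chart[OF x2 one_neq_zero, of _ _ x1 z] sub[of z 1] by auto
  show False
    using poly_two_roots_or_double_root[OF deg]
  proof
    assume "\<exists>a b. a \<noteq> b \<and> poly ?p a = 0 \<and> poly ?p b = 0"
    then show False using nondegD(4)[OF k] root by blast
  next
    assume "\<exists>a. poly ?p a = 0 \<and> poly (pderiv ?p) a = 0"
    then show False using nondegD(5)[of k "k + 2"] root k by auto
  qed
qed

text \<open>The root of E is a simple zero of f_(r+2), and all other zeros of that form are zeros of
  f_r. For r = 0 there is such a zero, contradicting the nonzero constant. For r = 1 there are two
  distinct ones, and the linear form f_1 would vanish on the whole line.\<close>

lemma first_level_contradiction:
  fixes E :: "complex \<Rightarrow> complex \<Rightarrow> complex"
  defines "r \<equiv> d mod 2"
  assumes x: "(x1, x2) \<noteq> (0, 0)" and w: "(w1, w2) \<noteq> (0, 0)" "E w1 w2 = 0"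
    and E0: "\<And>v1 v2. (v1, v2) \<noteq> (0, 0) \<Longrightarrow> E v1 v2 = 0 \<Longrightarrow>
      fval c (r + 2) (tens x1 x2 v1 v2) = 0 \<and> fval c (r + 4) (tens x1 x2 v1 v2) = 0"
    and E1: "\<And>v1 v2. E v1 v2 \<noteq> 0 \<Longrightarrow> fval c (r + 2) (tens x1 x2 v1 v2) = 0 \<Longrightarrow> fval c r (tens x1 x2 v1 v2) = 0"
  shows False
proof -
  have r: "r = 0 \<and> even d \<or> r = 1 \<and> odd d" unfolding r_def by presburger
  have rd: "r + 4 \<le> d" using d r by presburger
  have rmod: "(r + 2) mod 2 = d mod 2" "r mod 2 = d mod 2" "(r + 4) mod 2 = d mod 2"
    using r unfolding r_def by auto
  have k: "2 \<le> r + 2" "r + 2 + 2 \<le> d" "(r + 2) mod 2 = d mod 2" using rd rmod by auto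
  have four: "r + 2 + 2 = r + 4" by simp
  note chart = common_zero_in_chart[OF _ k(2,3) x, unfolded four]
  have xw: "x2 \<noteq> 0" "w2 \<noteq> 0" using chart[of w1 w2] w E0 by auto
  define s where "s = x1 / x2"
  let ?p = "chart_poly c (r + 2) s" and ?q = "chart_poly c (r + 4) s" and ?u = "chart_poly c r s"
  define a where "a = w1 / w2"
  have ch: "fval c k (tens x1 x2 z 1) = 0 \<longleftrightarrow> poly (chart_poly c k s) z = 0" for k z
    using fval_chart[OF xw(1) one_neq_zero, of k c x1 z] by (simp add: s_def)
  have a: "poly ?p a = 0" "poly ?q a = 0"
    using E0[OF w] fval_chart[OF xw] by (simp_all add: s_def a_def)
  have E0': "poly ?p z = 0 \<and> poly ?q z = 0" if "E z 1 = 0" for z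
    using E0[of z 1] that ch by simp
  have E1': "poly ?u z = 0" if "E z 1 \<noteq> 0" "poly ?p z = 0" for z
    using E1[of z 1] that ch by simp
  \<comment> \<open>A second zero of E in the chart would be a second common zero of f_(r+2) and
    f_(r+4).\<close>
  have other: "E b 1 \<noteq> 0" if "b \<noteq> a" for b
    using nondegD(4)[OF k, unfolded four, of b a s] that a E0'[of b] by auto
  have dbl: "poly (pderiv ?p) b \<noteq> 0"
    if "poly ?p b = 0" "poly (chart_poly c k' s) b = 0" "1 \<le> k'" "k' \<le> d" "k' mod 2 = d mod 2" "r + 2 \<noteq> k'" for b k'
    using nondegD(5)[of "r + 2" k' s b] k that by auto
  have "coeff ?p (r + 2) \<noteq> 0"
  proof
    assume "coeff ?p (r + 2) = 0"
    then have 0: "fval c (r + 2) (tens x1 x2 1 0) = 0"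
      using fval_chart_inf[OF xw(1) one_neq_zero] by (simp add: coeff_chart_poly s_def)
    \<comment> \<open>A zero of E is common to f_(r+2) and f_(r+4), hence cannot lie at
      infinity.\<close>
    have "E 1 0 \<noteq> 0" using chart[of 1 0] E0[of 1 0] by auto
    then have u: "fval c r (tens x1 x2 1 0) = 0" using E1 0 by blast
    show False
    proof (cases "r = 0")
      case True
      then show False using u r nondegD(7) by auto
    next
      case False
      then have "1 \<le> r" by simp
      then show False using common_zero_in_chart[of r x1 x2 1 0] u 0 x rd rmod by auto
    qed
  qed
  then have deg: "degree ?p = r + 2" using degree_chart_poly[of c "r + 2" s] le_degree by (metis le_antisym)
  have da: "poly (pderiv ?p) a \<noteq> 0" by (rule dbl[OF a]) (use rd rmod in auto)
  obtain g where g: "?p = [:- a, 1:] * g" "degree ?p = Suc (degree g)" "poly g a \<noteq> 0"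
    by (rule poly_simple_root_quotient[OF a(1) _ da]) (use deg in auto)
  have gp: "poly ?p z = 0" if "poly g z = 0" for z unfolding g using that by simp
  have "degree g \<ge> 1" using g(2) deg by simp
  then obtain b where b: "poly g b = 0" using poly_root_exists by blast
  have ba: "b \<noteq> a" using b g(3) by auto
  have ub: "poly ?u b = 0" using E1'[OF other[OF ba]] gp[OF b] by blast
  show False
  proof (cases "r = 0")
    case True
    then have "fval c 0 (tens x1 x2 b 1) = 0" using ub ch[of 0 b] by simp
    then show False using True r nondegD(7) by auto
  next
    case False
    then have r1: "r = 1" "odd d" using r by auto
    \<comment> \<open>A double root of f_3 at b would also be a zero of f_1, which is excluded; so
      the third root differs from b.\<close>
    have "poly (pderiv ?p) b \<noteq> 0" using dbl[OF gp[OF b] ub] r1 rd rmod by auto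
    moreover have "poly (pderiv ?p) b = (b - a) * poly (pderiv g) b"
      unfolding g pderiv_mult using b by (simp add: pderiv_pCons algebra_simps)
    ultimately have "poly (pderiv g) b \<noteq> 0" by auto
    then obtain h where h: "g = [:- b, 1:] * h" "degree g = Suc (degree h)" "poly h b \<noteq> 0"
      using poly_simple_root_quotient[OF b \<open>degree g \<ge> 1\<close>] by blast
    have "degree h \<ge> 1" using h(2) g(2) deg r1 by simp
    then obtain b' where b': "poly h b' = 0" using poly_root_exists by blast
    have gb': "poly g b' = 0" unfolding h(1) using b' by simp
    have "b' \<noteq> a" using gb' g(3) by auto
    then have ub': "poly ?u b' = 0" using E1'[OF other] gp[OF gb'] by blast
    have "b' \<noteq> b" using b' h(3) by auto
    have "?u = 0"
    proof (rule ccontr)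
      assume nz: "?u \<noteq> 0"
      have "card {b, b'} \<le> card {z. poly ?u z = 0}"
        using ub ub' by (intro card_mono poly_roots_finite nz) auto
      also have "\<dots> \<le> degree ?u" by (rule card_poly_roots_bound[OF nz])
      also have "\<dots> \<le> 1" using degree_chart_poly[of c r s] r1 by simp
      finally show False using \<open>b' \<noteq> b\<close> by simp
    qed
    then have "poly ?u 0 = 0" "coeff ?u r = 0" by simp_all
    then have "fval c r (M2 0 s 0 1) = 0 \<and> fval c r (M2 s 0 1 0) = 0"
      unfolding poly_chart_poly coeff_chart_poly by simp
    then show False using nondegD(1)[of r s] r1 rd rmod by auto
  qed
qed

text \<open>Of the quadratic form only one zero, one nonzero value and polynomiality along lines are
  retained, so that it may be given in any linear coordinates of the moving factor.\<close>

lemma ruling_contradiction: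
  fixes E :: "complex \<Rightarrow> complex \<Rightarrow> complex"
  assumes x: "(x1, x2) \<noteq> (0, 0)" and \<gamma>: "\<gamma> > 0"
    and u: "E u1 u2 \<noteq> 0" and w: "(w1, w2) \<noteq> (0, 0)" "E w1 w2 = 0"
    and E: "\<And>v1 v2 z1 z2. \<exists>p. \<forall>z. E (v1 + z * z1) (v2 + z * z2) = poly p z"
    and T: "\<And>v1 v2. E v1 v2 \<noteq> 0 \<Longrightarrow> tropical_cond d c \<gamma> (E v1 v2) (tens x1 x2 v1 v2)"
    and T0: "\<And>v1 v2 \<alpha>. E v1 v2 = 0 \<Longrightarrow> (v1, v2) \<noteq> (0, 0) \<Longrightarrow> \<alpha> > \<gamma> \<Longrightarrow> tropical_cond d c \<alpha> 1 (tens x1 x2 v1 v2)"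
  shows False
  using \<gamma>
proof (cases rule: level_cases[where n = "d div 2"])
  case (2 j)
  let ?k = "2 * j + d mod 2"
  have k: "?k \<le> d" "?k mod 2 = d mod 2" using 2(1) by (presburger, simp)
  obtain v1 v2 where v: "fval c ?k (tens x1 x2 v1 v2) \<noteq> 0" using fval_nonzero_on_ruling[OF k x] by blast
  \<comment> \<open>On the line joining a point where the form is nonzero to one where E is, both
    restrict to nonzero polynomials; a parameter avoiding their roots contradicts the condition at
    level \<gamma>.\<close>
  obtain p where p: "\<And>z. fval c ?k (tens x1 x2 (v1 + z * (u1 - v1)) (v2 + z * (u2 - v2))) = poly p z"
    using fval_poly_on_line by blast
  obtain q where q: "\<And>z. E (v1 + z * (u1 - v1)) (v2 + z * (u2 - v2)) = poly q z"
    using E by blast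
  have "p \<noteq> 0" "q \<noteq> 0" using p[of 0] q[of 1] u v by auto
  then have "finite {z. poly (p * q) z = 0}" by (intro poly_roots_finite) simp
  then obtain z where "poly (p * q) z \<noteq> 0" using infinite_UNIV_char_0 by (metis (mono_tags) UNIV_eq_I mem_Collect_eq)
  then have "poly p z \<noteq> 0" "poly q z \<noteq> 0" by auto
  then show False using tropical_cond_interior[OF T 2] p q by metis
next
  case (1 j)
  \<comment> \<open>For i > j the level i + 1/2 exceeds \<gamma> = j + 1 and lies inside the i-th
    interval, so every higher form vanishes at the roots of E.\<close>
  have half: "fval c (2 * i + d mod 2) (tens x1 x2 v1 v2) = 0"
    if "E v1 v2 = 0" "(v1, v2) \<noteq> (0, 0)" "j < i" "i \<le> d div 2" for i v1 v2
  proof -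
    have "of_nat j + 1 \<le> (of_nat i :: rat)" using that(3) by (metis Suc_leI of_nat_Suc of_nat_le_iff add.commute)
    then have "tropical_cond d c (of_nat i + 1 / 2) 1 (tens x1 x2 v1 v2)" using T0[OF that(1,2)] 1 by simp
    then show ?thesis using that(4) by (rule tropical_cond_interior) auto
  qed
  have T': "fval c (2 * j + 2 + d mod 2) (tens x1 x2 v1 v2) = 0 \<longleftrightarrow> fval c (2 * j + d mod 2) (tens x1 x2 v1 v2) = 0"
    if "E v1 v2 \<noteq> 0" for v1 v2
    using tropical_cond_integer[OF T[OF that, unfolded 1(2)] 1(1) that] .
  show False
  proof (cases "j = 0")
    case False
    show False
    proof (rule common_roots_contradiction[OF _ _ _ x, of "2 * j + d mod 2"])
      show "2 \<le> 2 * j + d mod 2" "(2 * j + d mod 2) mod 2 = d mod 2" using False by auto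
      show "2 * j + d mod 2 + 2 \<le> d" using 1(1) by presburger
      fix v1 v2 :: complex assume v: "(v1, v2) \<noteq> (0, 0)" "fval c (2 * j + d mod 2) (tens x1 x2 v1 v2) = 0"
      have eq: "2 * j + d mod 2 + 2 = 2 * j + 2 + d mod 2" "2 * j + d mod 2 + 2 = 2 * Suc j + d mod 2" by simp_all
      show "fval c (2 * j + d mod 2 + 2) (tens x1 x2 v1 v2) = 0"
      \<comment> \<open>Off the roots of E the integer level transfers the zero; at a root the
        higher form vanishes anyway.\<close>
      proof (cases "E v1 v2 = 0")
        case True
        then show ?thesis unfolding eq(2) using v 1(1) by (intro half) auto
      next
        case False
        then show ?thesis unfolding eq(1) using T' v by blast
      qed
    qed
  next
    case True
    have n: "2 \<le> d div 2" using d by simp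
    show False
    proof (rule first_level_contradiction[where E = E, OF x w])
      fix v1 v2 :: complex
      show "fval c (d mod 2 + 2) (tens x1 x2 v1 v2) = 0 \<and> fval c (d mod 2 + 4) (tens x1 x2 v1 v2) = 0"
        if "(v1, v2) \<noteq> (0, 0)" "E v1 v2 = 0"
        using half[OF that(2,1), of 1] half[OF that(2,1), of 2] n True by (simp add: add.commute)
      show "fval c (d mod 2) (tens x1 x2 v1 v2) = 0" if "E v1 v2 \<noteq> 0" "fval c (d mod 2 + 2) (tens x1 x2 v1 v2) = 0"
        using T'[OF that(1)] that(2) True by (simp add: add.commute)
    qed
  qed
qed

text \<open>All half-integer levels are available, so every form of the equation vanishes at
  \<open>B\<close>. This is impossible for the nonzero constant if \<open>d\<close> is even, and for
  f_1, f_3, f_5 if \<open>d\<close> is odd.\<close>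

lemma transversal_contradiction:
  assumes "mdet B = 0" "B \<noteq> mzero" and T: "\<And>\<alpha>. \<alpha> > 0 \<Longrightarrow> tropical_cond d c \<alpha> 1 B"
  shows False
proof -
  have n: "2 \<le> d div 2" using d by simp
  have f: "fval c (2 * j + d mod 2) B = 0" if "j \<le> d div 2" for j
    using T[of "of_nat j + 1 / 2"] that by (intro tropical_cond_interior) auto
  show False
  proof (cases "even d")
    case True
    then show False using f[of 0] nondegD(7) by simp
  next
    case False
    then have d1: "d mod 2 = 1" by presburger
    have 135: "fval c 1 B = 0" "fval c 3 B = 0" "fval c 5 B = 0" using f[of 0] f[of 1] f[of 2] n d1 by simp_all
    obtain x1 x2 y1 y2 where B: "(x1, x2) \<noteq> (0, 0)" "(y1, y2) \<noteq> (0, 0)" "B = tens x1 x2 y1 y2"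
      using assms(1,2) by (rule det_0_tens)
    have "x2 \<noteq> 0 \<and> y2 \<noteq> 0" using common_zero_in_chart[of 1 x1 x2 y1 y2] B 135 d d1 by (simp add: numeral_3_eq_3)
    then show False using nondegD(6)[OF False] 135 fval_chart B(3) by metis
  qed
qed

lemma line_in_ruling_contradiction:
  assumes x: "(x1, x2) \<noteq> (0, 0)" and D: "y1 * z2 - y2 * z1 \<noteq> 0" and \<gamma>: "\<gamma> > 0" and efg: "(e, f, g) \<noteq> (0, 0, 0)"
    and T: "\<And>l m. qform e f g l m \<noteq> 0 \<Longrightarrow>
      tropical_cond d c \<gamma> (qform e f g l m) (tens x1 x2 (l * y1 + m * z1) (l * y2 + m * z2))"
    and T0: "\<And>l m \<alpha>. qform e f g l m = 0 \<Longrightarrow> (l, m) \<noteq> (0, 0) \<Longrightarrow> \<alpha> > \<gamma> \<Longrightarrow>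
      tropical_cond d c \<alpha> 1 (tens x1 x2 (l * y1 + m * z1) (l * y2 + m * z2))"
  shows False
proof -
  define D where "D = y1 * z2 - y2 * z1"
  have D0: "D \<noteq> 0" using D by (simp add: D_def)
  \<comment> \<open>Cramer's rule: the coordinates (l, m) on the line are recovered from the moving
    factor, which makes E a function of that factor.\<close>
  define L where "L v1 v2 = (v1 * z2 - v2 * z1) / D" for v1 v2
  define M where "M v1 v2 = (y1 * v2 - y2 * v1) / D" for v1 v2
  have LM: "L v1 v2 * y1 + M v1 v2 * z1 = v1" "L v1 v2 * y2 + M v1 v2 * z2 = v2" for v1 v2
  proof -
    have "(v1 * z2 - v2 * z1) * y1 + (y1 * v2 - y2 * v1) * z1 = D * v1"
      "(v1 * z2 - v2 * z1) * y2 + (y1 * v2 - y2 * v1) * z2 = D * v2"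
      by (simp_all add: D_def algebra_simps)
    then show "L v1 v2 * y1 + M v1 v2 * z1 = v1" "L v1 v2 * y2 + M v1 v2 * z2 = v2"
      using D0 by (simp_all add: L_def M_def flip: add_divide_distrib)
  qed
  have inv: "L (l * y1 + m * z1) (l * y2 + m * z2) = l" "M (l * y1 + m * z1) (l * y2 + m * z2) = m" for l m
  proof -
    have "(l * y1 + m * z1) * z2 - (l * y2 + m * z2) * z1 = D * l" "y1 * (l * y2 + m * z2) - y2 * (l * y1 + m * z1) = D * m"
      by (simp_all add: D_def algebra_simps)
    then show "L (l * y1 + m * z1) (l * y2 + m * z2) = l" "M (l * y1 + m * z1) (l * y2 + m * z2) = m"
      using D0 by (simp_all add: L_def M_def)
  qed
  let ?E = "\<lambda>v1 v2. qform e f g (L v1 v2) (M v1 v2)"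
  obtain l m where u: "qform e f g l m \<noteq> 0" using qform_nonzero_value[OF efg] .
  obtain l' m' where w: "(l', m') \<noteq> (0, 0)" "qform e f g l' m' = 0" by (rule qform_nontrivial_root)
  show False
  proof (rule ruling_contradiction[where E = ?E, OF x \<gamma>])
    show "?E (l * y1 + m * z1) (l * y2 + m * z2) \<noteq> 0" using u by (simp add: inv)
    show "?E (l' * y1 + m' * z1) (l' * y2 + m' * z2) = 0" using w by (simp add: inv)
    show "(l' * y1 + m' * z1, l' * y2 + m' * z2) \<noteq> (0, 0)"
    proof
      assume "(l' * y1 + m' * z1, l' * y2 + m' * z2) = (0, 0)"
      then have "l' = L 0 0" "m' = M 0 0" using inv[of l' m'] by auto
      then show False using w by (simp add: L_def M_def)
    qed
    show "\<exists>p. \<forall>z. ?E (v1 + z * w1) (v2 + z * w2) = poly p z" for v1 v2 w1 w2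
    proof (intro exI allI)
      fix z
      let ?l = "[:L v1 v2, L w1 w2:]" and ?m = "[:M v1 v2, M w1 w2:]"
      have "L (v1 + z * w1) (v2 + z * w2) = poly ?l z" "M (v1 + z * w1) (v2 + z * w2) = poly ?m z"
        using D0 by (simp_all add: L_def M_def field_simps)
      then show "?E (v1 + z * w1) (v2 + z * w2) = poly ([:e:] * ?l * ?l + [:f:] * ?l * ?m + [:g:] * ?m * ?m) z"
        unfolding qform_def by (simp only: poly_add poly_mult) simp
    qed
    show "tropical_cond d c \<gamma> (?E v1 v2) (tens x1 x2 v1 v2)" if "?E v1 v2 \<noteq> 0" for v1 v2
      using T[OF that] by (simp only: LM)
    show "tropical_cond d c \<alpha> 1 (tens x1 x2 v1 v2)" if "?E v1 v2 = 0" "(v1, v2) \<noteq> (0, 0)" "\<alpha> > \<gamma>" for v1 v2 \<alpha>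
    proof -
      have "(L v1 v2, M v1 v2) \<noteq> (0, 0)" using LM[of v1 v2] that(2) by auto
      from T0[OF that(1) this that(3)] show ?thesis by (simp only: LM)
    qed
  qed
qed

end

section \<open>Conclusion for both rulings\<close>

lemma lincomb_tens:
  "lincomb l m (tens x1 x2 y1 y2) (tens x1 x2 z1 z2) = tens x1 x2 (l * y1 + m * z1) (l * y2 + m * z2)"
  by (simp add: tens_def lincomb_M2 algebra_simps)

lemma lincomb_mtransp: "lincomb l m (mtransp P) (mtransp Q) = mtransp (lincomb l m P Q)"
  by (cases P; cases Q) (simp add: lincomb_M2)

lemma tropical_cond_transpose:
  "tropical_cond d (transpose_coeffs c) \<alpha> \<delta> (mtransp B) = tropical_cond d c \<alpha> \<delta> B"
  by (simp add: tropical_cond_def fval_transpose)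

lemma no_line_if_nondegenerate:
  assumes d: "d > 3" and nd: "nondegenerate d c" "nondegenerate d (transpose_coeffs c)"
    and L: "is_kline L" and sub: "VALs L \<subseteq> VALs (surface d c)"
  shows False
  using L sub
proof (cases rule: VAL_line_conditions)
  case (1 P Q)
  have zero: "mdet (lincomb l m P Q) = 0 \<and> fval c d (lincomb l m P Q) = 0" for l m
  proof (cases "(l, m) = (0, 0)")
    case True
    have "fval c d (msmult 0 P) = 0" using d by (simp only: cform_msmult) simp
    moreover have "msmult 0 P = mzero" by (cases P) (simp add: mzero_def)
    ultimately show ?thesis using True by (simp add: lincomb_0) (simp add: mzero_def)
  next
    case False
    then show ?thesis by (rule 1(2))
  qed
  \<comment> \<open>A line inside det = 0 would lie on f_d = 0, although f_d vanishes on no ruling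
    line. The claim is made for arbitrary coefficients because the second ruling needs it for the
    transposed ones.\<close>
  have *: False if nd: "nondegenerate d c" "nondegenerate d (transpose_coeffs c)" and x: "(x1, x2) \<noteq> (0, 0)" and D: "y1 * z2 - y2 * z1 \<noteq> 0"
    and f: "\<And>l m. fval c d (lincomb l m (tens x1 x2 y1 y2) (tens x1 x2 z1 z2)) = 0" for c x1 x2 y1 y2 z1 z2
  proof -
    obtain v1 v2 where v: "fval c d (tens x1 x2 v1 v2) \<noteq> 0"
      using fval_nonzero_on_ruling[OF d nd order_refl refl x] .
    let ?D = "y1 * z2 - y2 * z1"
    let ?l = "(v1 * z2 - v2 * z1) / ?D" and ?m = "(y1 * v2 - y2 * v1) / ?D"
    have "(v1 * z2 - v2 * z1) * y1 + (y1 * v2 - y2 * v1) * z1 = ?D * v1"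
      "(v1 * z2 - v2 * z1) * y2 + (y1 * v2 - y2 * v1) * z2 = ?D * v2"
      by (simp_all add: algebra_simps)
    then have "?l * y1 + ?m * z1 = v1" "?l * y2 + ?m * z2 = v2"
      using D by (simp_all flip: add_divide_distrib)
    then show False using f[of ?l ?m] v unfolding lincomb_tens by simp
  qed
  show False
  proof (rule line_on_quadric[OF 1(1) zero[THEN conjunct1]])
    fix x1 x2 y1 y2 z1 z2
    assume 2: "(x1, x2) \<noteq> (0, 0)" "y1 * z2 - y2 * z1 \<noteq> 0" "P = tens x1 x2 y1 y2" "Q = tens x1 x2 z1 z2"
    show False using *[OF nd 2(1,2)] zero unfolding 2(3,4) by blast
  next
    fix x1 x2 y1 y2 z1 z2
    assume 2: "(x1, x2) \<noteq> (0, 0)" "y1 * z2 - y2 * z1 \<noteq> 0" "P = tens y1 y2 x1 x2" "Q = tens z1 z2 x1 x2"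
    have "fval (transpose_coeffs c) d (lincomb l m (tens x1 x2 y1 y2) (tens x1 x2 z1 z2)) = 0" for l m
      using zero[of l m] fval_transpose[of d c "lincomb l m P Q"] by (simp add: 2 mtransp_tens flip: lincomb_mtransp)
    then show False using *[OF nd(2) _ 2(1,2)] nd(1) transpose_transpose by simp
  qed
next
  case (2 P Q \<gamma> e f g)
  show False
  proof (cases "\<gamma> = 0")
    case True
    obtain l m where lm: "(l, m) \<noteq> (0, 0)" "qform e f g l m = 0" by (rule qform_nontrivial_root)
    show False
    proof (rule transversal_contradiction[OF d nd])
      show "mdet (lincomb l m P Q) = 0" using 2(4)[OF True] lm by simp
      show "lincomb l m P Q \<noteq> mzero" using 2(1) lm by auto
      show "tropical_cond d c \<alpha> 1 (lincomb l m P Q)" if "\<alpha> > 0" for \<alpha> using 2(7)[OF lm(2,1)] that True by simp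
    qed
  next
    case False
    then have \<gamma>: "\<gamma> > 0" using 2(3) by simp
    show False
    proof (rule line_on_quadric[OF 2(1) 2(5)[OF \<gamma>]])
      fix x1 x2 y1 y2 z1 z2
      assume 1: "(x1, x2) \<noteq> (0, 0)" "y1 * z2 - y2 * z1 \<noteq> 0" "P = tens x1 x2 y1 y2" "Q = tens x1 x2 z1 z2"
      show False
        by (rule line_in_ruling_contradiction[OF d nd 1(1,2) \<gamma> 2(2)])
           (use 2(6)[OF \<gamma>] 2(7) in \<open>simp_all add: 1 lincomb_tens\<close>)
    next
      fix x1 x2 y1 y2 z1 z2
      assume t: "(x1, x2) \<noteq> (0, 0)" "y1 * z2 - y2 * z1 \<noteq> 0" "P = tens y1 y2 x1 x2" "Q = tens z1 z2 x1 x2"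
      \<comment> \<open>Transposing matrices and coefficients together carries a line of the second
        ruling to one of the first.\<close>
      have tr: "tropical_cond d (transpose_coeffs c) \<alpha> \<delta> (tens x1 x2 (l * y1 + m * z1) (l * y2 + m * z2)) =
          tropical_cond d c \<alpha> \<delta> (lincomb l m P Q)" for \<alpha> \<delta> l m
        using tropical_cond_transpose[of d c \<alpha> \<delta> "lincomb l m P Q"]
        by (simp add: t mtransp_tens lincomb_tens flip: lincomb_mtransp)
      show False
        by (rule line_in_ruling_contradiction[of d "transpose_coeffs c", OF d nd(2) _ t(1,2) \<gamma> 2(2)])
           (use 2(6)[OF \<gamma>] 2(7) nd(1) in \<open>simp_all only: tr transpose_transpose\<close>)
    qed
  qed
qed

theorem theorem6p1:
  fixes d :: nat
  assumes "d > 3"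
  shows "\<exists>Z. zariski_closed_in (coef_space d) Z \<and> Z \<noteq> coef_space d \<and>
    (\<forall>c \<in> coef_space d - Z.
       (\<forall>j \<le> d div 2. \<not> det_dvd (2 * j + d mod 2) (\<lambda>m. c (2 * j + d mod 2, m))) \<longrightarrow>
       \<not> (\<exists>L. is_kline L \<and> VALs L \<subseteq> VALs (surface d c)))"
proof -
  have "generically (coef_space d) (\<lambda>c. nondegenerate d c \<and> nondegenerate d (transpose_coeffs c))"
    using generically_conj[where V = "coef_index d", folded coef_space_eq] generically_nondegenerate[OF assms]
      generically_transpose by blast
  then obtain p c where p: "p \<in> polyfun" "c \<in> coef_space d" "p c \<noteq> 0"
    and nd: "\<And>c. c \<in> coef_space d \<Longrightarrow> p c \<noteq> 0 \<Longrightarrow> nondegenerate d c \<and> nondegenerate d (transpose_coeffs c)"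
    unfolding generically_def by blast
  let ?Z = "{c \<in> coef_space d. p c = 0}"
  have "zariski_closed_in (coef_space d) ?Z"
    unfolding zariski_closed_in_def using p(1) by (intro exI[of _ "{p}"]) auto
  moreover have "?Z \<noteq> coef_space d" using p by blast
  moreover have "\<not> (\<exists>L. is_kline L \<and> VALs L \<subseteq> VALs (surface d c))" if "c \<in> coef_space d - ?Z" for c
    using no_line_if_nondegenerate[OF assms] nd[of c] that by blast
  ultimately show ?thesis by (intro exI[of _ ?Z]) auto
qed

end
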